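(* Let $X$ be a smooth and strictly convex real normed space with finite dimension $d$. Suppose $G'$ is obtained from a finite simple graph $G$ by a $d$-dimensional vertex split. If $G$ is independent in $X$ then $G'$ is independent in $X$. Further, if both $G$ and $G'$ are independent in $X$, then $G'$ is rigid in $X$ if and only if $G$ is rigid in $X$.
   Context: Vertex split: let $G=(V,E)$ contain a vertex $v_0$ and edges $v_0v_i\in E$ for $i=1,\dots,d-1$ (with $v_1,\dots,v_{d-1}$ distinct). A graph $G'$ is obtained from $G$ by a $d$-dimensional vertex split at $v_0$ and edges $v_0v_1,\dots,v_0v_{d-1}$ by the following process: (i) adjoin a new vertex $w_0$ together with the edges $w_0v_0,w_0v_1,\dots,w_0v_{d-1}$; (ii) for every edge $v_0w\in E$ with $w\notin\{v_1,\dots,v_{d-1}\}$, either leave the edge as it is or replace it with the edge $w_0w$. Let $X$ be a finite dimensional real normed space with dual $X^*$. A linear functional $f:X\to\mathbb{R}$ supports a non-zero point $x_0\in X$ if $f(x_0)=\|x_0\|^2$ and $\sup_{\|x\|\le1}|f(x)|=\|x_0\|$. If exactly one linear functional supports $x_0$ then $x_0$ is called smooth and $\varphi_{x_0}$ denotes this functional. $X$ is smooth if every non-zero point is smooth, and strictly convex if $\|x+y\|<\|x\|+\|y\|$ whenever $x,y$ are non-zero and $x$ is not a scalar multiple of $y$ (equivalently, if the closed unit ball of $X$ is strictly convex). A placement of $G=(V,E)$ in $X$ is a point $p=(p_v)_{v\in V}\in X^V$ with $p_v\neq p_w$ for each $vw\in E$; it is well-positioned if $p_v-p_w$ is smooth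 for every $vw\in E$. Fix a basis $b_1,\dots,b_d$ of $X$. For well-positioned $p$, the rigidity matrix $R(G,p)$ has rows indexed by $E$ and columns indexed by $V\times\{1,\dots,d\}$; for $e=vw$ its $(e,(v,k))$ entry is $\varphi_{p_v-p_w}(b_k)$, its $(e,(w,k))$ entry is $\varphi_{p_w-p_v}(b_k)=-\varphi_{p_v-p_w}(b_k)$, and the remaining entries of row $e$ are $0$. $(G,p)$ is independent if the rows of $R(G,p)$ are linearly independent, and regular if $\operatorname{rank}R(G,p)$ is maximal among all well-positioned placements of $G$ in $X$. Let $\mathcal{O}_p$ be the set of $p'\in X^V$ for which there is an isometry $T:X\to X$ with $p_v=T(p'_v)$ for all $v\in V$; it is a smooth submanifold of $X^V$, and $\mathcal{T}(p)$ denotes its tangent space at $p$. A regular framework $(G,p)$ is rigid in $X$ if $\operatorname{rank}R(G,p)=d|V|-\dim\mathcal{T}(p)$. The graph $G$ is independent (resp. rigid) in $X$ if $(G,p)$ is independent (resp. rigid) for some placement $p$. *)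

theory Defs
  imports "HOL-Analysis.Analysis" "HOL-Library.Function_Algebras"
begin

(* The real vector space structure on functions 'i => 'a. It is used for the rows of the rigidity
   matrix (elements of real^(V x {1..d})) and for the subspaces of X^V, so that independence and
   dimension of these are the library notions. *)
instantiation "fun" :: (type, real_vector) real_vector
begin

definition scaleR_fun :: "real \<Rightarrow> ('a \<Rightarrow> 'b) \<Rightarrow> 'a \<Rightarrow> 'b"
  where "scaleR_fun c f = (\<lambda>x. c *\<^sub>R f x)"

instance
  by standard (simp_all add: scaleR_fun_def fun_eq_iff algebra_simps)

end

definition simple_graph :: "'v set \<Rightarrow> 'v set set \<Rightarrow> bool"
  where "simple_graph V E \<longleftrightarrow> finite V \<and> E \<subseteq> {{v, w} | v w. v \<in> V \<and> w \<in> V \<and> v \<noteq> w}"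

(* M is the set of those w for which v0w is replaced with w0w in step (ii). *)
definition vertex_split ::
  "nat \<Rightarrow> 'v set \<Rightarrow> 'v set set \<Rightarrow> 'v set \<Rightarrow> 'v set set \<Rightarrow> bool"
  where "vertex_split d V E V' E' \<longleftrightarrow>
    (\<exists>v0 w0 vs M.
       v0 \<in> V \<and> w0 \<notin> V \<and>
       inj_on vs {1..<d} \<and> (\<forall>i\<in>{1..<d}. {v0, vs i} \<in> E) \<and>
       M \<subseteq> {w. {v0, w} \<in> E \<and> w \<notin> vs ` {1..<d}} \<and>
       V' = insert w0 V \<and>
       E' = (E - {{v0, w} | w. w \<in> M}) \<union> {{w0, w} | w. w \<in> M}
            \<union> {{w0, v0}} \<union> {{w0, vs i} | i. i \<in> {1..<d}})"

definition supports :: "('a::real_normed_vector \<Rightarrow> real) \<Rightarrow> 'a \<Rightarrow> bool"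
  where "supports f x \<longleftrightarrow>
    linear f \<and> f x = (norm x)\<^sup>2 \<and> (SUP y\<in>{y. norm y \<le> 1}. \<bar>f y\<bar>) = norm x"

definition smooth_point :: "'a::real_normed_vector \<Rightarrow> bool"
  where "smooth_point x \<longleftrightarrow> x \<noteq> 0 \<and> (\<exists>!f. supports f x)"

definition support_functional :: "'a::real_normed_vector \<Rightarrow> 'a \<Rightarrow> real"
  where "support_functional x = (THE f. supports f x)"

definition smooth_space :: "'a::real_normed_vector itself \<Rightarrow> bool"
  where "smooth_space _ \<longleftrightarrow> (\<forall>x::'a. x \<noteq> 0 \<longrightarrow> smooth_point x)"

definition strictly_convex_space :: "'a::real_normed_vector itself \<Rightarrow> bool"
  where "strictly_convex_space _ \<longleftrightarrow>
    (\<forall>x y::'a. x \<noteq> 0 \<longrightarrow> y \<noteq> 0 \<longrightarrow> (\<nexists>c. x = c *\<^sub>R y) \<longrightarrow> norm (x + y) < norm x + norm y)"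

definition indexed_basis :: "nat \<Rightarrow> (nat \<Rightarrow> 'a::real_vector) \<Rightarrow> bool"
  where "indexed_basis d b \<longleftrightarrow>
    inj_on b {1..d} \<and> independent (b ` {1..d}) \<and> span (b ` {1..d}) = UNIV"

(* The space X^V, as the space of functions vanishing off V, so that it is a subspace of the
   function space. *)
definition config_space :: "'v set \<Rightarrow> ('v \<Rightarrow> 'a::real_normed_vector) set"
  where "config_space V = {p. \<forall>v. v \<notin> V \<longrightarrow> p v = 0}"

definition placement :: "'v set \<Rightarrow> 'v set set \<Rightarrow> ('v \<Rightarrow> 'a::real_normed_vector) \<Rightarrow> bool"
  where "placement V E p \<longleftrightarrow> p \<in> config_space V \<and> (\<forall>v w. {v, w} \<in> E \<longrightarrow> p v \<noteq> p w)"

definition well_positioned :: "'v set \<Rightarrow> 'v set set \<Rightarrow> ('v \<Rightarrow> 'a::real_normed_vector) \<Rightarrow> bool"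
  where "well_positioned V E p \<longleftrightarrow>
    placement V E p \<and> (\<forall>v w. {v, w} \<in> E \<longrightarrow> smooth_point (p v - p w))"

(* For an edge e = {v, w} the element of e - {v} is w, so that the entries of row e at (v, k) and
   (w, k) are the values at b k of the support functionals of p v - p w and of p w - p v. *)
definition rigidity_matrix ::
  "nat \<Rightarrow> (nat \<Rightarrow> 'a::real_normed_vector) \<Rightarrow> ('v \<Rightarrow> 'a) \<Rightarrow> 'v set \<Rightarrow> 'v \<times> nat \<Rightarrow> real"
  where "rigidity_matrix d b p e = (\<lambda>(v, k).
    if v \<in> e \<and> k \<in> {1..d}
    then support_functional (p v - p (the_elem (e - {v}))) (b k) else 0)"

definition rigidity_rank ::
  "nat \<Rightarrow> (nat \<Rightarrow> 'a::real_normed_vector) \<Rightarrow> 'v set set \<Rightarrow> ('v \<Rightarrow> 'a) \<Rightarrow> nat"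
  where "rigidity_rank d b E p = dim (rigidity_matrix d b p ` E)"

definition independent_framework ::
  "nat \<Rightarrow> (nat \<Rightarrow> 'a::real_normed_vector) \<Rightarrow> 'v set \<Rightarrow> 'v set set \<Rightarrow> ('v \<Rightarrow> 'a) \<Rightarrow> bool"
  where "independent_framework d b V E p \<longleftrightarrow>
    well_positioned V E p \<and>
    inj_on (rigidity_matrix d b p) E \<and> independent (rigidity_matrix d b p ` E)"

definition regular_framework ::
  "nat \<Rightarrow> (nat \<Rightarrow> 'a::real_normed_vector) \<Rightarrow> 'v set \<Rightarrow> 'v set set \<Rightarrow> ('v \<Rightarrow> 'a) \<Rightarrow> bool"
  where "regular_framework d b V E p \<longleftrightarrow>
    well_positioned V E p \<and>
    (\<forall>q. well_positioned V E q \<longrightarrow> rigidity_rank d b E q \<le> rigidity_rank d b E p)"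

definition isometry :: "('a::real_normed_vector \<Rightarrow> 'a) \<Rightarrow> bool"
  where "isometry T \<longleftrightarrow> (\<forall>x y. dist (T x) (T y) = dist x y)"

definition orbit :: "'v set \<Rightarrow> ('v \<Rightarrow> 'a::real_normed_vector) \<Rightarrow> ('v \<Rightarrow> 'a) set"
  where "orbit V p = {q \<in> config_space V. \<exists>T. isometry T \<and> (\<forall>v\<in>V. p v = T (q v))}"

definition smooth_curve_on :: "real set \<Rightarrow> (real \<Rightarrow> 'a::real_normed_vector) \<Rightarrow> bool"
  where "smooth_curve_on I g \<longleftrightarrow>
    (\<exists>D. D 0 = g \<and> (\<forall>n::nat. \<forall>t\<in>I. (D n has_vector_derivative D (Suc n) t) (at t)))"

(* The tangent space at p of a smooth submanifold M of X^V (V finite): the velocities at time 0 of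
   the smooth curves in M through p. *)
definition tangent_space ::
  "('v \<Rightarrow> 'a::real_normed_vector) set \<Rightarrow> ('v \<Rightarrow> 'a) \<Rightarrow> ('v \<Rightarrow> 'a) set"
  where "tangent_space M p =
    {u. \<exists>\<epsilon>>0. \<exists>\<gamma> :: real \<Rightarrow> 'v \<Rightarrow> 'a.
       (\<forall>v. smooth_curve_on {-\<epsilon><..<\<epsilon>} (\<lambda>t. \<gamma> t v)) \<and>
       (\<forall>t\<in>{-\<epsilon><..<\<epsilon>}. \<gamma> t \<in> M) \<and> \<gamma> 0 = p \<and>
       (\<forall>v. ((\<lambda>t. \<gamma> t v) has_vector_derivative u v) (at 0))}"

definition rigid_framework ::
  "nat \<Rightarrow> (nat \<Rightarrow> 'a::real_normed_vector) \<Rightarrow> 'v set \<Rightarrow> 'v set set \<Rightarrow> ('v \<Rightarrow> 'a) \<Rightarrow> bool"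
  where "rigid_framework d b V E p \<longleftrightarrow>
    regular_framework d b V E p \<and>
    int (rigidity_rank d b E p) = int (d * card V) - int (dim (tangent_space (orbit V p) p))"

definition independent_graph ::
  "nat \<Rightarrow> (nat \<Rightarrow> 'a::real_normed_vector) \<Rightarrow> 'v set \<Rightarrow> 'v set set \<Rightarrow> bool"
  where "independent_graph d b V E \<longleftrightarrow> (\<exists>p. independent_framework d b V E p)"

definition rigid_graph ::
  "nat \<Rightarrow> (nat \<Rightarrow> 'a::real_normed_vector) \<Rightarrow> 'v set \<Rightarrow> 'v set set \<Rightarrow> bool"
  where "rigid_graph d b V E \<longleftrightarrow> (\<exists>p. rigid_framework d b V E p)"

end

theory Submission
  imports Defs
begin

text \<open>An independent framework stays independent under small perturbations. By strict convexity the
  edges \<open>v0 v1, \<dots>, v0 v(d-1)\<close> can therefore be brought into general position, in the sense that both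
  these edge vectors and their support functionals are linearly independent. Let \<open>z\<close> be a common
  zero of these functionals and place \<open>w0\<close> at \<open>p v0 + t z\<close>. As \<open>t\<close> tends to \<open>0\<close> from the right, the
  rows of the split framework, the row of \<open>w0 v0\<close> being divided by \<open>t\<close>, converge to independent
  rows, so they are independent for small \<open>t\<close>.

  For rigidity, the tangent space at \<open>p\<close> consists of the maps \<open>v \<mapsto> A (p v) + c\<close> where \<open>c\<close> is a vector
  and \<open>A\<close> is skew, i.e. \<open>\<phi>\<close> at \<open>x\<close> annihilates \<open>A x\<close> for all nonzero \<open>x\<close>. A skew map that annihilates
  \<open>d - 1\<close> independent vectors is zero. Hence the dimension of the tangent space takes its maximal
  value, which does not depend on the graph, at every placement in general position. An independent
  graph is rigid iff this value is \<open>d |V| - |E|\<close>, and a vertex split changes neither side.\<close>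

section \<open>Linear independence of finite families\<close>

text \<open>Two obstacles shape the argument. As \<open>w0\<close> tends to \<open>v0\<close> the
  edge \<open>w0 v0\<close> shrinks to a point, so the limit of its row belongs to no placement.
  Since \<phi> is homogeneous of degree one, \<phi> at \<open>t z\<close> is \<open>t\<close> times
  \<phi> at \<open>z\<close>, and division by \<open>t\<close> leaves a fixed functional. That
  \<open>z\<close> is a common zero separates this row from those of the edges \<open>w0 vi\<close>:
  evaluated at \<open>z\<close>, the equilibrium at \<open>w0\<close> leaves only the weight of
  \<open>w0 v0\<close> times the square of the norm of \<open>z\<close>. The second obstacle is the
  tangent space. A smooth curve in the orbit comes with an isometry at each time, but these
  isometries may fail to be unique, and nothing makes them depend differentiably, or even
  continuously, on time. Their derivative has to be produced by compactness. Nor is a rigid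
  placement known to be in general position; the bound \<open>dim T + |E| <= d |V|\<close>, valid at
  every independent placement, closes this gap.\<close>

lemma sum_fun_at: "(\<Sum>i\<in>I. f i) x = (\<Sum>i\<in>I. f i x)"
  by (induction I rule: infinite_finite_induct) auto

lemma scaleR_fun_at [simp]: "(c *\<^sub>R f) x = c *\<^sub>R f x"
  by (simp add: scaleR_fun_def)

text \<open>Indexed families rather than sets: two equal members count as dependent. This combines
  the injectivity and the independence that \<open>independent_framework\<close> asks of the
  rows.\<close>

definition indep_family :: "'i set \<Rightarrow> ('i \<Rightarrow> 'a::real_vector) \<Rightarrow> bool"
  where "indep_family I f \<longleftrightarrow> (\<forall>c. (\<Sum>i\<in>I. c i *\<^sub>R f i) = 0 \<longrightarrow> (\<forall>i\<in>I. c i = 0))"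

lemma indep_familyI:
  "(\<And>c i. (\<Sum>i\<in>I. c i *\<^sub>R f i) = 0 \<Longrightarrow> i \<in> I \<Longrightarrow> c i = 0) \<Longrightarrow> indep_family I f"
  unfolding indep_family_def by blast

lemma indep_familyD:
  "indep_family I f \<Longrightarrow> (\<Sum>i\<in>I. c i *\<^sub>R f i) = 0 \<Longrightarrow> i \<in> I \<Longrightarrow> c i = 0"
  unfolding indep_family_def by blast

lemma indep_family_cong:
  "(\<And>i. i \<in> I \<Longrightarrow> f i = g i) \<Longrightarrow> indep_family I f \<longleftrightarrow> indep_family I g"
  unfolding indep_family_def by (metis (no_types, lifting) sum.cong)

lemma indep_family_iff:
  assumes "finite I"
  shows "indep_family I f \<longleftrightarrow> inj_on f I \<and> independent (f ` I)"
proof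
  assume ind: "indep_family I f"
  have inj: "inj_on f I"
  proof (rule inj_onI, rule ccontr)
    fix i j assume ij: "i \<in> I" "j \<in> I" "f i = f j" "i \<noteq> j"
    define c :: "'a \<Rightarrow> real" where "c k = (if k = i then 1 else 0) - (if k = j then 1 else 0)" for k
    have "(\<Sum>k\<in>I. c k *\<^sub>R f k) = (\<Sum>k\<in>I. (if k = i then f k else 0) - (if k = j then f k else 0))"
      by (rule sum.cong) (auto simp: c_def)
    also have "\<dots> = 0"
      using ij assms by (simp add: sum_subtractf)
    finally have "c i = 0" using indep_familyD[OF ind _ ij(1), of c] by blast
    then show False using ij(4) by (simp add: c_def)
  qed
  have "independent (f ` I)"
  proof
    assume "dependent (f ` I)"
    then obtain u where u: "(\<Sum>v\<in>f ` I. u v *\<^sub>R v) = 0" and ex: "\<exists>v\<in>f ` I. u v \<noteq> 0"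
      using assms by (auto simp: real_vector.dependent_finite)
    from u have "(\<Sum>i\<in>I. u (f i) *\<^sub>R f i) = 0"
      by (simp add: sum.reindex[OF inj])
    with ex indep_familyD[OF ind, of "u \<circ> f"] show False by auto
  qed
  with inj show "inj_on f I \<and> independent (f ` I)" by blast
next
  assume *: "inj_on f I \<and> independent (f ` I)"
  show "indep_family I f"
  proof (rule indep_familyI, rule ccontr)
    fix c i assume c: "(\<Sum>i\<in>I. c i *\<^sub>R f i) = 0" and i: "i \<in> I" and "c i \<noteq> 0"
    let ?u = "\<lambda>v. c (the_inv_into I f v)"
    have "(\<Sum>v\<in>f ` I. ?u v *\<^sub>R v) = (\<Sum>i\<in>I. c i *\<^sub>R f i)"
      using * by (simp add: sum.reindex the_inv_into_f_f)
    moreover have "?u (f i) \<noteq> 0" using * i \<open>c i \<noteq> 0\<close> by (simp add: the_inv_into_f_f)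
    ultimately have "dependent (f ` I)"
      using assms c i unfolding real_vector.dependent_finite[OF finite_imageI[OF assms]]
      by (intro exI[of _ ?u]) auto
    with * show False by blast
  qed
qed

lemma indep_family_insert:
  assumes "finite I" "j \<notin> I" "indep_family I f" "\<And>c. f j \<noteq> (\<Sum>i\<in>I. c i *\<^sub>R f i)"
  shows "indep_family (insert j I) f"
proof (rule indep_familyI)
  fix c k assume "(\<Sum>i\<in>insert j I. c i *\<^sub>R f i) = 0" and k: "k \<in> insert j I"
  then have eq: "c j *\<^sub>R f j = - (\<Sum>i\<in>I. c i *\<^sub>R f i)"
    using assms(1,2) by (simp add: eq_neg_iff_add_eq_0)
  have "c j = 0"
  proof (rule ccontr)
    assume "c j \<noteq> 0"
    then have "f j = (1 / c j) *\<^sub>R (c j *\<^sub>R f j)" by simp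
    also have "\<dots> = (\<Sum>i\<in>I. (- c i / c j) *\<^sub>R f i)"
      unfolding eq by (simp add: scaleR_sum_right sum_negf)
    finally show False using assms(4)[of "\<lambda>i. - c i / c j"] by simp
  qed
  with eq have "(\<Sum>i\<in>I. c i *\<^sub>R f i) = 0" by simp
  then show "c k = 0" using indep_familyD[OF assms(3)] k \<open>c j = 0\<close> by blast
qed

text \<open>The biorthogonal functionals turn independence into finitely many numerical equations,
  which can be perturbed.\<close>

lemma indep_family_dual:
  assumes "indep_family I f" "finite I"
  obtains g :: "'i \<Rightarrow> 'a::real_vector \<Rightarrow> real"
  where "\<And>i. linear (g i)" "\<And>i j. i \<in> I \<Longrightarrow> j \<in> I \<Longrightarrow> g i (f j) = (if i = j then 1 else 0)"
proof -
  from assms have inj: "inj_on f I" and ind: "independent (f ` I)"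
    by (auto simp: indep_family_iff)
  have "\<exists>g::'a \<Rightarrow> real. linear g \<and> (\<forall>x\<in>f ` I. g x = (if x = f i then 1 else 0))" for i
    by (rule linear_independent_extend[OF ind])
  then obtain g :: "'i \<Rightarrow> 'a \<Rightarrow> real"
    where g: "\<And>i. linear (g i)" "\<And>i x. x \<in> f ` I \<Longrightarrow> g i x = (if x = f i then 1 else 0)"
    by metis
  show thesis
  proof (rule that[of g])
    show "g i (f j) = (if i = j then 1 else 0)" if "i \<in> I" "j \<in> I" for i j
      using that g(2)[of "f j" i] inj by (auto simp: inj_on_def)
  qed (rule g)
qed

text \<open>Diagonal dominance of the matrix of the \<open>g i (f j)\<close>.\<close>
lemma indep_family_if_near_dual:
  fixes g :: "'i \<Rightarrow> 'a::real_vector \<Rightarrow> real"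
  assumes "finite I" and lin: "\<And>i. linear (g i)"
    and near: "\<And>i j. i \<in> I \<Longrightarrow> j \<in> I \<Longrightarrow> \<bar>g i (f j) - (if i = j then 1 else 0)\<bar> \<le> \<epsilon>"
    and small: "\<epsilon> * card I < (1::real)"
  shows "indep_family I f"
proof (rule indep_familyI)
  fix c k assume c: "(\<Sum>i\<in>I. c i *\<^sub>R f i) = 0" and k: "k \<in> I"
  define m where "m = Max ((\<lambda>i. \<bar>c i\<bar>) ` I)"
  have le: "\<bar>c j\<bar> \<le> m" if "j \<in> I" for j
    using that assms(1) by (auto simp: m_def)
  have "m \<in> (\<lambda>i. \<bar>c i\<bar>) ` I" unfolding m_def
    by (rule Max_in) (use assms(1) k in auto)
  \<comment> \<open>An index with a largest coefficient in absolute value: in the equation obtained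
    from \<open>g i\<close> the error terms add up to less than \<open>m\<close>, unless
    \<open>m = 0\<close>.\<close>
  then obtain i where i: "i \<in> I" "\<bar>c i\<bar> = m" by auto
  have "g i (\<Sum>j\<in>I. c j *\<^sub>R f j) = 0"
    using linear_0[OF lin] by (simp only: c)
  then have "(\<Sum>j\<in>I. c j * g i (f j)) = 0"
    by (simp add: linear_sum[OF lin] linear_cmul[OF lin])
  moreover have "(\<Sum>j\<in>I. c j * (if i = j then 1 else 0)) = c i"
    using i assms(1) by (simp add: if_distrib cong: if_cong)
  ultimately have "- c i = (\<Sum>j\<in>I. c j * (g i (f j) - (if i = j then 1 else 0)))"
    by (simp add: right_diff_distrib sum_subtractf)
  then have "\<bar>c i\<bar> \<le> (\<Sum>j\<in>I. \<bar>c j * (g i (f j) - (if i = j then 1 else 0))\<bar>)"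
    by (metis abs_minus_cancel sum_abs)
  also have "\<dots> \<le> (\<Sum>j\<in>I. m * \<epsilon>)"
  proof (rule sum_mono)
    fix j assume j: "j \<in> I"
    show "\<bar>c j * (g i (f j) - (if i = j then 1 else 0))\<bar> \<le> m * \<epsilon>"
      unfolding abs_mult using near[OF i(1) j] le[OF j] i(2) by (intro mult_mono) auto
  qed
  finally have "m \<le> m * (\<epsilon> * card I)" using i by (simp add: algebra_simps)
  moreover have "m \<ge> 0" using i by auto
  ultimately have "m = 0" using small
    by (smt (verit) mult_less_cancel_left2)
  then show "c k = 0" using le[OF k] by simp
qed

text \<open>Independence is an open condition: the functionals dual to \<open>f\<close> stay nearly
  dual to \<open>f' t\<close>. Pointwise convergence is enough because all members are supported in
  the finite set \<open>J\<close>, where each \<open>g i\<close> is a finite combination of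
  coordinates.\<close>

lemma eventually_indep_family:
  fixes f :: "'i \<Rightarrow> 'j \<Rightarrow> real"
  assumes ind: "indep_family I f" and fin: "finite I" "finite J"
    and supp: "\<And>i j. i \<in> I \<Longrightarrow> j \<notin> J \<Longrightarrow> f i j = 0"
    and supp': "\<And>t i j. i \<in> I \<Longrightarrow> j \<notin> J \<Longrightarrow> f' t i j = 0"
    and lim: "\<And>i j. i \<in> I \<Longrightarrow> j \<in> J \<Longrightarrow> ((\<lambda>t. f' t i j) \<longlongrightarrow> f i j) F"
  shows "eventually (\<lambda>t. indep_family I (f' t)) F"
proof -
  from ind fin(1) obtain g :: "'i \<Rightarrow> ('j \<Rightarrow> real) \<Rightarrow> real"
    where g: "\<And>i. linear (g i)"
      "\<And>i j. i \<in> I \<Longrightarrow> j \<in> I \<Longrightarrow> g i (f j) = (if i = j then 1 else 0)"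
    by (rule indep_family_dual) blast
  define e :: "'j \<Rightarrow> 'j \<Rightarrow> real" where "e j = (\<lambda>k. if k = j then 1 else 0)" for j
  have expand: "g i h = (\<Sum>j\<in>J. h j * g i (e j))" if "\<And>j. j \<notin> J \<Longrightarrow> h j = 0" for i and h :: "'j \<Rightarrow> real"
  proof -
    have "h = (\<Sum>j\<in>J. h j *\<^sub>R e j)"
      using that fin(2) by (auto simp: fun_eq_iff sum_fun_at e_def if_distrib cong: if_cong)
    then have "g i h = g i (\<Sum>j\<in>J. h j *\<^sub>R e j)" by simp
    then show ?thesis by (simp add: linear_sum[OF g(1)] linear_cmul[OF g(1)])
  qed
  \<comment> \<open>Small enough for diagonal dominance: \<open>card I\<close> errors of size
    \<epsilon> add up to less than 1. The \<open>+ 1\<close> makes this strict and covers the empty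
    family.\<close>
  define \<epsilon> where "\<epsilon> = 1 / (real (card I) + 1)"
  have "\<epsilon> > 0" "\<epsilon> * card I < 1" by (auto simp: \<epsilon>_def field_simps)
  have "eventually (\<lambda>t. \<forall>i\<in>I. \<forall>k\<in>I. \<bar>g i (f' t k) - (if i = k then 1 else 0)\<bar> < \<epsilon>) F"
  proof (intro eventually_ball_finite ballI fin)
    fix i k assume ik: "i \<in> I" "k \<in> I"
    have "((\<lambda>t. \<Sum>j\<in>J. f' t k j * g i (e j)) \<longlongrightarrow> (\<Sum>j\<in>J. f k j * g i (e j))) F"
      by (intro tendsto_intros lim ik)
    then have "((\<lambda>t. g i (f' t k)) \<longlongrightarrow> g i (f k)) F"
      by (simp add: expand supp supp' ik)
    then show "eventually (\<lambda>t. \<bar>g i (f' t k) - (if i = k then 1 else 0)\<bar> < \<epsilon>) F"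
      using \<open>\<epsilon> > 0\<close> g(2)[OF ik] by (auto simp: tendsto_iff dist_real_def)
  qed
  then show ?thesis
  proof eventually_elim
    case (elim t)
    then show ?case
      using \<open>\<epsilon> * card I < 1\<close>
      by (intro indep_family_if_near_dual[where g = g and \<epsilon> = \<epsilon>] fin g) (auto simp: less_imp_le)
  qed
qed

section \<open>Dimension counts in spaces of finitely supported functions\<close>

lemma card_le_dim:
  fixes S :: "'a::real_vector set"
  assumes "independent B" "B \<subseteq> S" "S \<subseteq> span F" "finite F"
  shows "card B \<le> dim S"
proof -
  obtain C where C: "C \<subseteq> S" "independent C" "S \<subseteq> span C" "card C = dim S"
    using real_vector.basis_exists by blast
  \<comment> \<open>The finite spanning set rules out an infinite basis, whose \<open>card\<close>,
    and with it \<open>dim S\<close>, would be 0.\<close>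
  have "C \<subseteq> span F" using C assms by blast
  then have "finite C" using C(2) assms(4) real_vector.independent_span_bound by blast
  moreover have "B \<subseteq> span C" using C assms by blast
  ultimately show ?thesis
    using assms(1) C(4) real_vector.independent_span_bound by metis
qed

lemma card_indep_family_le_dim:
  fixes S :: "'a::real_vector set"
  assumes "indep_family I f" "finite I" "f ` I \<subseteq> S" "S \<subseteq> span F" "finite F"
  shows "card I \<le> dim S"
  using assms card_le_dim[of "f ` I" S F] by (auto simp: indep_family_iff card_image)

lemma finite_support_subset_span:
  fixes h :: "'j \<Rightarrow> 'a::real_vector"
  assumes "finite J" "\<And>j. j \<notin> J \<Longrightarrow> h j = 0" "finite B" "span B = (UNIV :: 'a set)"
  shows "h \<in> span ((\<lambda>(j, x) k. if k = j then x else 0) ` (J \<times> B))"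
proof -
  let ?S = "(\<lambda>(j, x) k. if k = j then x else (0::'a)) ` (J \<times> B)"
  have single: "(\<lambda>k. if k = j then x else 0) \<in> span ?S" if j: "j \<in> J" for j x
  proof -
    have "x \<in> span B" using assms by simp
    then obtain u where x: "x = (\<Sum>v\<in>B. u v *\<^sub>R v)"
      using assms(3) by (auto simp: real_vector.span_finite)
    have "(\<lambda>k. if k = j then x else 0) = (\<Sum>v\<in>B. u v *\<^sub>R (\<lambda>k. if k = j then v else 0))"
      by (auto simp: fun_eq_iff sum_fun_at x)
    also have "\<dots> \<in> span ?S"
      by (intro span_sum span_scale span_base) (use j in auto)
    finally show ?thesis .
  qed
  have "h = (\<Sum>j\<in>J. (\<lambda>k. if k = j then h j else 0))"
    using assms by (auto simp: fun_eq_iff sum_fun_at)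
  also have "\<dots> \<in> span ?S"
    by (intro span_sum single)
  finally show ?thesis .
qed

text \<open>The spans of two orthogonal families meet only in 0, because a common element is
  orthogonal to itself. The disjoint union is therefore independent in a space of dimension
  \<open>card K\<close>. This bounds rows and infinitesimal motions together and, with one family
  empty, the size of any independent family.\<close>

lemma card_orthogonal_families:
  fixes f :: "'i \<Rightarrow> 'k \<Rightarrow> real" and g :: "'j \<Rightarrow> 'k \<Rightarrow> real"
  assumes f: "indep_family I f" "finite I" and g: "indep_family J g" "finite J" and K: "finite K"
    and "\<And>i k. i \<in> I \<Longrightarrow> k \<notin> K \<Longrightarrow> f i k = 0" "\<And>j k. j \<in> J \<Longrightarrow> k \<notin> K \<Longrightarrow> g j k = 0"
    and orth: "\<And>i j. i \<in> I \<Longrightarrow> j \<in> J \<Longrightarrow> (\<Sum>k\<in>K. f i k * g j k) = 0"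
  shows "card I + card J \<le> card K"
proof -
  let ?h = "case_sum f g"
  have sum: "(\<Sum>s\<in>I <+> J. c s *\<^sub>R ?h s) = (\<Sum>i\<in>I. c (Inl i) *\<^sub>R f i) + (\<Sum>j\<in>J. c (Inr j) *\<^sub>R g j)"
    for c :: "'i + 'j \<Rightarrow> real"
    using f(2) g(2) by (simp add: sum.Plus)
  have "indep_family (I <+> J) ?h"
  proof (rule indep_familyI)
    fix c s assume c: "(\<Sum>s\<in>I <+> J. c s *\<^sub>R ?h s) = 0" and s: "s \<in> I <+> J"
    define a where "a = (\<Sum>i\<in>I. c (Inl i) *\<^sub>R f i)"
    define b where "b = (\<Sum>j\<in>J. c (Inr j) *\<^sub>R g j)"
    have "a + b = 0" using c by (simp add: sum a_def b_def)
    then have ba: "b = - a" by (simp add: eq_neg_iff_add_eq_0 add.commute)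
    have "(\<Sum>k\<in>K. a k * b k) = (\<Sum>k\<in>K. \<Sum>i\<in>I. \<Sum>j\<in>J. c (Inl i) * c (Inr j) * (f i k * g j k))"
      by (simp add: a_def b_def sum_fun_at sum_product algebra_simps)
    also have "\<dots> = (\<Sum>i\<in>I. \<Sum>j\<in>J. \<Sum>k\<in>K. c (Inl i) * c (Inr j) * (f i k * g j k))"
      by (subst sum.swap, rule sum.cong[OF refl], rule sum.swap)
    also have "\<dots> = (\<Sum>i\<in>I. \<Sum>j\<in>J. c (Inl i) * c (Inr j) * (\<Sum>k\<in>K. f i k * g j k))"
      by (simp add: sum_distrib_left)
    also have "\<dots> = 0" by (simp add: orth)
    finally have "(\<Sum>k\<in>K. (a k)\<^sup>2) = 0"
      by (simp add: ba power2_eq_square sum_negf)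
    then have "\<forall>k\<in>K. a k = 0" using K by (simp add: sum_nonneg_eq_0_iff)
    moreover have "a k = 0" if "k \<notin> K" for k
      using that assms by (simp add: a_def sum_fun_at)
    ultimately have "a = 0" by (auto simp: fun_eq_iff)
    with ba have "b = 0" by simp
    with \<open>a = 0\<close> show "c s = 0"
      using s indep_familyD[OF f(1), of "c \<circ> Inl"] indep_familyD[OF g(1), of "c \<circ> Inr"]
      by (auto simp: a_def b_def)
  qed
  moreover have "finite (I <+> J)" using f g by simp
  moreover have "?h ` (I <+> J) \<subseteq> span ((\<lambda>(j, x) k. if k = j then x else 0) ` (K \<times> {1}))"
  proof -
    have "span {1::real} = UNIV" by (auto simp: span_singleton)
    then have "h \<in> span ((\<lambda>(j, x) k. if k = j then x else 0) ` (K \<times> {1}))"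
      if "\<And>k. k \<notin> K \<Longrightarrow> h k = 0" for h :: "'k \<Rightarrow> real"
      using finite_support_subset_span[OF K, of h "{1}"] that by auto
    with assms(6,7) show ?thesis by auto
  qed
  ultimately have "card (?h ` (I <+> J)) \<le> card ((\<lambda>(j, x) k. if k = j then x else (0::real)) ` (K \<times> {1}))"
    using K by (intro real_vector.independent_span_bound[THEN conjunct2]) (auto simp: indep_family_iff)
  also have "\<dots> \<le> card (K \<times> {1::real})" using K by (intro card_image_le) auto
  also have "\<dots> = card K" by (simp add: card_cartesian_product)
  moreover have "card (?h ` (I <+> J)) = card I + card J"
    using \<open>indep_family (I <+> J) ?h\<close> f g by (simp add: indep_family_iff card_image card_Plus)
  ultimately show ?thesis by simp
qed

text \<open>Bolzano-Weierstrass for one index at a time; a sequence that already converges keeps its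
  limit along every further subsequence.\<close>

lemma seq_compact_family:
  fixes x :: "'i \<Rightarrow> nat \<Rightarrow> 'a::metric_space"
  assumes "finite I" "compact S" "\<And>i n. i \<in> I \<Longrightarrow> x i n \<in> S"
  shows "\<exists>s l. strict_mono s \<and> (\<forall>i\<in>I. (\<lambda>n. x i (s n)) \<longlonglongrightarrow> l i)"
  using assms(1,3)
proof (induction I)
  case empty
  show ?case by (rule exI[of _ id]) (auto simp: strict_mono_def)
next
  case (insert j I)
  then obtain s l where s: "strict_mono (s :: nat \<Rightarrow> nat)" "\<forall>i\<in>I. (\<lambda>n. x i (s n)) \<longlonglongrightarrow> l i" by auto
  obtain r m where r: "strict_mono (r :: nat \<Rightarrow> nat)" "((\<lambda>n. x j (s n)) \<circ> r) \<longlonglongrightarrow> m"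
    using compact_imp_seq_compact[OF assms(2)] insert.prems seq_compactE
    by (metis insertI1)
  have "(\<lambda>n. x i (s (r n))) \<longlonglongrightarrow> (if i = j then m else l i)" if "i \<in> insert j I" for i
  proof (cases "i = j")
    case True then show ?thesis using r by (simp add: o_def)
  next
    case False
    then have "(\<lambda>n. x i (s n)) \<longlonglongrightarrow> l i" using s that by auto
    from LIMSEQ_subseq_LIMSEQ[OF this r(1)] False show ?thesis by (simp add: o_def)
  qed
  with s(1) r(1) show ?case
    by (intro exI[of _ "s \<circ> r"] exI[of _ "\<lambda>i. if i = j then m else l i"])
      (auto simp: strict_mono_def)
qed

section \<open>Normed spaces with a finite basis\<close>

declare One_nat_def [simp del]

text \<open>The type is only a real normed space. The basis is the sole source of finite dimension,
  so boundedness and compactness are recovered from coordinates.\<close>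

locale based_space =
  fixes d :: nat and b :: "nat \<Rightarrow> 'a::real_normed_vector"
  assumes basis: "indexed_basis d b"
begin

definition coord :: "nat \<Rightarrow> 'a \<Rightarrow> real"
  where "coord k x = representation (b ` {1..d}) x (b k)"

lemma inj_b: "inj_on b {1..d}" and independent_b: "independent (b ` {1..d})"
  and span_b: "span (b ` {1..d}) = UNIV"
  using basis by (auto simp: indexed_basis_def)

lemma linear_coord: "linear (coord k)"
  unfolding coord_def
  by (intro linearI)
    (auto simp: real_vector.representation_add real_vector.representation_scale independent_b span_b)

lemmas coord_linear_simps [simp] =
  linear_add[OF linear_coord] linear_diff[OF linear_coord] linear_cmul[OF linear_coord]
  linear_0[OF linear_coord] linear_neg[OF linear_coord] linear_sum[OF linear_coord]

lemma coord_expand: "(\<Sum>k\<in>{1..d}. coord k x *\<^sub>R b k) = x"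
proof -
  have "(\<Sum>k\<in>{1..d}. coord k x *\<^sub>R b k)
      = (\<Sum>v\<in>b ` {1..d}. representation (b ` {1..d}) x v *\<^sub>R v)"
    by (simp add: sum.reindex[OF inj_b] coord_def)
  also have "\<dots> = x"
    by (rule real_vector.sum_representation_eq) (auto simp: independent_b span_b)
  finally show ?thesis .
qed

lemma linear_expand:
  assumes "linear f"
  shows "f x = (\<Sum>k\<in>{1..d}. coord k x *\<^sub>R f (b k))"
proof -
  have "f x = f (\<Sum>k\<in>{1..d}. coord k x *\<^sub>R b k)" by (simp only: coord_expand)
  then show ?thesis by (simp add: linear_sum[OF assms] linear_cmul[OF assms])
qed

lemma coord_sum: "k \<in> {1..d} \<Longrightarrow> coord k (\<Sum>j\<in>{1..d}. c j *\<^sub>R b j) = c k"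
proof -
  assume k: "k \<in> {1..d}"
  have "coord k (b j) = (if j = k then 1 else 0)" if "j \<in> {1..d}" for j
  proof -
    have "b j \<in> b ` {1..d}" using that by blast
    then have "coord k (b j) = (if b k = b j then 1 else 0)"
      by (simp add: coord_def real_vector.representation_basis[OF independent_b])
    then show ?thesis using inj_on_eq_iff[OF inj_b k that] by auto
  qed
  then have "(\<Sum>j\<in>{1..d}. c j * coord k (b j)) = (\<Sum>j\<in>{1..d}. if j = k then c j else 0)"
    by (intro sum.cong) auto
  moreover have "coord k (\<Sum>j\<in>{1..d}. c j *\<^sub>R b j) = (\<Sum>j\<in>{1..d}. c j * coord k (b j))"
    by simp
  ultimately show ?thesis using k by simp
qed

lemma eq_if_coord_eq: "(\<And>k. k \<in> {1..d} \<Longrightarrow> coord k x = coord k y) \<Longrightarrow> x = y"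
proof -
  assume "\<And>k. k \<in> {1..d} \<Longrightarrow> coord k x = coord k y"
  then have "(\<Sum>k\<in>{1..d}. coord k x *\<^sub>R b k) = (\<Sum>k\<in>{1..d}. coord k y *\<^sub>R b k)"
    by (intro sum.cong) auto
  then show ?thesis by (simp only: coord_expand)
qed

section \<open>Compactness through coordinates and the equivalence of norms\<close>

lemma compact_coord_cube: "compact ((\<lambda>c. \<Sum>k\<in>{1..d}. c k *\<^sub>R b k) ` PiE UNIV (\<lambda>k. {-r..r::real}))"
proof (rule compact_continuous_image)
  show "continuous_on (PiE UNIV (\<lambda>k. {-r..r})) (\<lambda>c. \<Sum>k\<in>{1..d}. c k *\<^sub>R b k)"
    by (intro continuous_intros continuous_on_subset[OF continuous_on_product_coordinates]) auto
  \<comment> \<open>Tychonoff for functions on all of \<open>nat\<close>; the image reads only the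
    components in \<open>{1..d}\<close>.\<close>
  have "compactin (product_topology (\<lambda>_. euclidean) UNIV) (PiE UNIV (\<lambda>k::nat. {-r..r}))"
    by (subst compactin_PiE) auto
  then show "compact (PiE UNIV (\<lambda>k::nat. {-r..r}))"
    by (simp add: euclidean_product_topology)
qed

text \<open>Comparison with the maximum norm of the coordinates: the norm is positive on the compact
  boundary of the unit cube, hence bounded below there, and every nonzero vector can be scaled onto
  this boundary.\<close>

lemma coord_bounded: "\<exists>C\<ge>0. \<forall>x. \<forall>k\<in>{1..d}. \<bar>coord k x\<bar> \<le> C * norm x"
proof (cases "d = 0")
  case True then show ?thesis by auto
next
  case False
  let ?f = "\<lambda>c. \<Sum>k\<in>{1..d}. c k *\<^sub>R b k"
  define Q where "Q = PiE UNIV (\<lambda>k::nat. {-1..1::real})"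
  define S where "S = Q \<inter> (\<Union>k\<in>{1..d}. {c. \<bar>c k\<bar> = 1})"
  have "compactin (product_topology (\<lambda>_. euclidean) UNIV) Q"
    unfolding Q_def by (subst compactin_PiE) auto
  then have "compact Q" by (simp add: euclidean_product_topology)
  have "closed {c::nat \<Rightarrow> real. \<bar>c k\<bar> = 1}" for k
    by (intro closed_Collect_eq continuous_intros) auto
  then have "compact S"
    unfolding S_def by (intro compact_Int_closed \<open>compact Q\<close>) auto
  then have "compact (?f ` S)"
    by (intro compact_continuous_image continuous_intros
          continuous_on_subset[OF continuous_on_product_coordinates]) auto
  moreover have "(\<lambda>k. 1) \<in> S" using False by (auto simp: S_def Q_def)
  then have "?f ` S \<noteq> {}" by blast
  ultimately obtain y where y: "y \<in> ?f ` S" "\<And>z. z \<in> ?f ` S \<Longrightarrow> norm y \<le> norm z"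
    using continuous_attains_inf[of "?f ` S" norm] by (auto intro: continuous_intros)
  from y(1) obtain c k where c: "y = ?f c" "k \<in> {1..d}" "\<bar>c k\<bar> = 1" by (auto simp: S_def)
  have "coord k y \<noteq> 0" using c coord_sum[of k c] by auto
  then have "y \<noteq> 0" by auto
  then have m: "norm y > 0" by simp
  have "\<bar>coord k x\<bar> \<le> (1 / norm y) * norm x" if k: "k \<in> {1..d}" for x k
  proof (cases "x = 0")
    case False
    define M where "M = Max ((\<lambda>k. \<bar>coord k x\<bar>) ` {1..d})"
    have le: "\<bar>coord j x\<bar> \<le> M" if "j \<in> {1..d}" for j using that by (auto simp: M_def)
    have "M \<in> (\<lambda>k. \<bar>coord k x\<bar>) ` {1..d}" unfolding M_def
      by (rule Max_in) (use k in auto)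
    then obtain l where l: "l \<in> {1..d}" "M = \<bar>coord l x\<bar>" by auto
    have "M \<noteq> 0"
    proof
      assume "M = 0"
      then have "coord j x = coord j 0" if "j \<in> {1..d}" for j using le[OF that] by simp
      then have "x = 0" by (rule eq_if_coord_eq)
      with False show False by simp
    qed
    with l have "M > 0" by auto
    define c where "c j = (if j \<in> {1..d} then coord j x / M else 0)" for j
    have "\<bar>c j\<bar> \<le> 1" for j using le[of j] \<open>M > 0\<close> by (simp add: c_def)
    then have "c \<in> Q" by (auto simp: Q_def abs_le_iff minus_le_iff)
    moreover have "\<bar>c l\<bar> = 1" using l \<open>M > 0\<close> by (auto simp: c_def)
    ultimately have "c \<in> S" using l by (auto simp: S_def)
    moreover have "?f c = (1 / M) *\<^sub>R ?f (\<lambda>k. coord k x)"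
      unfolding scaleR_sum_right by (rule sum.cong) (auto simp: c_def)
    then have "?f c = (1 / M) *\<^sub>R x" by (simp only: coord_expand)
    ultimately have "(1 / M) *\<^sub>R x \<in> ?f ` S" by (intro image_eqI[of _ _ c]) simp_all
    then have "norm y \<le> norm ((1 / M) *\<^sub>R x)" by (rule y(2))
    then have "M * norm y \<le> norm x" using \<open>M > 0\<close> by (simp add: field_simps)
    moreover have "\<bar>coord k x\<bar> * norm y \<le> M * norm y" using le[OF k] by (rule mult_right_mono) simp
    ultimately have "\<bar>coord k x\<bar> * norm y \<le> norm x" by linarith
    then show ?thesis using m by (simp add: field_simps)
  qed simp
  then show ?thesis using m by (intro exI[of _ "1 / norm y"]) auto
qed

text \<open>A substitute for Heine-Borel: for the extraction of convergent subsequences a compact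
  superset of the ball suffices.\<close>

lemma compact_superset_cball: "\<exists>S. compact S \<and> (\<forall>x::'a. norm x \<le> r \<longrightarrow> x \<in> S)"
proof -
  obtain C where C: "C \<ge> 0" "\<And>x k. k \<in> {1..d} \<Longrightarrow> \<bar>coord k x\<bar> \<le> C * norm x"
    using coord_bounded by blast
  have "x \<in> (\<lambda>c. \<Sum>k\<in>{1..d}. c k *\<^sub>R b k) ` PiE UNIV (\<lambda>k. {- (C * r)..C * r})"
    if x: "norm x \<le> r" for x
  proof
    let ?c = "\<lambda>k. if k \<in> {1..d} then coord k x else 0"
    show "x = (\<Sum>k\<in>{1..d}. ?c k *\<^sub>R b k)"
      using coord_expand[of x] by simp
    have "C * norm x \<le> C * r" "0 \<le> C * norm x" using x C(1) by (auto intro: mult_left_mono)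
    then have "?c k \<in> {- (C * r)..C * r}" for k using C(2)[of k x] by auto
    then show "?c \<in> PiE UNIV (\<lambda>k. {- (C * r)..C * r})"
      by (intro PiE_I) auto
  qed
  then show ?thesis using compact_coord_cube by blast
qed

lemma linear_bounded:
  fixes f :: "'a \<Rightarrow> 'c::real_normed_vector"
  assumes "linear f"
  shows "\<exists>K\<ge>0. \<forall>x. norm (f x) \<le> K * norm x"
proof -
  obtain C where C: "C \<ge> 0" "\<And>x k. k \<in> {1..d} \<Longrightarrow> \<bar>coord k x\<bar> \<le> C * norm x"
    using coord_bounded by blast
  have "norm (f x) \<le> (C * (\<Sum>k\<in>{1..d}. norm (f (b k)))) * norm x" for x
  proof -
    have "norm (f x) \<le> (\<Sum>k\<in>{1..d}. norm (coord k x *\<^sub>R f (b k)))"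
      by (subst linear_expand[OF assms]) (rule norm_sum)
    also have "\<dots> \<le> (\<Sum>k\<in>{1..d}. (C * norm x) * norm (f (b k)))"
      by (rule sum_mono) (auto intro!: mult_right_mono C)
    finally show ?thesis by (simp add: sum_distrib_left algebra_simps)
  qed
  then show ?thesis
    by (intro exI[of _ "C * (\<Sum>k\<in>{1..d}. norm (f (b k)))"]) (auto intro!: mult_nonneg_nonneg sum_nonneg C)
qed

lemma tendsto_if_tendsto_basis:
  fixes f :: "'t \<Rightarrow> 'a \<Rightarrow> 'c::real_normed_vector"
  assumes "\<And>t. linear (f t)" "linear g" "\<And>k. k \<in> {1..d} \<Longrightarrow> ((\<lambda>t. f t (b k)) \<longlongrightarrow> g (b k)) F"
  shows "((\<lambda>t. f t x) \<longlongrightarrow> g x) F"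
proof -
  have "((\<lambda>t. \<Sum>k\<in>{1..d}. coord k x *\<^sub>R f t (b k)) \<longlongrightarrow> (\<Sum>k\<in>{1..d}. coord k x *\<^sub>R g (b k))) F"
    by (intro tendsto_intros assms)
  then show ?thesis
    by (simp only: linear_expand[OF assms(1), of _ x, symmetric] linear_expand[OF assms(2), of x, symmetric])
qed

text \<open>A linear map is determined by its \<open>d\<close> values on the basis, so pointwise
  convergence reduces to a common subsequence for these values.\<close>

lemma linear_subseq_converges:
  fixes f :: "nat \<Rightarrow> 'a \<Rightarrow> 'c::real_normed_vector"
  assumes lin: "\<And>n. linear (f n)" and "compact S" "\<And>n k. k \<in> {1..d} \<Longrightarrow> f n (b k) \<in> S"
  obtains s g where "strict_mono s" "linear g" "\<And>x. (\<lambda>n. f (s n) x) \<longlonglongrightarrow> g x"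
proof -
  obtain s l where s: "strict_mono s" and l: "\<And>k. k \<in> {1..d} \<Longrightarrow> (\<lambda>n. f (s n) (b k)) \<longlonglongrightarrow> l k"
    using seq_compact_family[of "{1..d}" S "\<lambda>k n. f n (b k)"] assms by blast
  define g where "g x = (\<Sum>k\<in>{1..d}. coord k x *\<^sub>R l k)" for x
  have g: "linear g"
    unfolding g_def
    by (intro linearI) (simp_all add: algebra_simps sum.distrib scaleR_sum_right)
  have "(\<lambda>n. \<Sum>k\<in>{1..d}. coord k x *\<^sub>R f (s n) (b k)) \<longlonglongrightarrow> g x" for x
    unfolding g_def by (intro tendsto_intros l)
  then have "(\<lambda>n. f (s n) x) \<longlonglongrightarrow> g x" for x
    by (subst linear_expand[OF lin])
  with s g show thesis by (rule that)
qed

section \<open>Linear algebra by counting against the basis\<close>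

lemma ex_notin_span:
  assumes "finite S" "card S < d"
  shows "\<exists>y::'a. y \<notin> span S"
proof (rule ccontr)
  assume "\<nexists>y. y \<notin> span S"
  then have "b ` {1..d} \<subseteq> span S" by blast
  then have "card (b ` {1..d}) \<le> card S"
    using real_vector.independent_span_bound[OF assms(1) independent_b] by blast
  then show False using assms inj_b by (simp add: card_image)
qed

text \<open>The values of the functionals at the basis vectors form \<open>d\<close> elements of a
  space of dimension \<open>card I < d\<close>. The coefficients of a dependence between them are
  the coordinates of \<open>z\<close>.\<close>

lemma ex_common_zero:
  fixes f :: "'i \<Rightarrow> 'a \<Rightarrow> real"
  assumes "finite I" "card I < d" and lin: "\<And>i. i \<in> I \<Longrightarrow> linear (f i)"
  obtains z where "z \<noteq> 0" "\<And>i. i \<in> I \<Longrightarrow> f i z = 0"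
proof -
  let ?g = "\<lambda>k i. if i \<in> I then f i (b k) else 0"
  have "\<not> indep_family {1..d} ?g"
  proof
    assume ind: "indep_family {1..d} ?g"
    \<comment> \<open>With an empty second family the orthogonality bound is the plain bound on
      independent families in dimension \<open>card I\<close>.\<close>
    have "card {1..d} + card ({}::nat set) \<le> card I"
      by (rule card_orthogonal_families[OF ind, where g = undefined])
        (use assms in \<open>auto simp: indep_family_def\<close>)
    with assms(2) show False by simp
  qed
  then obtain c k where c: "(\<Sum>k\<in>{1..d}. c k *\<^sub>R ?g k) = 0" and k: "k \<in> {1..d}" "c k \<noteq> 0"
    unfolding indep_family_def by blast
  show thesis
  proof (rule that)
    show "(\<Sum>k\<in>{1..d}. c k *\<^sub>R b k) \<noteq> 0"
      using coord_sum[OF k(1), of c] k(2) by (metis linear_0[OF linear_coord])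
    fix i assume i: "i \<in> I"
    have "(\<Sum>k\<in>{1..d}. c k *\<^sub>R ?g k) i = 0" using c by simp
    then show "f i (\<Sum>k\<in>{1..d}. c k *\<^sub>R b k) = 0"
      using i by (simp add: sum_fun_at linear_sum[OF lin[OF i]] linear_cmul[OF lin[OF i]])
  qed
qed

lemma linear_inj_imp_bij:
  fixes f :: "'a \<Rightarrow> 'a"
  assumes "linear f" "inj f"
  shows "bij f"
proof -
  have "independent (f ` b ` {1..d})"
    using independent_b assms by (meson inj_on_subset subset_UNIV linear_independent_injective_image)
  moreover have "card (f ` b ` {1..d}) = d"
    using assms(2) inj_b by (simp add: card_image inj_on_subset[of f UNIV])
  ultimately have "b ` {1..d} \<subseteq> span (f ` b ` {1..d})"
  proof -
    let ?B = "f ` b ` {1..d}"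
    assume ind: "independent ?B" and card: "card ?B = d"
    have "y \<in> span ?B" for y
    proof (rule ccontr)
      assume y: "y \<notin> span ?B"
      then have "independent (insert y ?B)" using ind by (simp add: independent_insert)
      then have "card (insert y ?B) \<le> card (b ` {1..d})"
        using real_vector.independent_span_bound[of "b ` {1..d}" "insert y ?B"] span_b by auto
      moreover have "y \<notin> ?B" using y span_base[of y ?B] by auto
      ultimately show False using card inj_b by (simp add: card_image)
    qed
    then show ?thesis by blast
  qed
  then have "span (b ` {1..d}) \<subseteq> span (f ` b ` {1..d})"
    by (rule real_vector.span_minimal) (rule real_vector.subspace_span)
  then have "range f = UNIV"
    using span_b linear_span_image[OF assms(1), of "b ` {1..d}"] by auto
  then show ?thesis using assms(2) by (simp add: bij_def)
qed

end

section \<open>The support map of a smooth strictly convex space\<close>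

lemma has_vector_derivative_iff_quotient:
  "(f has_vector_derivative u) (at t) \<longleftrightarrow> ((\<lambda>s. (f s - f t) /\<^sub>R (s - t)) \<longlongrightarrow> u) (at t)"
proof -
  have "(f has_vector_derivative u) (at t) \<longleftrightarrow> ((\<lambda>s. (f s - (f t + (s - t) *\<^sub>R u)) /\<^sub>R \<bar>s - t\<bar>) \<longlongrightarrow> 0) (at t)"
    by (simp add: has_vector_derivative_def has_derivative_at_within bounded_linear_scaleR_left diff_diff_eq)
  also have "\<dots> \<longleftrightarrow> ((\<lambda>s. (f s - f t) /\<^sub>R (s - t) - u) \<longlongrightarrow> 0) (at t)"
    unfolding tendsto_norm_zero_iff[symmetric, where f = "\<lambda>s. (f s - (f t + (s - t) *\<^sub>R u)) /\<^sub>R \<bar>s - t\<bar>"]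
      tendsto_norm_zero_iff[symmetric, where f = "\<lambda>s. (f s - f t) /\<^sub>R (s - t) - u"]
  proof (rule tendsto_cong)
    show "\<forall>\<^sub>F s in at t. norm ((f s - (f t + (s - t) *\<^sub>R u)) /\<^sub>R \<bar>s - t\<bar>) = norm ((f s - f t) /\<^sub>R (s - t) - u)"
      unfolding eventually_at_filter
    proof (rule always_eventually, intro allI impI)
      fix s assume "s \<noteq> t"
      then have "(f s - (f t + (s - t) *\<^sub>R u)) /\<^sub>R (s - t) = (f s - f t) /\<^sub>R (s - t) - u"
        by (simp add: diff_diff_eq[symmetric] scaleR_diff_right)
      moreover have "norm ((f s - (f t + (s - t) *\<^sub>R u)) /\<^sub>R \<bar>s - t\<bar>)
          = norm ((f s - (f t + (s - t) *\<^sub>R u)) /\<^sub>R (s - t))" by simp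
      ultimately show "norm ((f s - (f t + (s - t) *\<^sub>R u)) /\<^sub>R \<bar>s - t\<bar>) = norm ((f s - f t) /\<^sub>R (s - t) - u)"
        by simp
    qed
  qed
  also have "\<dots> \<longleftrightarrow> ((\<lambda>s. (f s - f t) /\<^sub>R (s - t)) \<longlongrightarrow> u) (at t)"
    by (simp add: LIM_zero_iff)
  finally show ?thesis .
qed

locale smooth_convex_space = based_space d b for d and b :: "nat \<Rightarrow> 'a::real_normed_vector" +
  assumes dim_pos: "1 \<le> d"
    and smooth: "smooth_space TYPE('a)"
    and strictly_convex: "strictly_convex_space TYPE('a)"
begin

abbreviation \<phi> :: "'a \<Rightarrow> 'a \<Rightarrow> real" where "\<phi> \<equiv> support_functional"

text \<open>Linear functionals are bounded in finite dimension, so the supremum is a true least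
  upper bound and not a default value; it can be traded for a pointwise estimate.\<close>

lemma supports_iff:
  fixes x :: 'a
  assumes "x \<noteq> 0"
  shows "supports f x \<longleftrightarrow> linear f \<and> f x = (norm x)\<^sup>2 \<and> (\<forall>y. \<bar>f y\<bar> \<le> norm x * norm y)"
proof
  assume s: "supports f x"
  then have lin: "linear f" and fx: "f x = (norm x)\<^sup>2"
    and sup: "(SUP y\<in>{y. norm y \<le> 1}. \<bar>f y\<bar>) = norm x" by (auto simp: supports_def)
  obtain K where K: "K \<ge> 0" "\<And>y. norm (f y) \<le> K * norm y" using linear_bounded[OF lin] by blast
  have bdd: "bdd_above ((\<lambda>y. \<bar>f y\<bar>) ` {y. norm y \<le> 1})"
  proof (rule bdd_aboveI2)
    fix y :: 'a assume "y \<in> {y. norm y \<le> 1}"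
    then have "K * norm y \<le> K * 1" using K(1) by (intro mult_left_mono) auto
    then show "\<bar>f y\<bar> \<le> K" using K(2)[of y] by simp
  qed
  have "\<bar>f y\<bar> \<le> norm x * norm y" for y
  proof (cases "y = 0")
    case False
    have "\<bar>f (y /\<^sub>R norm y)\<bar> \<le> norm x"
      unfolding sup[symmetric] by (rule cSUP_upper[OF _ bdd]) (use False in simp)
    then show ?thesis using False by (simp add: linear_cmul[OF lin] abs_mult field_simps)
  qed (simp add: linear_0[OF lin])
  with lin fx show "linear f \<and> f x = (norm x)\<^sup>2 \<and> (\<forall>y. \<bar>f y\<bar> \<le> norm x * norm y)" by blast
next
  assume f: "linear f \<and> f x = (norm x)\<^sup>2 \<and> (\<forall>y. \<bar>f y\<bar> \<le> norm x * norm y)"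
  have "(SUP y\<in>{y. norm y \<le> 1}. \<bar>f y\<bar>) = norm x"
  proof (rule cSup_eq_maximum)
    have "\<bar>f (x /\<^sub>R norm x)\<bar> = norm x"
      using f assms by (simp add: linear_cmul power2_eq_square abs_mult)
    then show "norm x \<in> (\<lambda>y. \<bar>f y\<bar>) ` {y. norm y \<le> 1}"
      using assms by (intro image_eqI[of _ _ "x /\<^sub>R norm x"]) auto
    fix r assume "r \<in> (\<lambda>y. \<bar>f y\<bar>) ` {y. norm y \<le> 1}"
    then obtain y where "r = \<bar>f y\<bar>" "norm y \<le> 1" by auto
    then show "r \<le> norm x" using f mult_left_mono[of "norm y" 1 "norm x"]
      by (metis mult.right_neutral norm_ge_zero order_trans)
  qed
  with f show "supports f x" by (simp add: supports_def)
qed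

lemma smooth_point: "(x::'a) \<noteq> 0 \<Longrightarrow> smooth_point x"
  using smooth by (simp add: smooth_space_def)

lemma supports_phi: "x \<noteq> 0 \<Longrightarrow> supports (\<phi> x) x"
  using smooth_point[of x] theI'[of "\<lambda>f. supports f x"]
  unfolding support_functional_def smooth_point_def by blast

lemma linear_phi: "x \<noteq> 0 \<Longrightarrow> linear (\<phi> x)"
  and phi_self: "x \<noteq> 0 \<Longrightarrow> \<phi> x x = (norm x)\<^sup>2"
  and phi_bound: "x \<noteq> 0 \<Longrightarrow> \<bar>\<phi> x y\<bar> \<le> norm x * norm y"
  using supports_phi[of x] supports_iff[of x "\<phi> x"] by auto

lemma phi_le: "x \<noteq> 0 \<Longrightarrow> \<phi> x y \<le> norm x * norm y"
  using phi_bound[of x y] by linarith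

lemma phi_unique:
  assumes "x \<noteq> 0" "linear f" "f x = (norm x)\<^sup>2" "\<And>y. \<bar>f y\<bar> \<le> norm x * norm y"
  shows "f = \<phi> x"
proof -
  have "supports f x" using assms by (simp add: supports_iff)
  then show ?thesis
    using smooth_point[OF assms(1)] supports_phi[OF assms(1)] unfolding smooth_point_def by auto
qed

lemma phi_scale:
  assumes "x \<noteq> 0" "c \<noteq> 0"
  shows "\<phi> (c *\<^sub>R x) y = c * \<phi> x y"
proof -
  have "(\<lambda>y. c * \<phi> x y) = \<phi> (c *\<^sub>R x)"
  proof (rule phi_unique)
    show "linear (\<lambda>y. c * \<phi> x y)"
      using linear_phi[OF assms(1)]
      by (intro linearI) (simp_all add: linear_add linear_cmul algebra_simps)
    show "c * \<phi> x (c *\<^sub>R x) = (norm (c *\<^sub>R x))\<^sup>2"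
      using assms by (simp add: linear_cmul[OF linear_phi] phi_self power2_eq_square)
    show "\<bar>c * \<phi> x y\<bar> \<le> norm (c *\<^sub>R x) * norm y" for y
      using phi_bound[OF assms(1), of y] by (simp add: abs_mult mult.assoc mult_left_mono)
  qed (use assms in auto)
  then show ?thesis by (metis (no_types))
qed

lemma phi_minus: "x \<noteq> 0 \<Longrightarrow> \<phi> (- x) y = - \<phi> x y"
  using phi_scale[of x "-1" y] by simp

text \<open>Uniqueness plus compactness: the functionals at points near \<open>x\<close> are
  uniformly bounded, so a subsequence converges, and its limit supports \<open>x\<close>. By
  smoothness this limit is \<phi> at \<open>x\<close>, which contradicts a gap of
  \<epsilon>.\<close>

lemma isCont_phi:
  assumes x: "x \<noteq> 0"
  shows "isCont (\<lambda>x. \<phi> x y) x"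
proof (rule ccontr)
  assume "\<not> isCont (\<lambda>x. \<phi> x y) x"
  then obtain \<epsilon> where \<epsilon>: "\<epsilon> > 0" "\<And>\<delta>. \<delta> > 0 \<Longrightarrow> \<exists>x'. dist x' x < \<delta> \<and> \<not> dist (\<phi> x' y) (\<phi> x y) < \<epsilon>"
    unfolding continuous_at_eps_delta by blast
  \<comment> \<open>The bound by \<open>norm x\<close> keeps the points of the sequence away from 0,
    where the facts about \<phi> do not apply.\<close>
  have "\<exists>x'. dist x' x < min (inverse (real (Suc n))) (norm x) \<and> \<not> dist (\<phi> x' y) (\<phi> x y) < \<epsilon>" for n
    by (rule \<epsilon>(2)) (use x in simp)
  then obtain X where X: "\<And>n. dist (X n) x < min (inverse (real (Suc n))) (norm x)"
    "\<And>n. \<not> dist (\<phi> (X n) y) (\<phi> x y) < \<epsilon>" by metis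
  have X0: "X n \<noteq> 0" for n using X(1)[of n] by (auto simp: dist_norm)
  have norm_X: "norm (X n) \<le> 2 * norm x" for n
    using X(1)[of n] norm_triangle_sub[of "X n" x] by (simp add: dist_norm)
  have lim: "X \<longlonglongrightarrow> x"
  proof (rule metric_LIMSEQ_I)
    fix r :: real assume "r > 0"
    then obtain N where N: "inverse (real (Suc N)) < r" using reals_Archimedean by blast
    have "dist (X n) x < r" if "n \<ge> N" for n
    proof -
      have "inverse (real (Suc n)) \<le> inverse (real (Suc N))" using that by (simp add: field_simps)
      moreover have "dist (X n) x < inverse (real (Suc n))" using X(1)[of n] by (simp del: of_nat_Suc)
      ultimately show ?thesis using N by linarith
    qed
    then show "\<exists>N. \<forall>n\<ge>N. dist (X n) x < r" by blast
  qed
  define R where "R = 2 * norm x * (\<Sum>k\<in>{1..d}. norm (b k))"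
  have bnd: "\<phi> (X n) (b k) \<in> {-R..R}" if k: "k \<in> {1..d}" for n k
  proof -
    have "norm (b k) \<le> (\<Sum>k\<in>{1..d}. norm (b k))" by (rule member_le_sum[OF k]) auto
    then have "norm (X n) * norm (b k) \<le> R"
      unfolding R_def by (intro mult_mono norm_X) auto
    with phi_bound[OF X0[of n], of "b k"] show ?thesis by (simp add: abs_le_iff)
  qed
  obtain s g where s: "strict_mono s" and g: "linear g" "\<And>z. (\<lambda>n. \<phi> (X (s n)) z) \<longlonglongrightarrow> g z"
    using linear_subseq_converges[of "\<lambda>n. \<phi> (X n)" "{-R..R}"] linear_phi[OF X0] bnd by auto
  have lims: "(\<lambda>n. X (s n)) \<longlonglongrightarrow> x"
    using LIMSEQ_subseq_LIMSEQ[OF lim s] by (simp add: o_def)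
  have "g = \<phi> x"
  proof (rule phi_unique[OF x g(1)])
    \<comment> \<open>The limit functional takes the right value at \<open>x\<close>: \<phi> at
      \<open>X n\<close> takes the value \<open>(norm (X n))^2\<close> at \<open>X n\<close> itself,
      and by the uniform bound its values at \<open>X n\<close> and at \<open>x\<close> differ by a
      null sequence.\<close>
    have "(\<lambda>n. norm (X (s n)) * norm (X (s n) - x)) \<longlonglongrightarrow> norm x * norm (x - x)"
      by (intro tendsto_intros lims)
    then have "(\<lambda>n. norm (X (s n)) * norm (X (s n) - x)) \<longlonglongrightarrow> 0" by simp
    then have "(\<lambda>n. \<phi> (X (s n)) (X (s n) - x)) \<longlonglongrightarrow> 0"
      by (rule Lim_null_comparison[rotated]) (simp add: phi_bound[OF X0])
    then have "(\<lambda>n. (norm (X (s n)))\<^sup>2 - \<phi> (X (s n)) x) \<longlonglongrightarrow> 0"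
      by (simp add: linear_diff[OF linear_phi[OF X0]] phi_self[OF X0])
    moreover have "(\<lambda>n. (norm (X (s n)))\<^sup>2 - \<phi> (X (s n)) x) \<longlonglongrightarrow> (norm x)\<^sup>2 - g x"
      by (intro tendsto_intros lims g)
    ultimately show "g x = (norm x)\<^sup>2" using LIMSEQ_unique by fastforce
    show "\<bar>g z\<bar> \<le> norm x * norm z" for z
    proof (rule LIMSEQ_le)
      show "(\<lambda>n. \<bar>\<phi> (X (s n)) z\<bar>) \<longlonglongrightarrow> \<bar>g z\<bar>" by (intro tendsto_intros g)
      show "(\<lambda>n. norm (X (s n)) * norm z) \<longlonglongrightarrow> norm x * norm z" by (intro tendsto_intros lims)
    qed (auto intro: phi_bound[OF X0])
  qed
  with g(2)[of y] have "eventually (\<lambda>n. dist (\<phi> (X (s n)) y) (\<phi> x y) < \<epsilon>) sequentially"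
    using \<epsilon>(1) by (auto simp: tendsto_iff)
  with X(2) show False by simp
qed

lemma tendsto_phi:
  assumes X: "(X \<longlongrightarrow> x) F" and Y: "(Y \<longlongrightarrow> y) F" and x: "x \<noteq> 0"
  shows "((\<lambda>t. \<phi> (X t) (Y t)) \<longlongrightarrow> \<phi> x y) F"
proof -
  have ev: "eventually (\<lambda>t. X t \<noteq> 0) F" using X x by (rule tendsto_imp_eventually_ne)
  have "((\<lambda>t. norm (X t) * norm (Y t - y)) \<longlongrightarrow> norm x * norm (y - y)) F"
    by (intro tendsto_intros X Y)
  then have "((\<lambda>t. norm (X t) * norm (Y t - y)) \<longlongrightarrow> 0) F" by simp
  then have "((\<lambda>t. \<phi> (X t) (Y t - y)) \<longlongrightarrow> 0) F"
    by (rule Lim_null_comparison[rotated]) (use ev in eventually_elim, simp add: phi_bound)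
  moreover have "((\<lambda>t. \<phi> (X t) y) \<longlongrightarrow> \<phi> x y) F"
    using isCont_tendsto_compose[OF isCont_phi[OF x] X] .
  ultimately have "((\<lambda>t. \<phi> (X t) (Y t - y) + \<phi> (X t) y) \<longlongrightarrow> 0 + \<phi> x y) F"
    by (rule tendsto_add)
  moreover have "eventually (\<lambda>t. \<phi> (X t) (Y t - y) + \<phi> (X t) y = \<phi> (X t) (Y t)) F"
    using ev by eventually_elim (simp add: linear_diff[OF linear_phi])
  ultimately show ?thesis
    using Lim_transform_eventually by fastforce
qed

text \<open>The difference quotient is squeezed: the functional at \<open>g t\<close> bounds the
  increment of the norm from one side, the functional at \<open>g s\<close> from the other, and
  continuity of \<phi> sends both bounds to the same limit.\<close>

lemma norm_has_derivative:
  assumes g: "(g has_vector_derivative u) (at t)" and g0: "g t \<noteq> 0"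
  shows "((\<lambda>s. norm (g s)) has_real_derivative \<phi> (g t) u / norm (g t)) (at t)"
proof -
  define q where "q s = (g s - g t) /\<^sub>R (s - t)" for s
  have q: "(q \<longlongrightarrow> u) (at t)" 
  proof -
    have "q = (\<lambda>s. (g s - g t) /\<^sub>R (s - t))" by (rule ext) (rule q_def)
    then show ?thesis using g has_vector_derivative_iff_quotient[of g u t] by metis
  qed
  have gt: "(g \<longlongrightarrow> g t) (at t)"
    using has_vector_derivative_continuous[OF g] by (simp add: isCont_def)
  let ?L = "\<phi> (g t) u / norm (g t)"
  have A: "((\<lambda>s. \<phi> (g t) (q s) / norm (g t)) \<longlongrightarrow> ?L) (at t)"
    by (intro tendsto_intros tendsto_phi q g0) (use g0 in auto)
  have B: "((\<lambda>s. \<phi> (g s) (q s) / norm (g s)) \<longlongrightarrow> ?L) (at t)"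
    by (intro tendsto_intros tendsto_phi q gt g0) (use g0 in auto)
  \<comment> \<open>A number between two others is no farther from the limit than the sum of their
    distances to it. This estimate does not depend on which bound is the larger one, so it covers
    both signs of \<open>s - t\<close>.\<close>
  have "((\<lambda>s. \<bar>\<phi> (g t) (q s) / norm (g t) - ?L\<bar> + \<bar>\<phi> (g s) (q s) / norm (g s) - ?L\<bar>)
      \<longlongrightarrow> \<bar>?L - ?L\<bar> + \<bar>?L - ?L\<bar>) (at t)"
    by (intro tendsto_intros A B)
  then have "((\<lambda>s. \<bar>\<phi> (g t) (q s) / norm (g t) - ?L\<bar> + \<bar>\<phi> (g s) (q s) / norm (g s) - ?L\<bar>) \<longlongrightarrow> 0) (at t)"
    by simp
  then have "((\<lambda>s. (norm (g s) - norm (g t)) / (s - t) - ?L) \<longlongrightarrow> 0) (at t)"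
  proof (rule Lim_null_comparison[rotated])
    have "eventually (\<lambda>s. g s \<noteq> 0) (at t)" using gt g0 by (rule tendsto_imp_eventually_ne)
    moreover have "eventually (\<lambda>s. s \<noteq> t) (at t)" by (simp add: eventually_at_filter)
    ultimately show "\<forall>\<^sub>F s in at t. norm ((norm (g s) - norm (g t)) / (s - t) - ?L)
      \<le> \<bar>\<phi> (g t) (q s) / norm (g t) - ?L\<bar> + \<bar>\<phi> (g s) (q s) / norm (g s) - ?L\<bar>"
    proof eventually_elim
      case (elim s)
      let ?\<Delta> = "norm (g s) - norm (g t)"
      have diff: "g s - g t = (s - t) *\<^sub>R q s" using elim by (simp add: q_def)
      have "\<phi> (g t) (g s) \<le> norm (g t) * norm (g s)" using phi_le[OF g0] .
      then have "\<phi> (g t) (g s - g t) \<le> norm (g t) * ?\<Delta>"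
        by (simp add: linear_diff[OF linear_phi[OF g0]] phi_self[OF g0] power2_eq_square algebra_simps)
      then have lo: "(s - t) * (\<phi> (g t) (q s) / norm (g t)) \<le> ?\<Delta>"
        using g0 unfolding diff linear_cmul[OF linear_phi[OF g0]]
        by (simp add: pos_divide_le_eq mult.commute)
      have "\<phi> (g s) (g t) \<le> norm (g s) * norm (g t)" using phi_le[OF elim(1)] .
      then have "norm (g s) * ?\<Delta> \<le> \<phi> (g s) (g s - g t)"
        by (simp add: linear_diff[OF linear_phi[OF elim(1)]] phi_self[OF elim(1)] power2_eq_square algebra_simps)
      then have hi: "?\<Delta> \<le> (s - t) * (\<phi> (g s) (q s) / norm (g s))"
        using elim(1) unfolding diff linear_cmul[OF linear_phi[OF elim(1)]]
        by (simp add: pos_le_divide_eq mult.commute)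
      show ?case
      proof (cases "s > t")
        case True
        then have "\<phi> (g t) (q s) / norm (g t) \<le> ?\<Delta> / (s - t)" "?\<Delta> / (s - t) \<le> \<phi> (g s) (q s) / norm (g s)"
          using lo hi by (simp_all add: pos_le_divide_eq pos_divide_le_eq mult.commute)
        then show ?thesis unfolding real_norm_def by linarith
      next
        case False
        with elim have "s - t < 0" by simp
        then have "\<phi> (g t) (q s) / norm (g t) \<ge> ?\<Delta> / (s - t)" "?\<Delta> / (s - t) \<ge> \<phi> (g s) (q s) / norm (g s)"
          using lo hi by (simp_all add: neg_le_divide_eq neg_divide_le_eq mult.commute)
        then show ?thesis unfolding real_norm_def by linarith
      qed
    qed
  qed
  then have "((\<lambda>s. (norm (g s) - norm (g t)) / (s - t)) \<longlongrightarrow> ?L) (at t)"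
    by (simp add: LIM_zero_iff)
  then show ?thesis
    by (simp add: has_field_derivative_iff)
qed

section \<open>Consequences of strict convexity: isometries are affine, and general position is
  dense\<close>

lemma norm_add_eqD:
  fixes x y :: 'a
  assumes "norm (x + y) = norm x + norm y"
  shows "norm y *\<^sub>R x = norm x *\<^sub>R y"
proof (cases "x = 0 \<or> y = 0")
  case False
  then obtain c where c: "x = c *\<^sub>R y"
    using strictly_convex assms unfolding strictly_convex_space_def by (metis less_irrefl)
  have "norm (x + y) = \<bar>c + 1\<bar> * norm y"
    unfolding c by (metis norm_scaleR scaleR_left_distrib scaleR_one)
  moreover have "norm x + norm y = (\<bar>c\<bar> + 1) * norm y" by (simp add: c distrib_right)
  ultimately have "\<bar>c + 1\<bar> = \<bar>c\<bar> + 1" using assms False by simp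
  then have "c \<ge> 0" by linarith
  then show ?thesis by (simp add: c)
qed auto

text \<open>Strict convexity determines a point on a segment by its distances to the end points.\<close>
lemma linear_isometry:
  fixes T :: "'a \<Rightarrow> 'a"
  assumes "isometry T"
  shows "linear (\<lambda>x. T x - T 0)"
proof -
  define f where "f = (\<lambda>x. T x - T 0)"
  have iso: "norm (f x - f y) = norm (x - y)" for x y
    using assms by (simp add: f_def isometry_def dist_norm)
  have f0: "f 0 = 0" by (simp add: f_def)
  have norm_f: "norm (f x) = norm x" for x using iso[of x 0] by (simp add: f0)
  \<comment> \<open>The point \<open>c x\<close> lies on the segment from 0 to \<open>x\<close>, so
    the triangle inequality for its image is an equality.\<close>
  have small: "f (c *\<^sub>R x) = c *\<^sub>R f x" if c: "0 \<le> c" "c \<le> 1" for c x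
  proof (cases "x = 0")
    case False
    have n1: "norm (f (c *\<^sub>R x)) = c * norm x" using c by (simp add: norm_f)
    have "norm (f x - f (c *\<^sub>R x)) = norm ((1 - c) *\<^sub>R x)"
      by (simp add: iso scaleR_diff_left)
    then have n2: "norm (f x - f (c *\<^sub>R x)) = (1 - c) * norm x" using c by simp
    have "norm (f (c *\<^sub>R x) + (f x - f (c *\<^sub>R x))) = norm (f (c *\<^sub>R x)) + norm (f x - f (c *\<^sub>R x))"
      unfolding n1 n2 by (simp add: norm_f algebra_simps)
    from norm_add_eqD[OF this]
    have "norm x *\<^sub>R ((1 - c) *\<^sub>R f (c *\<^sub>R x)) = norm x *\<^sub>R (c *\<^sub>R (f x - f (c *\<^sub>R x)))"
      unfolding n1 n2 by (simp add: algebra_simps)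
    then have "(1 - c) *\<^sub>R f (c *\<^sub>R x) = c *\<^sub>R (f x - f (c *\<^sub>R x))"
      using False by (simp only: scaleR_cancel_left) simp
    then show ?thesis by (simp add: algebra_simps)
  qed (simp add: f0)
  have neg: "f (- x) = - f x" for x
  proof (cases "x = 0")
    case False
    have "norm (f x + - f (- x)) = norm (x - - x)" using iso[of x "- x"] by simp
    also have "\<dots> = norm (2 *\<^sub>R x)" by (simp add: scaleR_2)
    also have "\<dots> = norm (f x) + norm (- f (- x))" by (simp add: norm_f)
    finally have "norm (- f (- x)) *\<^sub>R f x = norm (f x) *\<^sub>R (- f (- x))" by (rule norm_add_eqD)
    then have "norm x *\<^sub>R f x = norm x *\<^sub>R (- f (- x))" by (simp only: norm_f norm_minus_cancel)
    then have "f x = - f (- x)" using False by (simp only: scaleR_cancel_left) simp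
    then show ?thesis by simp
  qed (simp add: f0)
  have pos: "f (c *\<^sub>R x) = c *\<^sub>R f x" if c: "0 \<le> c" for c x
  proof (cases "c \<le> 1")
    case False
    then have "f x = (1 / c) *\<^sub>R f (c *\<^sub>R x)"
      using small[of "1 / c" "c *\<^sub>R x"] by simp
    with False show ?thesis by simp
  qed (rule small[OF c])
  have scale: "f (c *\<^sub>R x) = c *\<^sub>R f x" for c x
    using pos[of c x] pos[of "- c" "- x"] neg[of x] by (cases "c \<ge> 0") auto
  \<comment> \<open>The image of the midpoint has equal distances to \<open>f x\<close> and
    \<open>f y\<close>, and these add up to the distance between the two, so it is their midpoint;
    homogeneity turns this into additivity.\<close>
  have add: "f (x + y) = f x + f y" for x y
  proof -
    let ?m = "f ((1/2) *\<^sub>R (x + y))"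
    define u v where "u = (1/2) *\<^sub>R x" and "v = (1/2) *\<^sub>R y"
    have uv: "x = u + u" "y = v + v" unfolding u_def v_def by (simp_all flip: scaleR_left_distrib)
    have "x - (u + v) = u - v" "(u + v) - y = u - v" unfolding uv by simp_all
    then have "x - (1/2) *\<^sub>R (x + y) = (1/2) *\<^sub>R (x - y)" "(1/2) *\<^sub>R (x + y) - y = (1/2) *\<^sub>R (x - y)"
      unfolding u_def v_def by (simp_all add: scaleR_right_diff_distrib scaleR_right_distrib)
    then have n: "norm (f x - ?m) = norm (x - y) / 2" "norm (?m - f y) = norm (x - y) / 2"
      by (simp_all add: iso)
    have "f x - ?m = ?m - f y"
    proof (cases "x = y")
      case False
      have "norm ((f x - ?m) + (?m - f y)) = norm (f x - ?m) + norm (?m - f y)"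
        unfolding n by (simp add: iso)
      from norm_add_eqD[OF this] show ?thesis unfolding n using False by simp
    qed (use n in simp)
    then have "2 *\<^sub>R ?m = f x + f y" by (simp add: scaleR_2 algebra_simps)
    then show ?thesis by (simp add: scale)
  qed
  have "linear f" by (intro linearI add scale)
  then show ?thesis by (simp add: f_def)
qed

text \<open>If \<phi> annihilated \<open>z\<close> at all nonzero points near \<open>x\<close>, the
  norm would not change along a short step in direction \<open>z\<close>. Then
  \<open>y + \<eta> z\<close>, \<open>y - \<eta> z\<close> and their midpoint \<open>y\<close> would
  have the same norm, which strict convexity forbids.\<close>

lemma ex_near_phi_nonzero:
  assumes z: "z \<noteq> (0::'a)" and \<epsilon>: "\<epsilon> > 0"
  shows "\<exists>x'. norm (x' - x) < \<epsilon> \<and> x' \<noteq> 0 \<and> \<phi> x' z \<noteq> 0"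
proof (rule ccontr)
  assume "\<not> ?thesis"
  then have zero: "\<phi> x' z = 0" if "norm (x' - x) < \<epsilon>" "x' \<noteq> 0" for x' using that by blast
  \<comment> \<open>The base point \<open>y\<close> is at most \<epsilon>/4 away from
    \<open>x\<close>, and a step of length \<epsilon>/4 still stays inside the ball. For
    \<open>x = 0\<close> a nonzero base point has to be chosen.\<close>
  define \<eta> where "\<eta> = \<epsilon> / (4 * norm z)"
  have \<eta>: "\<eta> > 0" "\<eta> * norm z = \<epsilon> / 4" using z \<epsilon> by (auto simp: \<eta>_def)
  define y where "y = (if x = 0 then \<eta> *\<^sub>R z else x)"
  have y: "y \<noteq> 0" "norm (y - x) \<le> \<epsilon> / 4" using z \<eta> \<epsilon> by (auto simp: y_def)
  have y0: "\<phi> y z = 0" using zero[of y] y \<epsilon> by simp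
  have near: "norm (y + s *\<^sub>R z) = norm y \<and> y + s *\<^sub>R z \<noteq> 0" if s: "\<bar>s\<bar> = \<eta>" for s
  proof -
    have val: "\<phi> y (y + s *\<^sub>R z) = (norm y)\<^sup>2"
      using y y0 by (simp add: linear_add[OF linear_phi] linear_cmul[OF linear_phi] phi_self)
    then have ne: "y + s *\<^sub>R z \<noteq> 0" using y(1) linear_0[OF linear_phi[OF y(1)]] by auto
    have "norm (y + s *\<^sub>R z - x) \<le> norm (y - x) + norm (s *\<^sub>R z)"
      by (metis add_diff_eq add.commute norm_triangle_ineq add_diff_eq diff_add_eq)
    also have "\<dots> < \<epsilon>" using y(2) s \<eta> \<epsilon> by simp
    finally have w: "\<phi> (y + s *\<^sub>R z) z = 0" using zero ne by blast
    \<comment> \<open>The functional at either of the points \<open>y\<close> and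
      \<open>y + s z\<close> takes the same value at both of them. This gives both inequalities
      between the two norms.\<close>
    have "\<phi> (y + s *\<^sub>R z) y = \<phi> (y + s *\<^sub>R z) (y + s *\<^sub>R z)"
      using w by (simp add: linear_add[OF linear_phi[OF ne]] linear_cmul[OF linear_phi[OF ne]])
    then have "(norm (y + s *\<^sub>R z))\<^sup>2 \<le> norm (y + s *\<^sub>R z) * norm y"
      using phi_le[OF ne, of y] by (simp add: phi_self[OF ne])
    moreover have "(norm y)\<^sup>2 \<le> norm y * norm (y + s *\<^sub>R z)"
      using phi_le[OF y(1), of "y + s *\<^sub>R z"] val by simp
    ultimately have "norm (y + s *\<^sub>R z) = norm y" using y(1) ne by (simp add: power2_eq_square)
    then show ?thesis using ne by blast
  qed
  have p: "norm (y + \<eta> *\<^sub>R z) = norm y" "y + \<eta> *\<^sub>R z \<noteq> 0"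
    and m: "norm (y - \<eta> *\<^sub>R z) = norm y" "y - \<eta> *\<^sub>R z \<noteq> 0"
    using near[of \<eta>] near[of "- \<eta>"] \<eta>(1) by auto
  have "norm ((y + \<eta> *\<^sub>R z) + (y - \<eta> *\<^sub>R z)) = norm (2 *\<^sub>R y)" by (simp add: scaleR_2)
  also have "\<dots> = norm (y + \<eta> *\<^sub>R z) + norm (y - \<eta> *\<^sub>R z)" by (simp add: p m)
  finally have "norm (y - \<eta> *\<^sub>R z) *\<^sub>R (y + \<eta> *\<^sub>R z) = norm (y + \<eta> *\<^sub>R z) *\<^sub>R (y - \<eta> *\<^sub>R z)"
    by (rule norm_add_eqD)
  then have "y + \<eta> *\<^sub>R z = y - \<eta> *\<^sub>R z" using y(1) by (simp add: p m)
  then have "\<eta> *\<^sub>R z = - (\<eta> *\<^sub>R z)" by (simp add: diff_conv_add_uminus del: add_uminus_conv_diff)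
  then have "\<eta> *\<^sub>R z = 0" by (simp add: eq_neg_iff_add_eq_0 flip: scaleR_2)
  with \<eta>(1) z show False by simp
qed

text \<open>The vectors are adjusted one at a time. With \<open>z\<close> a common zero of the
  functionals found so far, a new vector whose functional does not vanish at \<open>z\<close> makes
  the functionals independent. This condition is open, so a further small shift can move the vector
  off the span of the earlier ones without destroying it.\<close>

lemma ex_near_general_position:
  fixes x :: "'i \<Rightarrow> 'a"
  assumes "finite I" "card I < d" "\<epsilon> > 0"
  shows "\<exists>y. (\<forall>i\<in>I. norm (y i - x i) < \<epsilon> \<and> y i \<noteq> 0) \<and> indep_family I y \<and> indep_family I (\<lambda>i. \<phi> (y i))"
  using assms(1,2)
proof (induction I)
  case empty
  then show ?case by (auto simp: indep_family_def)
next
  case (insert j I)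
  then obtain y where y: "\<And>i. i \<in> I \<Longrightarrow> norm (y i - x i) < \<epsilon> \<and> y i \<noteq> 0"
    "indep_family I y" "indep_family I (\<lambda>i. \<phi> (y i))" by auto
  have card: "card I < d" using insert by simp
  obtain z where z: "z \<noteq> 0" "\<And>i. i \<in> I \<Longrightarrow> \<phi> (y i) z = 0"
    by (rule ex_common_zero[OF insert.hyps(1) card, of "\<lambda>i. \<phi> (y i)"]) (use y linear_phi in auto)
  obtain x' where x': "norm (x' - x j) < \<epsilon> / 2" "x' \<noteq> 0" "\<phi> x' z \<noteq> 0"
    using ex_near_phi_nonzero[OF z(1), of "\<epsilon> / 2" "x j"] assms(3) by auto
  obtain w where w: "w \<notin> span (y ` I)"
    using ex_notin_span[of "y ` I"] insert.hyps(1) card card_image_le[of I y] by force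
  have "eventually (\<lambda>x''. \<phi> x'' z \<noteq> 0) (nhds x')"
    using tendsto_phi[OF filterlim_ident tendsto_const x'(2)] x'(3)
    by (rule tendsto_imp_eventually_ne)
  then obtain \<delta> where \<delta>: "\<delta> > 0" "\<And>x''. dist x'' x' < \<delta> \<Longrightarrow> \<phi> x'' z \<noteq> 0"
    unfolding eventually_nhds_metric by blast
  have "\<exists>x''. norm (x'' - x') < \<epsilon> / 2 \<and> \<phi> x'' z \<noteq> 0 \<and> x'' \<notin> span (y ` I)"
  proof (cases "x' \<in> span (y ` I)")
    case True
    \<comment> \<open>Any nonzero multiple of \<open>w\<close> moves \<open>x'\<close> off the span;
      this one is shorter than \<delta> and \<epsilon>/2, the \<open>+ 1\<close> making the bound
      strict.\<close>
    define t where "t = min \<delta> (\<epsilon> / 2) / (norm w + 1)"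
    have w1: "norm w + 1 > 0" by (simp add: add_nonneg_pos)
    then have t: "t > 0" using \<delta>(1) assms(3) by (simp add: t_def)
    have "t * norm w < t * (norm w + 1)" using t by simp
    also have "\<dots> = min \<delta> (\<epsilon> / 2)"
      using w1 by (simp add: t_def)
    finally have "norm (t *\<^sub>R w) < min \<delta> (\<epsilon> / 2)" using t by simp
    moreover have "x' + t *\<^sub>R w \<notin> span (y ` I)"
    proof
      assume "x' + t *\<^sub>R w \<in> span (y ` I)"
      then have "(1 / t) *\<^sub>R ((x' + t *\<^sub>R w) - x') \<in> span (y ` I)"
        using True by (intro span_scale span_diff)
      with w t show False by simp
    qed
    ultimately show ?thesis
      using \<delta>(2)[of "x' + t *\<^sub>R w"] by (intro exI[of _ "x' + t *\<^sub>R w"]) (simp add: dist_norm)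
  next
    case False
    with x' assms(3) show ?thesis by (intro exI[of _ x']) simp
  qed
  then obtain x'' where x'': "norm (x'' - x') < \<epsilon> / 2" "\<phi> x'' z \<noteq> 0" "x'' \<notin> span (y ` I)" by blast
  have near: "norm (x'' - x j) < \<epsilon>"
    using norm_triangle_ineq[of "x'' - x'" "x' - x j"] x'(1) x''(1) by simp
  have x''0: "x'' \<noteq> 0" using x''(3) span_zero by blast
  define y' where "y' = y(j := x'')"
  have eq: "y' i = y i" if "i \<in> I" for i using that insert.hyps(2) by (auto simp: y'_def)
  have "indep_family I y'" "indep_family I (\<lambda>i. \<phi> (y' i))"
    using y(2,3) eq by (auto simp: indep_family_def)
  then have "indep_family (insert j I) y'" "indep_family (insert j I) (\<lambda>i. \<phi> (y' i))"
  proof (atomize (full), intro conjI indep_family_insert insert.hyps)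
    fix c :: "'i \<Rightarrow> real"
    have "(\<Sum>i\<in>I. c i *\<^sub>R y' i) \<in> span (y ` I)"
      by (intro span_sum span_scale span_base) (simp add: eq)
    then show "y' j \<noteq> (\<Sum>i\<in>I. c i *\<^sub>R y' i)" using x''(3) by (auto simp: y'_def)
    have "(\<Sum>i\<in>I. c i *\<^sub>R \<phi> (y' i)) z = 0"
      using z(2) by (simp add: sum_fun_at eq)
    moreover have "\<phi> (y' j) z \<noteq> 0" using x'' by (simp add: y'_def)
    ultimately show "\<phi> (y' j) \<noteq> (\<Sum>i\<in>I. c i *\<^sub>R \<phi> (y' i))" by metis
  qed
  moreover have "\<forall>i\<in>insert j I. norm (y' i - x i) < \<epsilon> \<and> y' i \<noteq> 0"
    using y(1) eq near x''0 by (auto simp: y'_def)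
  ultimately show ?case by blast
qed

end

section \<open>Skew maps and one-parameter groups of isometries\<close>

context based_space
begin

text \<open>The exponential of a linear map, computed coordinatewise so that only real power series occur.\<close>
definition flow :: "('a \<Rightarrow> 'a) \<Rightarrow> real \<Rightarrow> 'a \<Rightarrow> 'a"
  where "flow A t x = (\<Sum>j\<in>{1..d}. (\<Sum>m. coord j ((A ^^ m) x) / fact m * t ^ m) *\<^sub>R b j)"

lemma linear_funpow:
  fixes A :: "'a \<Rightarrow> 'a"
  shows "linear A \<Longrightarrow> linear (A ^^ m)"
  by (induction m) (auto intro: linear_compose simp: linear_iff)

lemma summable_flow:
  fixes A :: "'a \<Rightarrow> 'a"
  assumes A: "linear A" and j: "j \<in> {1..d}"
  shows "summable (\<lambda>m. coord j ((A ^^ m) x) / fact m * t ^ m)"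
proof -
  obtain K where K: "K \<ge> 0" "\<And>x. norm (A x) \<le> K * norm x" using linear_bounded[OF A] by blast
  obtain C where C: "C \<ge> 0" "\<And>x k. k \<in> {1..d} \<Longrightarrow> \<bar>coord k x\<bar> \<le> C * norm x"
    using coord_bounded by blast
  have pow: "norm ((A ^^ m) x) \<le> K ^ m * norm x" for m
  proof (induction m)
    case (Suc m)
    have "norm ((A ^^ Suc m) x) \<le> K * norm ((A ^^ m) x)" using K(2) by simp
    also have "\<dots> \<le> K * (K ^ m * norm x)" by (rule mult_left_mono[OF Suc K(1)])
    finally show ?case by (simp add: mult.assoc)
  qed simp
  have "summable (\<lambda>m. C * norm x * (inverse (fact m) * (K * \<bar>t\<bar>) ^ m))"
    by (intro summable_mult summable_exp)
  then show ?thesis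
  proof (rule summable_comparison_test'[where N = 0])
    fix m
    have "\<bar>coord j ((A ^^ m) x)\<bar> \<le> C * (K ^ m * norm x)"
      using C(2)[OF j, of "(A ^^ m) x"] mult_left_mono[OF pow[of m] C(1)] by linarith
    then have "\<bar>coord j ((A ^^ m) x)\<bar> * (\<bar>t\<bar> ^ m / fact m) \<le> C * (K ^ m * norm x) * (\<bar>t\<bar> ^ m / fact m)"
      by (rule mult_right_mono) simp
    then show "norm (coord j ((A ^^ m) x) / fact m * t ^ m) \<le> C * norm x * (inverse (fact m) * (K * \<bar>t\<bar>) ^ m)"
      by (simp add: abs_mult power_abs power_mult_distrib divide_inverse mult_ac)
  qed
qed

lemma coord_flow:
  fixes A :: "'a \<Rightarrow> 'a"
  shows "j \<in> {1..d} \<Longrightarrow> coord j (flow A t x) = (\<Sum>m. coord j ((A ^^ m) x) / fact m * t ^ m)"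
  unfolding flow_def by (rule coord_sum)

lemma linear_flow:
  assumes A: "linear A"
  shows "linear (flow A t)"
proof (rule linearI)
  fix x y :: 'a and c :: real
  show "flow A t (x + y) = flow A t x + flow A t y"
  proof (rule eq_if_coord_eq)
    fix j assume j: "j \<in> {1..d}"
    show "coord j (flow A t (x + y)) = coord j (flow A t x + flow A t y)"
      using suminf_add[OF summable_flow[OF A j, of x t] summable_flow[OF A j, of y t]]
      by (simp add: coord_flow[OF j] linear_add[OF linear_funpow[OF A]] add_divide_distrib distrib_right)
  qed
  show "flow A t (c *\<^sub>R x) = c *\<^sub>R flow A t x"
  proof (rule eq_if_coord_eq)
    fix j assume j: "j \<in> {1..d}"
    show "coord j (flow A t (c *\<^sub>R x)) = coord j (c *\<^sub>R flow A t x)"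
      using suminf_mult[OF summable_flow[OF A j, of x t], of c]
      by (simp add: coord_flow[OF j] linear_cmul[OF linear_funpow[OF A]] mult.assoc)
  qed
qed

lemma flow_0 [simp]: "flow A 0 x = x"
  by (rule eq_if_coord_eq) (simp only: coord_flow powser_zero, simp)

text \<open>On coordinates \<open>A\<close> acts by a finite matrix, so it can be exchanged with the
  power series.\<close>

lemma flow_commute:
  assumes A: "linear A"
  shows "flow A t (A x) = A (flow A t x)"
proof (rule eq_if_coord_eq)
  fix j assume j: "j \<in> {1..d}"
  have expand: "coord j (A y) = (\<Sum>i\<in>{1..d}. coord i y * coord j (A (b i)))" for y
    by (subst linear_expand[OF A]) simp
  have "coord j (flow A t (A x)) = (\<Sum>m. coord j (A ((A ^^ m) x)) / fact m * t ^ m)"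
    by (simp add: coord_flow[OF j] funpow_swap1)
  also have "\<dots> = (\<Sum>m. \<Sum>i\<in>{1..d}. coord j (A (b i)) * (coord i ((A ^^ m) x) / fact m * t ^ m))"
    by (subst expand) (simp add: sum_distrib_right sum_distrib_left sum_divide_distrib mult_ac)
  also have "\<dots> = (\<Sum>i\<in>{1..d}. \<Sum>m. coord j (A (b i)) * (coord i ((A ^^ m) x) / fact m * t ^ m))"
    by (intro suminf_sum summable_mult summable_flow[OF A])
  also have "\<dots> = (\<Sum>i\<in>{1..d}. coord i (flow A t x) * coord j (A (b i)))"
    by (intro sum.cong refl, subst suminf_mult[OF summable_flow[OF A]]) (simp_all add: coord_flow)
  also have "\<dots> = coord j (A (flow A t x))" by (rule expand[symmetric])
  finally show "coord j (flow A t (A x)) = coord j (A (flow A t x))" .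
qed

text \<open>Differentiation shifts the coefficients, which replaces \<open>x\<close> by
  \<open>A x\<close>. In this form the derivative is again a flow curve, so all higher derivatives
  follow.\<close>

lemma flow_has_derivative:
  assumes A: "linear A"
  shows "((\<lambda>t. flow A t x) has_vector_derivative flow A t (A x)) (at t)"
  unfolding flow_def
proof (intro has_vector_derivative_sum)
  fix j assume j: "j \<in> {1..d}"
  let ?c = "\<lambda>m. coord j ((A ^^ m) x) / fact m"
  have "diffs ?c m = coord j ((A ^^ m) (A x)) / fact m" for m
    by (simp add: diffs_def funpow_swap1 field_simps del: of_nat_Suc)
  then have "((\<lambda>t. \<Sum>m. ?c m * t ^ m) has_field_derivative
      (\<Sum>m. coord j ((A ^^ m) (A x)) / fact m * t ^ m)) (at t)"
    using termdiffs_strong_converges_everywhere[OF summable_flow[OF A j, of x], of t] by simp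
  then show "((\<lambda>t. (\<Sum>m. ?c m * t ^ m) *\<^sub>R b j) has_vector_derivative
      (\<Sum>m. coord j ((A ^^ m) (A x)) / fact m * t ^ m) *\<^sub>R b j) (at t)"
    unfolding has_real_derivative_iff_has_vector_derivative
    by (rule bounded_linear.has_vector_derivative[OF bounded_linear_scaleR_left])
qed

lemma flow_fixes_kernel:
  assumes A: "linear A" and x: "A x = 0"
  shows "flow A t x = x"
proof -
  have "((\<lambda>t. flow A t x) has_vector_derivative 0) (at t within UNIV)" for t
    using flow_has_derivative[OF A, of x t] by (simp add: x linear_0[OF linear_flow[OF A]])
  then obtain c where "\<And>t. flow A t x = c"
    using has_vector_derivative_zero_constant[of UNIV "\<lambda>t. flow A t x"] by auto
  then show ?thesis by (metis flow_0)
qed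

lemma linear_isometry_inverse:
  fixes M :: "'a \<Rightarrow> 'a"
  assumes M: "linear M" "\<And>x. norm (M x) = norm x"
  shows "bij M" "linear (inv M)" "norm (inv M x) = norm x" "M (inv M x) = x" "inv M (M x) = x"
proof -
  have "inj M"
    using M by (metis linear_injective_0 norm_eq_zero)
  then show bij: "bij M" by (rule linear_inj_imp_bij[OF M(1)])
  show i1: "M (inv M x) = x" for x using bij by (simp add: bij_is_surj surj_f_inv_f)
  show i2: "inv M (M x) = x" using bij by (simp add: bij_is_inj)
  show "norm (inv M x) = norm x" using M(2)[of "inv M x"] by (simp add: i1)
  show "linear (inv M)"
  proof (rule linearI)
    show "inv M (x + y) = inv M x + inv M y" for x y
      by (rule injD[OF \<open>inj M\<close>]) (simp add: linear_add[OF M(1)] i1)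
    show "inv M (c *\<^sub>R x) = c *\<^sub>R inv M x" for c x
      by (rule injD[OF \<open>inj M\<close>]) (simp add: linear_cmul[OF M(1)] i1)
  qed
qed

end

context smooth_convex_space
begin

text \<open>The Lie algebra of the group of linear isometries.\<close>
definition skew :: "('a \<Rightarrow> 'a) \<Rightarrow> bool"
  where "skew A \<longleftrightarrow> linear A \<and> (\<forall>x. x \<noteq> 0 \<longrightarrow> \<phi> x (A x) = 0)"

lemma skew_scale: "skew A \<Longrightarrow> skew (\<lambda>x. c *\<^sub>R A x)"
  by (auto simp: skew_def linear_cmul[OF linear_phi] intro: linear_compose_scale_right)

lemma skew_sum:
  assumes "\<And>i. i \<in> I \<Longrightarrow> skew (A i)"
  shows "skew (\<lambda>x. \<Sum>i\<in>I. c i *\<^sub>R A i x)"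
  using assms
  by (auto simp: skew_def linear_sum[OF linear_phi] linear_cmul[OF linear_phi]
      intro!: linear_compose_sum linear_compose_scale_right)

text \<open>Unlike the norm, its square is differentiable at 0 as well, so curves through 0 are
  covered.\<close>

lemma norm_sq_has_derivative:
  assumes g: "(g has_vector_derivative u) (at t)"
  shows "((\<lambda>s. (norm (g s))\<^sup>2) has_real_derivative (if g t = 0 then 0 else 2 * \<phi> (g t) u)) (at t)"
proof (cases "g t = 0")
  case False
  from norm_has_derivative[OF g False]
  have "((\<lambda>s. (norm (g s))\<^sup>2) has_real_derivative 2 * (norm (g t) * (\<phi> (g t) u / norm (g t)))) (at t)"
    by (auto intro!: derivative_eq_intros simp: mult_ac)
  with False show ?thesis by simp
next
  case True
  have gt: "(g \<longlongrightarrow> 0) (at t)"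
    using has_vector_derivative_continuous[OF g] True by (simp add: isCont_def)
  have q: "((\<lambda>s. (g s - g t) /\<^sub>R (s - t)) \<longlongrightarrow> u) (at t)"
    using g has_vector_derivative_iff_quotient by blast
  have "((\<lambda>s. norm (g s) * norm ((g s - g t) /\<^sub>R (s - t))) \<longlongrightarrow> norm (0::'a) * norm u) (at t)"
    by (intro tendsto_intros gt q)
  then have "((\<lambda>s. norm (g s) * norm ((g s - g t) /\<^sub>R (s - t))) \<longlongrightarrow> 0) (at t)" by simp
  then have "((\<lambda>s. ((norm (g s))\<^sup>2 - (norm (g t))\<^sup>2) / (s - t)) \<longlongrightarrow> 0) (at t)"
    by (rule Lim_null_comparison[rotated])
      (simp add: True power2_eq_square abs_mult divide_inverse mult_ac)
  then show ?thesis by (simp add: True has_field_derivative_iff)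
qed

text \<open>At \<open>y = flow A t x\<close> the squared norm changes at the rate
  \<open>2 * \<phi> y (A y)\<close>, which skewness makes 0.\<close>

lemma norm_flow:
  assumes A: "skew A"
  shows "norm (flow A t x) = norm x"
proof -
  have lin: "linear A" using A by (simp add: skew_def)
  have "((\<lambda>t. (norm (flow A t x))\<^sup>2) has_real_derivative 0) (at t)" for t
    using norm_sq_has_derivative[OF flow_has_derivative[OF lin, of x t]] A
    by (simp add: flow_commute[OF lin] skew_def split: if_splits)
  then have "(norm (flow A t x))\<^sup>2 = (norm (flow A 0 x))\<^sup>2"
    using DERIV_isconst_all by blast
  then show ?thesis by simp
qed

text \<open>Such a map has rank at most one, with image spanned by \<open>A y\<close>. Skewness at
  \<open>A y\<close> gives \<open>A (A y) = 0\<close>, so \<open>A\<close> sends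
  \<open>A y + \<epsilon> y\<close> to \<open>\<epsilon> A y\<close>. Skewness at this point, with
  \<epsilon> tending to 0, shows that \<phi> at \<open>A y\<close> vanishes at \<open>A y\<close>,
  hence \<open>A y = 0\<close>.\<close>

lemma skew_zero:
  assumes A: "skew A" and x: "indep_family I x" "finite I" "card I = d - 1"
    and zero: "\<And>i. i \<in> I \<Longrightarrow> A (x i) = 0"
  shows "A v = 0"
proof -
  have lin: "linear A" and sk: "\<And>x. x \<noteq> 0 \<Longrightarrow> \<phi> x (A x) = 0" using A by (auto simp: skew_def)
  have ind: "independent (x ` I)" and card: "card (x ` I) = d - 1"
    using x by (auto simp: indep_family_iff card_image)
  obtain y where y: "y \<notin> span (x ` I)"
    using ex_notin_span[of "x ` I"] x card dim_pos by auto
  have span_all: "v \<in> span (insert y (x ` I))" for v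
  proof (rule ccontr)
    assume v: "v \<notin> span (insert y (x ` I))"
    have "y \<notin> x ` I" "v \<notin> insert y (x ` I)"
      using y v span_base[of y "x ` I"] span_base[of v "insert y (x ` I)"] by auto
    then have "card (insert v (insert y (x ` I))) = Suc d"
      using x card dim_pos by simp
    moreover have "independent (insert v (insert y (x ` I)))"
      using ind y v by (simp add: independent_insert)
    then have "card (insert v (insert y (x ` I))) \<le> card (b ` {1..d})"
      using real_vector.independent_span_bound[of "b ` {1..d}" "insert v (insert y (x ` I))"] span_b by auto
    ultimately show False using inj_b by (simp add: card_image)
  qed
  have A0: "A w = 0" if "w \<in> span (x ` I)" for w
    using linear_eq_0_on_span[OF lin _ that] zero by auto
  have A_mult: "\<exists>c. A v = c *\<^sub>R A y" for v
  proof -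
    obtain c where "v - c *\<^sub>R y \<in> span (x ` I)"
      using span_all[of v] unfolding span_breakdown_eq by blast
    then have "A (v - c *\<^sub>R y) = 0" by (rule A0)
    then show ?thesis by (auto simp: linear_diff[OF lin] linear_cmul[OF lin])
  qed
  have "A y = 0"
  proof (rule ccontr)
    assume a: "A y \<noteq> 0"
    obtain c where c: "A (A y) = c *\<^sub>R A y" using A_mult by blast
    have "\<phi> (A y) (A (A y)) = 0" using sk a by blast
    then have "c = 0" using a by (simp add: c linear_cmul[OF linear_phi] phi_self)
    then have AA: "A (A y) = 0" using c by simp
    have "\<phi> (A y + \<epsilon> *\<^sub>R y) (A y) = 0" if e: "\<epsilon> \<noteq> 0" for \<epsilon>
    proof -
      have Ae: "A (A y + \<epsilon> *\<^sub>R y) = \<epsilon> *\<^sub>R A y"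
        by (simp add: linear_add[OF lin] linear_cmul[OF lin] AA)
      then have ne: "A y + \<epsilon> *\<^sub>R y \<noteq> 0" using a e linear_0[OF lin] by auto
      have "\<phi> (A y + \<epsilon> *\<^sub>R y) (A (A y + \<epsilon> *\<^sub>R y)) = 0" using sk[OF ne] .
      then show ?thesis using e by (simp add: Ae linear_cmul[OF linear_phi[OF ne]])
    qed
    then have ev: "eventually (\<lambda>\<epsilon>. \<phi> (A y + \<epsilon> *\<^sub>R y) (A y) = 0) (at (0::real))"
      by (simp add: eventually_at_filter)
    have "((\<lambda>\<epsilon>. \<phi> (A y + \<epsilon> *\<^sub>R y) (A y)) \<longlongrightarrow> \<phi> (A y + 0 *\<^sub>R y) (A y)) (at (0::real))"
      by (intro tendsto_phi tendsto_intros) (use a in simp)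
    from LIM_const_eq[OF Lim_transform_eventually[OF this ev]]
    have "\<phi> (A y) (A y) = 0" by simp
    then show False using a by (simp add: phi_self)
  qed
  then show ?thesis using A_mult[of v] by auto
qed

text \<open>As \<open>M n\<close> preserves the norm, \<phi> at \<open>x\<close> is at most 0 on the
  increment \<open>M n x - x\<close>, and \<phi> at \<open>M n x\<close> is at least 0 on it. Both
  functionals tend to \<phi> at \<open>x\<close>. The scale may be any positive sequence, so no
  regularity in time enters.\<close>

lemma skew_limit:
  assumes M: "\<And>n x. norm (M n x) = norm x" and lim: "\<And>x. (\<lambda>n. M n x) \<longlonglongrightarrow> x"
    and \<rho>: "\<And>n. \<rho> n > 0" and H: "linear H" "\<And>x. (\<lambda>n. (M n x - x) /\<^sub>R \<rho> n) \<longlonglongrightarrow> H x"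
  shows "skew H"
  unfolding skew_def
proof (intro conjI allI impI)
  fix x :: 'a assume x: "x \<noteq> 0"
  have Mx: "M n x \<noteq> 0" for n using M[of n x] x by auto
  have "\<phi> x (H x) \<le> 0"
  proof (rule LIMSEQ_le_const2)
    show "(\<lambda>n. \<phi> x ((M n x - x) /\<^sub>R \<rho> n)) \<longlonglongrightarrow> \<phi> x (H x)"
      by (intro tendsto_phi tendsto_const H x)
    have "\<phi> x (M n x - x) \<le> 0" for n
      using phi_le[OF x, of "M n x"]
      by (simp add: linear_diff[OF linear_phi[OF x]] phi_self[OF x] M power2_eq_square)
    then show "\<exists>N. \<forall>n\<ge>N. \<phi> x ((M n x - x) /\<^sub>R \<rho> n) \<le> 0"
      using \<rho> by (auto simp: linear_cmul[OF linear_phi[OF x]] mult_nonneg_nonpos less_imp_le)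
  qed
  moreover have "\<phi> x (H x) \<ge> 0"
  proof (rule LIMSEQ_le_const)
    show "(\<lambda>n. \<phi> (M n x) ((M n x - x) /\<^sub>R \<rho> n)) \<longlonglongrightarrow> \<phi> x (H x)"
      by (intro tendsto_phi lim H x)
    have "\<phi> (M n x) (M n x - x) \<ge> 0" for n
      using phi_le[OF Mx, of n x]
      by (simp add: linear_diff[OF linear_phi[OF Mx]] phi_self[OF Mx] M power2_eq_square)
    then show "\<exists>N. \<forall>n\<ge>N. 0 \<le> \<phi> (M n x) ((M n x - x) /\<^sub>R \<rho> n)"
      using \<rho> by (auto simp: linear_cmul[OF linear_phi[OF Mx]] less_imp_le)
  qed
  ultimately show "\<phi> x (H x) = 0" by simp
qed (rule H)

lemma tangent_space_superset:
  assumes A: "skew A" and p: "p \<in> config_space V"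
  shows "(\<lambda>v. if v \<in> V then A (p v) + c else 0) \<in> tangent_space (orbit V p) p"
proof -
  have lin: "linear A" using A by (simp add: skew_def)
  define \<gamma> where "\<gamma> t v = (if v \<in> V then flow A t (p v) + t *\<^sub>R c else 0)" for t v
  \<comment> \<open>\<open>D v n\<close> is the \<open>n\<close>-th derivative of the curve: each
    differentiation puts another \<open>A\<close> under the flow, and the translation contributes
    only for \<open>n = 0\<close> and \<open>n = 1\<close>.\<close>
  define D where "D v n t = (if v \<in> V then flow A t ((A ^^ n) (p v))
      + (if n = 0 then t *\<^sub>R c else if n = 1 then c else 0) else 0)" for v and n :: nat and t
  have D: "(D v n has_vector_derivative D v (Suc n) t) (at t)" for v n t
  proof (cases "v \<in> V")
    case True
    have "((\<lambda>t. if n = 0 then t *\<^sub>R c else if n = 1 then c else 0) has_vector_derivative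
        (if Suc n = 0 then t *\<^sub>R c else if Suc n = 1 then c else 0)) (at t)"
      by (cases "n = 0") (auto intro!: derivative_eq_intros simp: One_nat_def)
    moreover have "((\<lambda>t. flow A t ((A ^^ n) (p v))) has_vector_derivative flow A t ((A ^^ Suc n) (p v))) (at t)"
      using flow_has_derivative[OF lin, of "(A ^^ n) (p v)" t] by simp
    ultimately have "((\<lambda>t. flow A t ((A ^^ n) (p v)) + (if n = 0 then t *\<^sub>R c else if n = 1 then c else 0))
        has_vector_derivative flow A t ((A ^^ Suc n) (p v))
          + (if Suc n = 0 then t *\<^sub>R c else if Suc n = 1 then c else 0)) (at t)"
      by (intro has_vector_derivative_add)
    then show ?thesis using True unfolding D_def by (simp only: if_True)
  qed (simp add: D_def[abs_def])
  have D0: "D v 0 = (\<lambda>t. \<gamma> t v)" for v by (auto simp: D_def \<gamma>_def fun_eq_iff)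
  have smooth: "smooth_curve_on {-1<..<1} (\<lambda>t. \<gamma> t v)" for v
    unfolding smooth_curve_on_def using D D0 by blast
  have orb: "\<gamma> t \<in> orbit V p" for t
  proof -
    note S = linear_isometry_inverse[OF linear_flow[OF lin] norm_flow[OF A], of t]
    \<comment> \<open>\<open>orbit\<close> asks for an isometry from the curve point back to
      \<open>p\<close>, hence the inverse of the flow.\<close>
    define T where "T x = inv (flow A t) (x - t *\<^sub>R c)" for x
    have "isometry T"
      unfolding isometry_def T_def dist_norm
      by (simp add: S(3) flip: linear_diff[OF S(2)])
    moreover have "\<forall>v\<in>V. p v = T (\<gamma> t v)" by (simp add: T_def \<gamma>_def S(5))
    moreover have "\<gamma> t \<in> config_space V" by (simp add: \<gamma>_def config_space_def)
    ultimately show ?thesis by (auto simp: orbit_def)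
  qed
  have start: "\<gamma> 0 = p" using p by (auto simp: \<gamma>_def config_space_def fun_eq_iff)
  have deriv: "((\<lambda>t. \<gamma> t v) has_vector_derivative (if v \<in> V then A (p v) + c else 0)) (at 0)" for v
  proof -
    have "D v (Suc 0) 0 = (if v \<in> V then A (p v) + c else 0)" by (simp add: D_def One_nat_def)
    then show ?thesis using D[of v 0 0] by (simp add: D0)
  qed
  show ?thesis
    unfolding tangent_space_def mem_Collect_eq
    by (intro exI[of _ "1::real"] conjI exI[of _ \<gamma>] allI ballI)
      (rule zero_less_one smooth orb start deriv)+
qed

end

section \<open>Tangent spaces of orbits\<close>

context smooth_convex_space
begin

text \<open>The distance of \<open>M\<close> from the identity, measured on the basis because that
  determines a linear map.\<close>

definition displacement :: "('a \<Rightarrow> 'a) \<Rightarrow> real"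
  where "displacement M = (\<Sum>k\<in>{1..d}. norm (M (b k) - b k))"

text \<open>Meant for differences of positions, from which translations have dropped out, so that
  linear isometries suffice.\<close>

definition carriers :: "'v set \<Rightarrow> ('v \<Rightarrow> 'a) \<Rightarrow> ('v \<Rightarrow> 'a) \<Rightarrow> ('a \<Rightarrow> 'a) set"
  where "carriers V x y = {M. linear M \<and> (\<forall>z. norm (M z) = norm z) \<and> (\<forall>v\<in>V. M (x v) = y v)}"

text \<open>The orbit supplies an isometry in the opposite direction; the inverse of its linear part
  is a carrier.\<close>

lemma carriers_nonempty:
  assumes q: "q \<in> orbit V p" and v0: "v0 \<in> V"
  shows "carriers V (\<lambda>v. p v - p v0) (\<lambda>v. q v - q v0) \<noteq> {}"
proof -
  from q obtain T where T: "isometry T" "\<And>v. v \<in> V \<Longrightarrow> p v = T (q v)" by (auto simp: orbit_def)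
  define L where "L = (\<lambda>x. T x - T 0)"
  have L: "linear L" unfolding L_def by (rule linear_isometry[OF T(1)])
  have norm_L: "norm (L x) = norm x" for x
    using T(1) unfolding isometry_def L_def by (metis diff_zero dist_norm)
  note S = linear_isometry_inverse[OF L norm_L]
  have "p v - p v0 = L (q v - q v0)" if "v \<in> V" for v
    using that v0 T(2) by (simp add: linear_diff[OF L]) (simp add: L_def)
  then have "inv L \<in> carriers V (\<lambda>v. p v - p v0) (\<lambda>v. q v - q v0)"
    using S by (simp add: carriers_def)
  then show ?thesis by blast
qed

text \<open>The tolerance \<open>e\<close> stands in for the compactness argument that an exact
  minimizer would require.\<close>

lemma ex_near_minimizer:
  assumes "carriers V x y \<noteq> {}" "e > 0"
  shows "\<exists>M\<in>carriers V x y. \<forall>M'\<in>carriers V x y. displacement M \<le> displacement M' + e"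
proof -
  let ?S = "displacement ` carriers V x y"
  have bdd: "bdd_below ?S" by (intro bdd_belowI[of _ 0]) (auto simp: displacement_def sum_nonneg)
  have "Inf ?S < Inf ?S + e" using assms(2) by simp
  then obtain M where M: "M \<in> carriers V x y" "displacement M < Inf ?S + e"
    using cInf_lessD[of ?S "Inf ?S + e"] assms(1) by auto
  have "displacement M \<le> displacement M' + e" if "M' \<in> carriers V x y" for M'
    using M(2) cInf_lower[OF imageI[OF that] bdd] by linarith
  with M(1) show ?thesis by blast
qed

text \<open>For \<open>t\<close> tending to \<open>0\<close> take linear isometries \<open>M\<close> that move \<open>p\<close> to the point of the curve
  at time \<open>t\<close> and are nearly as close to the identity as possible. A subsequence of the rescaled
  \<open>M - 1\<close> converges to a skew map. If the scale were not comparable to \<open>t\<close>, then this map would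
  annihilate the directions of \<open>p\<close>, and composing \<open>M\<close> with its flow would bring \<open>M\<close> closer to the
  identity.\<close>
lemma tangent_space_subset:
  assumes u: "u \<in> tangent_space (orbit V p) p" and v0: "v0 \<in> V"
  shows "\<exists>A c. skew A \<and> (\<forall>v\<in>V. u v = A (p v) + c)"
proof -
  from u obtain \<epsilon> \<gamma> where \<epsilon>: "\<epsilon> > 0" and orb: "\<And>t. t \<in> {-\<epsilon><..<\<epsilon>} \<Longrightarrow> \<gamma> t \<in> orbit V p"
    and start: "\<gamma> 0 = p" and deriv: "\<And>v. ((\<lambda>t. \<gamma> t v) has_vector_derivative u v) (at 0)"
    unfolding tangent_space_def by blast
  define x where "x v = p v - p v0" for v
  define y where "y t v = \<gamma> t v - \<gamma> t v0" for t v
  define w where "w v = u v - u v0" for v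
  define \<tau> where "\<tau> n = \<epsilon> / 2 * inverse (real (Suc n))" for n
  have \<tau>: "0 < \<tau> n" "\<tau> n < \<epsilon>" for n
  proof -
    show "0 < \<tau> n" using \<epsilon> by (simp add: \<tau>_def del: of_nat_Suc)
    have "inverse (real (Suc n)) \<le> 1" by (simp add: inverse_le_1_iff)
    then have "\<tau> n \<le> \<epsilon> / 2 * 1" unfolding \<tau>_def using \<epsilon> by (intro mult_left_mono) auto
    with \<epsilon> show "\<tau> n < \<epsilon>" by simp
  qed
  have "\<tau> \<longlonglongrightarrow> \<epsilon> / 2 * 0" unfolding \<tau>_def
    by (intro tendsto_intros LIMSEQ_inverse_real_of_nat)
  then have \<tau>_lim: "\<tau> \<longlonglongrightarrow> 0" by simp
  have "((\<lambda>t. y t v) has_vector_derivative w v) (at 0)" for v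
    unfolding y_def w_def by (intro has_vector_derivative_diff deriv)
  moreover have y0: "y 0 v = x v" for v by (simp add: y_def x_def start)
  ultimately have yq: "((\<lambda>t. (y t v - x v) /\<^sub>R t) \<longlongrightarrow> w v) (at 0)" for v
    by (simp add: has_vector_derivative_iff_quotient)
  have "filterlim \<tau> (at 0) sequentially"
    unfolding filterlim_at using \<tau>(1) \<tau>_lim by (auto simp: less_le)
  then have y_quot: "(\<lambda>n. (y (\<tau> n) v - x v) /\<^sub>R \<tau> n) \<longlonglongrightarrow> w v" for v
    using yq by (rule filterlim_compose[rotated])
  have y_lim: "(\<lambda>n. y (\<tau> n) v) \<longlonglongrightarrow> x v" for v
  proof -
    have "(\<lambda>n. \<tau> n *\<^sub>R ((y (\<tau> n) v - x v) /\<^sub>R \<tau> n) + x v) \<longlonglongrightarrow> 0 *\<^sub>R w v + x v"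
      by (intro tendsto_intros \<tau>_lim y_quot)
    then show ?thesis using \<tau>(1) by (simp add: less_imp_neq[symmetric])
  qed
  \<comment> \<open>The tolerance is the square of the time: divided by a scale at least as large as
    the time, it still tends to 0.\<close>
  have "\<exists>M\<in>carriers V x (y (\<tau> n)). \<forall>M'\<in>carriers V x (y (\<tau> n)). displacement M \<le> displacement M' + (\<tau> n)\<^sup>2" for n
  proof (rule ex_near_minimizer)
    have "\<gamma> (\<tau> n) \<in> orbit V p" using orb[of "\<tau> n"] \<tau>[of n] by simp
    then show "carriers V x (y (\<tau> n)) \<noteq> {}"
      using carriers_nonempty[OF _ v0] unfolding x_def[abs_def] y_def[abs_def] by blast
    show "(\<tau> n)\<^sup>2 > 0" using \<tau>(1)[of n] by simp
  qed
  then obtain M where M: "\<And>n. M n \<in> carriers V x (y (\<tau> n))"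
    "\<And>n M'. M' \<in> carriers V x (y (\<tau> n)) \<Longrightarrow> displacement (M n) \<le> displacement M' + (\<tau> n)\<^sup>2"
    by metis
  have M_lin: "linear (M n)" and M_norm: "norm (M n z) = norm z"
    and M_x: "v \<in> V \<Longrightarrow> M n (x v) = y (\<tau> n) v" for n z v
    using M(1)[of n] by (auto simp: carriers_def)

  define R where "R = (\<Sum>k\<in>{1..d}. norm (b k))"
  have b_le: "norm (b k) \<le> R" if "k \<in> {1..d}" for k
    unfolding R_def by (rule member_le_sum[OF that]) auto
  obtain S where S: "compact S" "\<And>z::'a. norm z \<le> R \<Longrightarrow> z \<in> S" using compact_superset_cball by blast
  \<comment> \<open>A first limit of the carriers. It need not be the identity; it is only known to
    be a linear isometry that fixes every \<open>x v\<close>.\<close>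
  obtain s N where s: "strict_mono s" and N: "linear N" "\<And>z. (\<lambda>n. M (s n) z) \<longlonglongrightarrow> N z"
    by (rule linear_subseq_converges[of M S]) (use M_lin M_norm b_le S in auto)
  have N_norm: "norm (N z) = norm z" for z
    using LIMSEQ_unique[OF tendsto_norm[OF N(2)[of z]]] by (simp add: M_norm)
  have N_x: "N (x v) = x v" if "v \<in> V" for v
    using LIMSEQ_unique[OF N(2)[of "x v"]] LIMSEQ_subseq_LIMSEQ[OF y_lim s, of v] that
    by (simp add: M_x o_def)
  note Ninv = linear_isometry_inverse[OF N(1) N_norm]
  define t where "t n = \<tau> (s n)" for n
  define P where "P n = M (s n)" for n
  define r where "r n = displacement (P n)" for n
  have t: "t n > 0" for n by (simp add: t_def \<tau>)
  have t_lim: "t \<longlonglongrightarrow> 0" using LIMSEQ_subseq_LIMSEQ[OF \<tau>_lim s] by (simp add: o_def t_def[abs_def])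
  have P: "P n \<in> carriers V x (y (t n))"
    and P_min: "M' \<in> carriers V x (y (t n)) \<Longrightarrow> r n \<le> displacement M' + (t n)\<^sup>2" for n M'
    using M(1)[of "s n"] M(2)[of M' "s n"] by (auto simp: P_def t_def r_def)
  have P_lin: "linear (P n)" and P_norm: "norm (P n z) = norm z"
    and P_x: "v \<in> V \<Longrightarrow> P n (x v) = y (t n) v" for n z v
    using P[of n] by (auto simp: carriers_def)
  have yt_quot: "(\<lambda>n. (y (t n) v - x v) /\<^sub>R t n) \<longlonglongrightarrow> w v" for v
    using LIMSEQ_subseq_LIMSEQ[OF y_quot s] by (simp add: o_def t_def)
  have r_nonneg: "r n \<ge> 0" for n by (simp add: r_def displacement_def sum_nonneg)
  \<comment> \<open>\<open>P n\<close> composed with the inverse of \<open>N\<close> is still a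
    carrier, and it tends to the identity. Near-minimality forces the displacement of
    \<open>P n\<close> itself to tend to 0.\<close>
  have r_lim: "r \<longlonglongrightarrow> 0"
  proof (rule tendsto_sandwich[where f = "\<lambda>_. 0"])
    have inv_x: "inv N (x v) = x v" if "v \<in> V" for v using Ninv(5)[of "x v"] N_x[OF that] by simp
    have "(\<lambda>z. P n (inv N z)) \<in> carriers V x (y (t n))" for n
      using linear_compose[OF Ninv(2) P_lin] by (simp add: carriers_def o_def P_norm Ninv P_x inv_x)
    then show "\<forall>\<^sub>F n in sequentially. r n \<le> displacement (\<lambda>z. P n (inv N z)) + (t n)\<^sup>2"
      using P_min by simp
    have "(\<lambda>n. displacement (\<lambda>z. P n (inv N z)) + (t n)\<^sup>2)
        \<longlonglongrightarrow> (\<Sum>k\<in>{1..d}. norm (N (inv N (b k)) - b k)) + 0\<^sup>2"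
      unfolding displacement_def P_def by (intro tendsto_intros N(2) t_lim)
    then show "(\<lambda>n. displacement (\<lambda>z. P n (inv N z)) + (t n)\<^sup>2) \<longlonglongrightarrow> 0"
      by (simp add: Ninv)
  qed (use r_nonneg in auto)
  have P_lim: "(\<lambda>n. P n z) \<longlonglongrightarrow> z" for z
  proof (rule tendsto_if_tendsto_basis[where g = "\<lambda>z. z", OF P_lin])
    fix k assume k: "k \<in> {1..d}"
    have "norm (P n (b k) - b k) \<le> r n" for n
      unfolding r_def displacement_def using k by (intro member_le_sum) auto
    then have "(\<lambda>n. P n (b k) - b k) \<longlonglongrightarrow> 0" by (intro Lim_null_comparison[OF _ r_lim]) simp
    then show "(\<lambda>n. P n (b k)) \<longlonglongrightarrow> b k" by (simp add: LIM_zero_iff)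
  qed (simp add: linear_iff)

  \<comment> \<open>The larger of displacement and time, so that the rescaled maps and the ratio of
    time to scale are both bounded and have convergent subsequences.\<close>
  define \<rho> where "\<rho> n = max (r n) (t n)" for n
  have \<rho>: "\<rho> n > 0" for n using t[of n] by (simp add: \<rho>_def)
  have \<rho>_lim: "\<rho> \<longlonglongrightarrow> 0" using tendsto_max[OF r_lim t_lim] by (simp add: \<rho>_def[abs_def])
  define \<eta> where "\<eta> n z = (P n z - z) /\<^sub>R \<rho> n" for n z
  have \<eta>_lin: "linear (\<eta> n)" for n
    unfolding \<eta>_def by (intro linearI)
      (simp_all add: linear_add[OF P_lin] linear_cmul[OF P_lin] algebra_simps)
  have \<eta>_bound: "norm (\<eta> n (b k)) \<le> 1" if k: "k \<in> {1..d}" for n k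
  proof -
    have "norm (P n (b k) - b k) \<le> r n"
      unfolding r_def displacement_def using k by (intro member_le_sum) auto
    also have "\<dots> \<le> \<rho> n" by (simp add: \<rho>_def)
    finally show ?thesis using \<rho>[of n] by (simp add: \<eta>_def inverse_eq_divide pos_divide_le_eq)
  qed
  obtain S' where S': "compact S'" "\<And>z::'a. norm z \<le> 1 \<Longrightarrow> z \<in> S'" using compact_superset_cball by blast
  obtain s1 H where s1: "strict_mono s1" and H: "linear H" "\<And>z. (\<lambda>n. \<eta> (s1 n) z) \<longlonglongrightarrow> H z"
    by (rule linear_subseq_converges[of \<eta> S']) (use \<eta>_lin \<eta>_bound S' in auto)
  have ratio: "t n / \<rho> n \<in> {0..1}" for n using t[of n] \<rho>[of n] by (auto simp: \<rho>_def)
  obtain s2 \<theta> where s2: "strict_mono s2" and \<theta>: "((\<lambda>n. t (s1 n) / \<rho> (s1 n)) \<circ> s2) \<longlonglongrightarrow> \<theta>"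
    by (rule seq_compactE[OF compact_imp_seq_compact[OF compact_Icc[of 0 "1::real"]],
          of "\<lambda>n. t (s1 n) / \<rho> (s1 n)"]) (use ratio in auto)
  define i where "i n = s1 (s2 n)" for n
  have i: "strict_mono i" using s1 s2 by (simp add: strict_mono_def i_def)
  have \<theta>_lim: "(\<lambda>n. t (i n) / \<rho> (i n)) \<longlonglongrightarrow> \<theta>" using \<theta> by (simp add: o_def i_def)
  have \<theta>_nonneg: "\<theta> \<ge> 0"
    by (rule LIMSEQ_le_const[OF \<theta>_lim]) (use ratio in auto)
  have H_lim: "(\<lambda>n. \<eta> (i n) z) \<longlonglongrightarrow> H z" for z
    using LIMSEQ_subseq_LIMSEQ[OF H(2) s2] by (simp add: o_def i_def)
  have sub: "f \<longlonglongrightarrow> l \<Longrightarrow> (\<lambda>n. f (i n)) \<longlonglongrightarrow> l" for f :: "nat \<Rightarrow> 'c::topological_space" and l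
    using LIMSEQ_subseq_LIMSEQ[OF _ i] by (auto simp: o_def)
  have skew_H: "skew H"
    by (rule skew_limit[where M = "\<lambda>n. P (i n)" and \<rho> = "\<lambda>n. \<rho> (i n)"])
      (use P_norm \<rho> H(1) H_lim LIMSEQ_subseq_LIMSEQ[OF P_lim i] in \<open>auto simp: o_def \<eta>_def\<close>)
  have H_x: "H (x v) = \<theta> *\<^sub>R w v" if v: "v \<in> V" for v
  proof (rule LIMSEQ_unique[OF H_lim])
    have "(\<lambda>n. (t (i n) / \<rho> (i n)) *\<^sub>R ((y (t (i n)) v - x v) /\<^sub>R t (i n))) \<longlonglongrightarrow> \<theta> *\<^sub>R w v"
      using LIMSEQ_subseq_LIMSEQ[OF yt_quot i] by (intro tendsto_intros \<theta>_lim) (simp add: o_def)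
    moreover have "(t n / \<rho> n) *\<^sub>R ((y (t n) v - x v) /\<^sub>R t n) = \<eta> n (x v)" for n
      using t[of n] by (simp add: \<eta>_def P_x[OF v] divide_inverse)
    ultimately show "(\<lambda>n. \<eta> (i n) (x v)) \<longlonglongrightarrow> \<theta> *\<^sub>R w v" by simp
  qed
  \<comment> \<open>If \<theta> were 0, the flow of \<open>H\<close> would fix every
    \<open>x v\<close>, so \<open>P n\<close> composed with it would remain a carrier. Running the
    flow for time \<open>- \<rho>\<close> cancels the first-order part of \<open>P n\<close> and
    leaves a displacement of \<open>o(\<rho>)\<close>. But near-minimality bounds \<rho> by this
    displacement plus \<open>t + t^2\<close>, which is also \<open>o(\<rho>)\<close>.\<close>
  have "\<theta> \<noteq> 0"
  proof
    assume \<theta>0: "\<theta> = 0"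
    define Q where "Q n z = P n (flow H (- \<rho> n) z)" for n z
    have "flow H s (x v) = x v" if "v \<in> V" for s v
      using flow_fixes_kernel[OF H(1)] H_x[OF that] \<theta>0 by simp
    then have "Q n \<in> carriers V x (y (t n))" for n
      using linear_compose[OF linear_flow[OF H(1)] P_lin]
      by (simp add: carriers_def o_def Q_def[abs_def] P_norm norm_flow[OF skew_H] P_x)
    then have min: "r n \<le> displacement (Q n) + (t n)\<^sup>2" for n by (rule P_min)
    have Q_lim: "(\<lambda>n. (Q (i n) z - z) /\<^sub>R \<rho> (i n)) \<longlonglongrightarrow> 0" for z
    proof -
      let ?h = "\<lambda>n. (flow H (- \<rho> (i n)) z - z) /\<^sub>R \<rho> (i n)"
      have "((\<lambda>s. (flow H s z - z) /\<^sub>R s) \<longlongrightarrow> H z) (at 0)"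
        using flow_has_derivative[OF H(1), of z 0]
        by (simp add: has_vector_derivative_iff_quotient)
      moreover have "(\<lambda>n. - \<rho> (i n)) \<longlonglongrightarrow> 0" using tendsto_minus[OF sub[OF \<rho>_lim]] by simp
      then have "filterlim (\<lambda>n. - \<rho> (i n)) (at 0) sequentially"
        unfolding filterlim_at using \<rho> by (auto simp: less_le)
      ultimately have "(\<lambda>n. (flow H (- \<rho> (i n)) z - z) /\<^sub>R (- \<rho> (i n))) \<longlonglongrightarrow> H z"
        by (rule filterlim_compose)
      from tendsto_minus[OF this] have h: "?h \<longlonglongrightarrow> - H z" by simp
      \<comment> \<open>The map \<open>P\<close> varies with \<open>n\<close>, so its argument is
        split into a null sequence, controlled because \<open>P\<close> preserves norms, and the
        fixed vector \<open>- H z\<close>.\<close>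
      have "(\<lambda>n. ?h n - - H z) \<longlonglongrightarrow> - H z - - H z" by (intro tendsto_intros h)
      then have "(\<lambda>n. norm (?h n - - H z)) \<longlonglongrightarrow> 0" by (simp add: tendsto_norm_zero_iff)
      then have "(\<lambda>n. P (i n) (?h n - - H z)) \<longlonglongrightarrow> 0"
        by (rule Lim_null_comparison[rotated]) (simp add: P_norm)
      moreover have "(\<lambda>n. P (i n) (- H z)) \<longlonglongrightarrow> - H z" by (rule sub[OF P_lim])
      ultimately have "(\<lambda>n. P (i n) (?h n - - H z) + P (i n) (- H z) + \<eta> (i n) z) \<longlonglongrightarrow> 0 + (- H z) + H z"
        by (intro tendsto_intros H_lim)
      moreover have "P (i n) (?h n - - H z) + P (i n) (- H z) + \<eta> (i n) z = (Q (i n) z - z) /\<^sub>R \<rho> (i n)" for n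
        by (simp add: Q_def \<eta>_def linear_add[OF P_lin] linear_diff[OF P_lin] linear_neg[OF P_lin]
            linear_cmul[OF P_lin] scaleR_right_diff_distrib)
      ultimately show ?thesis by simp
    qed
    have "(\<lambda>n. \<Sum>k\<in>{1..d}. norm ((Q (i n) (b k) - b k) /\<^sub>R \<rho> (i n))) \<longlonglongrightarrow> (\<Sum>k\<in>{1..d}. norm (0::'a))"
      by (intro tendsto_intros Q_lim)
    moreover have "(\<Sum>k\<in>{1..d}. norm ((Q n (b k) - b k) /\<^sub>R \<rho> n)) = displacement (Q n) / \<rho> n" for n
      using \<rho>[of n] by (simp add: displacement_def sum_divide_distrib divide_inverse mult.commute sum_distrib_left)
    ultimately have disp: "(\<lambda>n. displacement (Q (i n)) / \<rho> (i n)) \<longlonglongrightarrow> 0" by simp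
    have lower: "1 \<le> displacement (Q n) / \<rho> n + t n / \<rho> n + t n * (t n / \<rho> n)" for n
    proof -
      have "\<rho> n \<le> r n + t n" using r_nonneg[of n] t[of n] by (simp add: \<rho>_def)
      also have "\<dots> \<le> displacement (Q n) + (t n)\<^sup>2 + t n" using min[of n] by simp
      finally show ?thesis using \<rho>[of n] by (simp add: field_simps power2_eq_square)
    qed
    have "(\<lambda>n. displacement (Q (i n)) / \<rho> (i n) + t (i n) / \<rho> (i n) + t (i n) * (t (i n) / \<rho> (i n)))
        \<longlonglongrightarrow> 0 + \<theta> + 0 * \<theta>"
      by (intro tendsto_intros disp \<theta>_lim sub[OF t_lim])
    then have "1 \<le> 0 + \<theta> + 0 * \<theta>"
      by (rule LIMSEQ_le_const) (use lower in blast)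
    then show False by (simp add: \<theta>0)
  qed
  define A where "A z = (1 / \<theta>) *\<^sub>R H z" for z
  have "skew A" unfolding A_def by (rule skew_scale[OF skew_H])
  moreover have "u v = A (p v) + (u v0 - A (p v0))" if "v \<in> V" for v
  proof -
    have "A (x v) = w v" using H_x[OF that] \<open>\<theta> \<noteq> 0\<close> by (simp add: A_def)
    then show ?thesis
      using \<open>skew A\<close> by (simp add: skew_def x_def w_def linear_diff algebra_simps)
  qed
  ultimately show ?thesis by blast
qed

end

section \<open>Stresses and flexes\<close>

text \<open>Rows with arbitrary functionals on the edges: the rescaled rows of a split framework and
  their limit are of this kind, but they are not the rows of a placement.\<close>

definition edge_row ::
  "nat \<Rightarrow> (nat \<Rightarrow> 'a::real_normed_vector) \<Rightarrow> ('v \<Rightarrow> 'v \<Rightarrow> 'a \<Rightarrow> real) \<Rightarrow> 'v set \<Rightarrow> 'v \<times> nat \<Rightarrow> real"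
  where "edge_row d b \<theta> e = (\<lambda>(v, k).
    if v \<in> e \<and> k \<in> {1..d} then \<theta> v (the_elem (e - {v})) (b k) else 0)"

lemma rigidity_matrix_eq_edge_row:
  "rigidity_matrix d b p = edge_row d b (\<lambda>u w. support_functional (p u - p w))"
  by (rule ext) (simp add: rigidity_matrix_def edge_row_def)

lemma simple_graph_edgeE:
  assumes "simple_graph V E" "e \<in> E"
  obtains v w where "e = {v, w}" "v \<in> V" "w \<in> V" "v \<noteq> w"
  using assms unfolding simple_graph_def by blast

lemma simple_graphD:
  assumes "simple_graph V E" "{v, w} \<in> E"
  shows "v \<in> V" "w \<in> V" "v \<noteq> w"
  using assms(1) assms(2) by (auto elim!: simple_graph_edgeE simp: doubleton_eq_iff)

lemma simple_graph_finite:
  assumes "simple_graph V E"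
  shows "finite V" "finite E"
proof -
  show "finite V" using assms by (simp add: simple_graph_def)
  moreover have "E \<subseteq> Pow V" using assms by (auto elim: simple_graph_edgeE)
  ultimately show "finite E" by (meson finite_Pow_iff finite_subset)
qed

lemma the_elem_doubleton: "v \<noteq> w \<Longrightarrow> the_elem ({v, w} - {v}) = w"
  by (simp add: insert_Diff_if)

lemma edge_row_support:
  "simple_graph V E \<Longrightarrow> e \<in> E \<Longrightarrow> j \<notin> V \<times> {1..d} \<Longrightarrow> edge_row d b \<theta> e j = 0"
  by (cases j) (auto simp: edge_row_def elim!: simple_graph_edgeE)

text \<open>Each edge at \<open>v\<close> is counted through its other endpoint. A dependence
  between rows thereby becomes an equilibrium condition at each vertex.\<close>

lemma sum_edge_rows:
  assumes G: "simple_graph V E" and k: "k \<in> {1..d}"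
  shows "(\<Sum>e\<in>E. c e * edge_row d b \<theta> e (v, k))
    = (\<Sum>w\<in>V. (if {v, w} \<in> E then c {v, w} else 0) * \<theta> v w (b k))"
proof -
  note fin = simple_graph_finite[OF G]
  have bij: "bij_betw (\<lambda>w. {v, w}) {w \<in> V. {v, w} \<in> E} {e \<in> E. v \<in> e}"
  proof (rule bij_betw_imageI)
    show "inj_on (\<lambda>w. {v, w}) {w \<in> V. {v, w} \<in> E}"
      by (auto simp: inj_on_def doubleton_eq_iff)
    have "e \<in> (\<lambda>w. {v, w}) ` {w \<in> V. {v, w} \<in> E}" if ev: "e \<in> E" "v \<in> e" for e
    proof -
      obtain u w where e: "e = {u, w}" "u \<in> V" "w \<in> V" "u \<noteq> w"
        by (rule simple_graph_edgeE[OF G ev(1)])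
      show ?thesis
      proof (cases "v = u")
        case True
        with e ev(1) show ?thesis by blast
      next
        case False
        with ev(2) e have "e = {v, u}" by auto
        with e(2) ev(1) show ?thesis by blast
      qed
    qed
    then show "(\<lambda>w. {v, w}) ` {w \<in> V. {v, w} \<in> E} = {e \<in> E. v \<in> e}" by auto
  qed
  have "(\<Sum>e\<in>E. c e * edge_row d b \<theta> e (v, k)) = (\<Sum>e\<in>{e \<in> E. v \<in> e}. c e * edge_row d b \<theta> e (v, k))"
    by (rule sum.mono_neutral_right) (use fin in \<open>auto simp: edge_row_def\<close>)
  also have "\<dots> = (\<Sum>w\<in>{w \<in> V. {v, w} \<in> E}. c {v, w} * edge_row d b \<theta> {v, w} (v, k))"
    by (rule sum.reindex_bij_betw[OF bij, symmetric])
  also have "\<dots> = (\<Sum>w\<in>{w \<in> V. {v, w} \<in> E}. c {v, w} * \<theta> v w (b k))"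
  proof (rule sum.cong[OF refl])
    fix w assume "w \<in> {w \<in> V. {v, w} \<in> E}"
    then have "v \<noteq> w" using simple_graphD[OF G] by blast
    then show "c {v, w} * edge_row d b \<theta> {v, w} (v, k) = c {v, w} * \<theta> v w (b k)"
      using k unfolding edge_row_def by (simp add: the_elem_doubleton)
  qed
  also have "\<dots> = (\<Sum>w\<in>V. (if {v, w} \<in> E then c {v, w} else 0) * \<theta> v w (b k))"
    by (rule sum.mono_neutral_cong_left) (use fin in auto)
  finally show ?thesis .
qed

text \<open>Equilibrium stresses, with edge weights extended by zero to a symmetric function.\<close>
definition stress_free :: "'v set \<Rightarrow> 'v set set \<Rightarrow> ('v \<Rightarrow> 'v \<Rightarrow> 'a \<Rightarrow> real) \<Rightarrow> bool"
  where "stress_free V E \<theta> \<longleftrightarrow>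
    (\<forall>\<omega>. (\<forall>u w. \<omega> u w = \<omega> w u) \<and> (\<forall>u w. {u, w} \<notin> E \<longrightarrow> \<omega> u w = 0) \<and>
         (\<forall>u\<in>V. \<forall>x. (\<Sum>w\<in>V. \<omega> u w * \<theta> u w x) = 0) \<longrightarrow> (\<forall>u w. \<omega> u w = 0))"

lemma stress_freeD:
  assumes "stress_free V E \<theta>" "\<And>u w. \<omega> u w = \<omega> w u" "\<And>u w. {u, w} \<notin> E \<Longrightarrow> \<omega> u w = 0"
    "\<And>u x. u \<in> V \<Longrightarrow> (\<Sum>w\<in>V. \<omega> u w * \<theta> u w x) = 0"
  shows "\<omega> u w = 0"
  using assms unfolding stress_free_def by blast

lemma stress_free_if_indep_rows:
  assumes G: "simple_graph V E" and ind: "indep_family E (edge_row d b \<theta>)"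
  shows "stress_free V E \<theta>"
  unfolding stress_free_def
proof (intro allI impI, elim conjE)
  fix \<omega> :: "'a \<Rightarrow> 'a \<Rightarrow> real" and u w
  assume sym: "\<forall>u w. \<omega> u w = \<omega> w u" and off: "\<forall>u w. {u, w} \<notin> E \<longrightarrow> \<omega> u w = 0"
    and eq: "\<forall>u\<in>V. \<forall>x. (\<Sum>w\<in>V. \<omega> u w * \<theta> u w x) = 0"
  \<comment> \<open>The weight of an unordered edge; the symmetry of \<omega> makes this description
    unique.\<close>
  define c where "c e = (THE r. \<exists>u w. e = {u, w} \<and> r = \<omega> u w)" for e
  have c: "c {u, w} = \<omega> u w" for u w
    unfolding c_def by (rule the_equality) (use sym in \<open>auto simp: doubleton_eq_iff\<close>)
  have c': "(if {v, w} \<in> E then c {v, w} else 0) = \<omega> v w" for v w using c off by auto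
  have "(\<Sum>e\<in>E. c e *\<^sub>R edge_row d b \<theta> e) = 0"
  proof (rule ext)
    fix j :: "'a \<times> nat"
    show "(\<Sum>e\<in>E. c e *\<^sub>R edge_row d b \<theta> e) j = 0 j"
    proof (cases "j \<in> V \<times> {1..d}")
      case True
      then obtain v k where j: "j = (v, k)" "v \<in> V" "k \<in> {1..d}" by blast
      show ?thesis
        using sum_edge_rows[OF G j(3), of c b \<theta> v] eq j(2) by (simp add: j(1) sum_fun_at c')
    qed (simp add: sum_fun_at edge_row_support[OF G])
  qed
  then have "c e = 0" if "e \<in> E" for e using indep_familyD[OF ind _ that] by blast
  then show "\<omega> u w = 0" using c[of u w] off by metis
qed

context based_space
begin

text \<open>The rows record the functionals only at the basis vectors; linearity extends the
  equilibrium equations from there to all \<open>x\<close>.\<close>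

lemma indep_rows_if_stress_free:
  assumes G: "simple_graph V E" and lin: "\<And>u w. {u, w} \<in> E \<Longrightarrow> linear (\<theta> u w)"
    and sf: "stress_free V E \<theta>"
  shows "indep_family E (edge_row d b \<theta>)"
proof (rule indep_familyI)
  fix c e assume c: "(\<Sum>e\<in>E. c e *\<^sub>R edge_row d b \<theta> e) = 0" and e: "e \<in> E"
  define \<omega> where "\<omega> u w = (if {u, w} \<in> E then c {u, w} else 0)" for u w
  have eq_b: "(\<Sum>w\<in>V. \<omega> u w * \<theta> u w (b k)) = 0" if "k \<in> {1..d}" for u k
  proof -
    have "(\<Sum>e\<in>E. c e *\<^sub>R edge_row d b \<theta> e) (u, k) = 0" using c by simp
    then show ?thesis
      using sum_edge_rows[OF G that, of c b \<theta> u] by (simp add: sum_fun_at \<omega>_def)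
  qed
  have eq: "(\<Sum>w\<in>V. \<omega> u w * \<theta> u w x) = 0" for u x
  proof -
    have "(\<Sum>w\<in>V. \<omega> u w * \<theta> u w x) = (\<Sum>w\<in>V. \<Sum>k\<in>{1..d}. coord k x * (\<omega> u w * \<theta> u w (b k)))"
    proof (rule sum.cong[OF refl])
      fix w assume "w \<in> V"
      show "\<omega> u w * \<theta> u w x = (\<Sum>k\<in>{1..d}. coord k x * (\<omega> u w * \<theta> u w (b k)))"
      proof (cases "{u, w} \<in> E")
        case True
        show ?thesis
          by (subst linear_expand[OF lin[OF True]]) (simp add: sum_distrib_left mult_ac)
      qed (simp add: \<omega>_def)
    qed
    also have "\<dots> = (\<Sum>k\<in>{1..d}. coord k x * (\<Sum>w\<in>V. \<omega> u w * \<theta> u w (b k)))"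
      by (subst sum.swap) (simp add: sum_distrib_left)
    also have "\<dots> = 0" by (intro sum.neutral ballI) (simp only: eq_b mult_zero_right)
    finally show ?thesis .
  qed
  obtain u w where uw: "e = {u, w}" by (rule simple_graph_edgeE[OF G e])
  have "\<omega> u w = 0"
    by (rule stress_freeD[OF sf]) (use eq in \<open>auto simp: \<omega>_def insert_commute\<close>)
  with uw e show "c e = 0" by (simp add: \<omega>_def)
qed

lemma config_space_subset_span:
  assumes "finite V"
  obtains F where "finite F" "(config_space V :: ('v \<Rightarrow> 'a) set) \<subseteq> span F"
proof (rule that)
  let ?F = "(\<lambda>(j, x) k. if k = j then x else 0) ` (V \<times> b ` {1..d})"
  show "finite ?F" using assms by simp
  show "(config_space V :: ('v \<Rightarrow> 'a) set) \<subseteq> span ?F"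
    using finite_support_subset_span[OF assms _ _ span_b] by (auto simp: config_space_def)
qed

end

context smooth_convex_space
begin

section \<open>Infinitesimal rigid motions and bounds on their dimension\<close>

lemma tangent_space_subset_config_space:
  assumes u: "u \<in> tangent_space (orbit V (p :: 'v \<Rightarrow> 'a)) p"
  shows "u \<in> config_space V"
proof -
  from u obtain \<epsilon> \<gamma> where \<epsilon>: "\<epsilon> > 0" and orb: "\<And>t. t \<in> {-\<epsilon><..<\<epsilon>} \<Longrightarrow> \<gamma> t \<in> orbit V p"
    and deriv: "\<And>v. ((\<lambda>t. \<gamma> t v) has_vector_derivative u v) (at 0)"
    unfolding tangent_space_def by blast
  have "u v = 0" if v: "v \<notin> V" for v
  proof -
    have zero: "\<gamma> t v = 0" if "t \<in> {-\<epsilon><..<\<epsilon>}" for t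
      using orb[OF that] v by (simp add: orbit_def config_space_def)
    have lim: "((\<lambda>t. (\<gamma> t v - \<gamma> 0 v) /\<^sub>R (t - 0)) \<longlongrightarrow> u v) (at 0)"
      using deriv[of v] has_vector_derivative_iff_quotient[of "\<lambda>t. \<gamma> t v" "u v" 0] by blast
    have "eventually (\<lambda>t. t \<in> {-\<epsilon><..<\<epsilon>}) (at (0::real))"
      using \<epsilon> by (intro eventually_at_in_open') auto
    then have "eventually (\<lambda>t. (\<gamma> t v - \<gamma> 0 v) /\<^sub>R (t - 0) = 0) (at (0::real))"
      by eventually_elim (use zero \<epsilon> in simp)
    from LIM_const_eq[OF Lim_transform_eventually[OF lim this]] show ?thesis by simp
  qed
  then show ?thesis by (simp add: config_space_def)
qed

text \<open>Isometries of the whole space keep all distances constant along the curve, so the norm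
  of the difference of two positions has derivative 0.\<close>

lemma tangent_space_flex:
  assumes u: "u \<in> tangent_space (orbit V (p :: 'v \<Rightarrow> 'a)) p" and vw: "v \<in> V" "w \<in> V" "p v \<noteq> p w"
  shows "\<phi> (p v - p w) (u v) = \<phi> (p v - p w) (u w)"
proof -
  from u obtain \<epsilon> \<gamma> where \<epsilon>: "\<epsilon> > 0" and orb: "\<And>t. t \<in> {-\<epsilon><..<\<epsilon>} \<Longrightarrow> \<gamma> t \<in> orbit V p"
    and start: "\<gamma> 0 = p" and deriv: "\<And>v. ((\<lambda>t. \<gamma> t v) has_vector_derivative u v) (at 0)"
    unfolding tangent_space_def by blast
  have const: "norm (\<gamma> t v - \<gamma> t w) = norm (p v - p w)" if t: "t \<in> {-\<epsilon><..<\<epsilon>}" for t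
  proof -
    obtain T where "isometry T" "p v = T (\<gamma> t v)" "p w = T (\<gamma> t w)"
      using orb[OF t] vw by (auto simp: orbit_def)
    then show ?thesis unfolding isometry_def by (metis dist_norm)
  qed
  have ne: "p v - p w \<noteq> 0" using vw by simp
  have "((\<lambda>t. \<gamma> t v - \<gamma> t w) has_vector_derivative u v - u w) (at 0)"
    by (intro has_vector_derivative_diff deriv)
  from norm_has_derivative[OF this]
  have d: "((\<lambda>t. norm (\<gamma> t v - \<gamma> t w)) has_real_derivative \<phi> (p v - p w) (u v - u w) / norm (p v - p w)) (at 0)"
    using ne by (simp add: start)
  have "\<phi> (p v - p w) (u v - u w) / norm (p v - p w) = 0"
  proof (rule DERIV_local_const[OF d \<epsilon>], intro allI impI)
    fix t :: real assume "\<bar>0 - t\<bar> < \<epsilon>"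
    then have "t \<in> {-\<epsilon><..<\<epsilon>}" by auto
    then show "norm (\<gamma> 0 v - \<gamma> 0 w) = norm (\<gamma> t v - \<gamma> t w)" using const by (simp add: start)
  qed
  then show ?thesis using ne by (simp add: linear_diff[OF linear_phi[OF ne]])
qed

text \<open>A rigid motion of \<open>p\<close> induces one of \<open>q\<close>, and faithfully so, because only the zero skew map
  annihilates the differences of \<open>q\<close>.\<close>
lemma dim_tangent_space_le:
  fixes p :: "'v \<Rightarrow> 'a" and q :: "'w \<Rightarrow> 'a"
  assumes fin: "finite V" "finite W" and q: "q \<in> config_space W" and w0: "w0 \<in> W"
    and I: "finite I" "card I = d - 1" "ws ` I \<subseteq> W" and gp: "indep_family I (\<lambda>i. q w0 - q (ws i))"
  shows "dim (tangent_space (orbit V p) p) \<le> dim (tangent_space (orbit W q) q)"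
proof -
  let ?T = "tangent_space (orbit V p) p" and ?T' = "tangent_space (orbit W q) q"
  have Tsub: "?T \<subseteq> config_space V" "?T' \<subseteq> config_space W"
    using tangent_space_subset_config_space by blast+
  \<comment> \<open>The tangent space is treated as a mere set: \<open>dim\<close> is the dimension
    of its span, and \<open>B\<close> is taken from the set itself, so facts about single tangent
    vectors suffice.\<close>
  obtain B where B: "B \<subseteq> ?T" "independent B" "?T \<subseteq> span B" "card B = dim ?T"
    using real_vector.basis_exists by blast
  obtain F where F: "finite F" "(config_space V :: ('v \<Rightarrow> 'a) set) \<subseteq> span F"
    using config_space_subset_span[OF fin(1)] by blast
  have "B \<subseteq> span F" using B F Tsub by blast
  then have finB: "finite B" using real_vector.independent_span_bound[OF F(1) B(2)] by blast
  obtain F' where F': "finite F'" "(config_space W :: ('w \<Rightarrow> 'a) set) \<subseteq> span F'"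
    using config_space_subset_span[OF fin(2)] by blast
  have "\<exists>A c. skew A \<and> (\<forall>v\<in>V. u v = A (p v) + c)" if "u \<in> B" for u
  proof (cases "V = {}")
    case True
    have "u = 0" using that B Tsub True by (auto simp: config_space_def fun_eq_iff)
    then show ?thesis using that B(2) real_vector.dependent_zero by blast
  next
    case False
    then obtain v0 where "v0 \<in> V" by blast
    with that B(1) show ?thesis using tangent_space_subset[of u V p v0] by blast
  qed
  then obtain A c where A: "\<And>u. u \<in> B \<Longrightarrow> skew (A u)" "\<And>u v. u \<in> B \<Longrightarrow> v \<in> V \<Longrightarrow> u v = A u (p v) + c u"
    by metis
  define f where "f u w = (if w \<in> W then A u (q w) + c u else 0)" for u w
  have f: "f u \<in> ?T'" if "u \<in> B" for u
    using tangent_space_superset[OF A(1)[OF that] q] unfolding f_def[abs_def] .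
  have "indep_family B f"
  proof (rule indep_familyI)
    fix a u assume a: "(\<Sum>u\<in>B. a u *\<^sub>R f u) = 0" and u: "u \<in> B"
    define A' where "A' = (\<lambda>z. \<Sum>u\<in>B. a u *\<^sub>R A u z)"
    define C where "C = (\<Sum>u\<in>B. a u *\<^sub>R c u)"
    have skew: "skew A'" unfolding A'_def by (rule skew_sum[OF A(1)])
    then have lin: "linear A'" by (simp add: skew_def)
    have on_W: "A' (q w) + C = 0" if "w \<in> W" for w
    proof -
      have "(\<Sum>u\<in>B. a u *\<^sub>R f u) w = 0" using a by simp
      then show ?thesis
        using that by (simp add: sum_fun_at f_def A'_def C_def scaleR_add_right sum.distrib)
    qed
    have "A' (q w0 - q (ws i)) = 0" if "i \<in> I" for i
      using on_W[OF w0] on_W[of "ws i"] I(3) that by (auto simp: linear_diff[OF lin] eq_neg_iff_add_eq_0[symmetric])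
    then have A'0: "A' z = 0" for z by (rule skew_zero[OF skew gp I(1,2)])
    then have C0: "C = 0" using on_W[OF w0] by simp
    have "(\<Sum>u\<in>B. a u *\<^sub>R u) = 0"
    proof (rule ext)
      fix v
      show "(\<Sum>u\<in>B. a u *\<^sub>R u) v = 0 v"
      proof (cases "v \<in> V")
        case True
        have "(\<Sum>u\<in>B. a u *\<^sub>R u) v = (\<Sum>u\<in>B. a u *\<^sub>R (A u (p v) + c u))"
          unfolding sum_fun_at by (rule sum.cong) (use A(2) True in auto)
        also have "\<dots> = A' (p v) + C" by (simp add: A'_def C_def scaleR_add_right sum.distrib)
        finally show ?thesis by (simp add: A'0 C0)
      next
        case False
        then have "u v = 0" if "u \<in> B" for u using that B(1) Tsub by (auto simp: config_space_def)
        then have "(\<Sum>u\<in>B. a u *\<^sub>R u v) = 0" by (intro sum.neutral) auto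
        then show ?thesis by (simp add: sum_fun_at)
      qed
    qed
    moreover have "indep_family B (\<lambda>u. u)"
      using B(2) finB by (simp add: indep_family_iff)
    ultimately show "a u = 0" using indep_familyD[OF _ _ u, of "\<lambda>u. u" a] by blast
  qed
  then have "card B \<le> dim ?T'"
    by (rule card_indep_family_le_dim[OF _ finB _ _ F'(1)]) (use f Tsub(2) F'(2) in auto)
  with B(4) show ?thesis by simp
qed

lemma independent_framework_iff:
  assumes "simple_graph V E"
  shows "independent_framework d b V E p \<longleftrightarrow> placement V E p \<and> indep_family E (rigidity_matrix d b p)"
  using simple_graph_finite[OF assms] smooth_point
  by (auto simp: independent_framework_def well_positioned_def placement_def indep_family_iff)

text \<open>In the coordinates indexed by \<open>V \<times> {1..d}\<close> rows and tangent vectors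
  are orthogonal: pairing the row of \<open>{v, w}\<close> with a velocity \<open>u\<close> gives
  the value of \<phi> at \<open>p v - p w\<close> on \<open>u v - u w\<close>, which is 0 since
  distances are kept.\<close>

lemma dim_tangent_space_add_card_le:
  assumes G: "simple_graph V E" and ind: "independent_framework d b V E p"
  shows "dim (tangent_space (orbit V p) p) + card E \<le> d * card V"
proof -
  let ?T = "tangent_space (orbit V p) p"
  note fin = simple_graph_finite[OF G]
  have pl: "placement V E p" and rows: "indep_family E (rigidity_matrix d b p)"
    using ind by (auto simp: independent_framework_iff[OF G])
  obtain B where B: "B \<subseteq> ?T" "independent B" "?T \<subseteq> span B" "card B = dim ?T"
    using real_vector.basis_exists by blast
  have Bsub: "u \<in> config_space V" if "u \<in> B" for u
    using that B(1) tangent_space_subset_config_space by blast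
  obtain F where F: "finite F" "(config_space V :: ('b \<Rightarrow> 'a) set) \<subseteq> span F"
    using config_space_subset_span[OF fin(1)] by blast
  have "B \<subseteq> span F" using Bsub F by blast
  then have finB: "finite B" using real_vector.independent_span_bound[OF F(1) B(2)] by blast
  define g where "g u = (\<lambda>(v, k). if v \<in> V \<and> k \<in> {1..d} then coord k (u v) else 0)" for u :: "'b \<Rightarrow> 'a"
  have ind_g: "indep_family B g"
  proof (rule indep_familyI)
    fix a u assume a: "(\<Sum>u\<in>B. a u *\<^sub>R g u) = 0" and u: "u \<in> B"
    have "(\<Sum>u\<in>B. a u *\<^sub>R u) = 0"
    proof (rule ext)
      fix v
      show "(\<Sum>u\<in>B. a u *\<^sub>R u) v = 0 v"
      proof (cases "v \<in> V")
        case True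
        have "coord k ((\<Sum>u\<in>B. a u *\<^sub>R u) v) = coord k 0" if "k \<in> {1..d}" for k
        proof -
          have "(\<Sum>u\<in>B. a u *\<^sub>R g u) (v, k) = 0" using a by simp
          then show ?thesis using True that by (simp add: sum_fun_at g_def)
        qed
        then have "(\<Sum>u\<in>B. a u *\<^sub>R u) v = 0" by (rule eq_if_coord_eq)
        then show ?thesis by simp
      next
        case False
        then have "u v = 0" if "u \<in> B" for u using Bsub[OF that] by (auto simp: config_space_def)
        then have "(\<Sum>u\<in>B. a u *\<^sub>R u v) = 0" by (intro sum.neutral) auto
        then show ?thesis by (simp add: sum_fun_at)
      qed
    qed
    moreover have "indep_family B (\<lambda>u. u)"
      using B(2) finB by (simp add: indep_family_iff)
    ultimately show "a u = 0" using indep_familyD[OF _ _ u, of "\<lambda>u. u" a] by blast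
  qed
  have "card E + card B \<le> card (V \<times> {1..d})"
  proof (rule card_orthogonal_families[OF rows fin(2) ind_g finB])
    show "finite (V \<times> {1..d})" using fin by simp
    show "rigidity_matrix d b p e j = 0" if "e \<in> E" "j \<notin> V \<times> {1..d}" for e j
      unfolding rigidity_matrix_eq_edge_row by (rule edge_row_support[OF G that])
    show "g u j = 0" if "j \<notin> V \<times> {1..d}" for u j
      using that by (cases j) (auto simp: g_def)
    fix e u assume e: "e \<in> E" and u: "u \<in> B"
    obtain v w where vw: "e = {v, w}" "v \<in> V" "w \<in> V" "v \<noteq> w" by (rule simple_graph_edgeE[OF G e])
    have "p v \<noteq> p w" using pl e vw(1) unfolding placement_def by blast
    then have ne: "p v - p w \<noteq> 0" "p w - p v \<noteq> 0" by auto
    define h where "h x = (\<Sum>k\<in>{1..d}. rigidity_matrix d b p e (x, k) * g u (x, k))" for x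
    have "(\<Sum>j\<in>V \<times> {1..d}. rigidity_matrix d b p e j * g u j) = (\<Sum>x\<in>V. h x)"
      unfolding h_def sum.cartesian_product by (rule sum.cong) auto
    also have "\<dots> = (\<Sum>x\<in>{v, w}. h x)"
      by (rule sum.mono_neutral_right) (use vw fin in \<open>auto simp: h_def rigidity_matrix_def\<close>)
    also have "\<dots> = h v + h w" using vw(4) by simp
    also have "h v = \<phi> (p v - p w) (u v)"
      by (subst linear_expand[OF linear_phi[OF ne(1)]])
        (use vw in \<open>simp add: h_def rigidity_matrix_def g_def the_elem_doubleton mult.commute\<close>)
    also have "h w = \<phi> (p w - p v) (u w)"
      by (subst linear_expand[OF linear_phi[OF ne(2)]])
        (use vw the_elem_doubleton[of w v] in \<open>simp add: h_def rigidity_matrix_def g_def insert_commute mult.commute\<close>)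
    also have "\<dots> = - \<phi> (p v - p w) (u w)" using phi_minus[OF ne(1)] by simp
    also have "\<phi> (p v - p w) (u v) + - \<phi> (p v - p w) (u w) = 0"
      using tangent_space_flex[of u V p v w] u B(1) vw ne by auto
    finally show "(\<Sum>j\<in>V \<times> {1..d}. rigidity_matrix d b p e j * g u j) = 0" .
  qed
  then show ?thesis using B(4) by (simp add: card_cartesian_product mult.commute)
qed

end

section \<open>Vertex splits\<close>

lemma other_endpoint:
  assumes "simple_graph V E" "e \<in> E" "v \<in> e"
  shows "{v, the_elem (e - {v})} = e"
proof -
  obtain x y where xy: "e = {x, y}" "x \<noteq> y" by (rule simple_graph_edgeE[OF assms(1,2)])
  show ?thesis
  proof (cases "v = x")
    case True
    with xy show ?thesis by (simp add: the_elem_doubleton)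
  next
    case False
    with xy assms(3) have "e = {v, x}" "v \<noteq> x" by auto
    then show ?thesis by (simp add: the_elem_doubleton)
  qed
qed

lemma edge_row_tendsto:
  assumes G: "simple_graph V E" and e: "e \<in> E"
    and lim: "\<And>u w x. {u, w} \<in> E \<Longrightarrow> ((\<lambda>t. \<theta>' t u w x) \<longlongrightarrow> \<theta> u w x) F"
  shows "((\<lambda>t. edge_row d b (\<theta>' t) e j) \<longlongrightarrow> edge_row d b \<theta> e j) F"
proof -
  obtain v k where j: "j = (v, k)" by (cases j)
  show ?thesis
  proof (cases "v \<in> e \<and> k \<in> {1..d}")
    case True
    with other_endpoint[OF G e, of v] e have "{v, the_elem (e - {v})} \<in> E" by simp
    with True show ?thesis by (simp add: j edge_row_def lim)
  next
    case False
    then have "edge_row d b \<theta>'' e j = 0" for \<theta>'' :: "'a \<Rightarrow> 'a \<Rightarrow> 'b \<Rightarrow> real"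
      by (auto simp: j edge_row_def)
    then show ?thesis by simp
  qed
qed

lemma eventually_indep_rows:
  assumes G: "simple_graph V E" and ind: "indep_family E (edge_row d b \<theta>)"
    and lim: "\<And>u w x. {u, w} \<in> E \<Longrightarrow> ((\<lambda>t. \<theta>' t u w x) \<longlongrightarrow> \<theta> u w x) F"
  shows "eventually (\<lambda>t. indep_family E (edge_row d b (\<theta>' t))) F"
  using simple_graph_finite[OF G]
  by (intro eventually_indep_family[OF ind, of "V \<times> {1..d}"] edge_row_tendsto[OF G] lim)
    (auto intro: edge_row_support[OF G])

lemma eventually_placement:
  assumes G: "simple_graph V E" and conf: "\<And>t. p' t \<in> config_space V"
    and ev: "\<And>u w. {u, w} \<in> E \<Longrightarrow> eventually (\<lambda>t. p' t u \<noteq> p' t w) F"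
  shows "eventually (\<lambda>t. placement V E (p' t)) F"
proof -
  note fin = simple_graph_finite[OF G]
  have "eventually (\<lambda>t. \<forall>u\<in>V. \<forall>w\<in>V. {u, w} \<in> E \<longrightarrow> p' t u \<noteq> p' t w) F"
  proof (intro eventually_ball_finite ballI fin)
    fix u w
    show "eventually (\<lambda>t. {u, w} \<in> E \<longrightarrow> p' t u \<noteq> p' t w) F"
      using ev[of u w] by (cases "{u, w} \<in> E") auto
  qed
  then show ?thesis
    by eventually_elim (use conf simple_graphD[OF G] in \<open>auto simp: placement_def\<close>)
qed

locale split_graph =
  fixes d :: nat and V :: "'v set" and E V' E' v0 w0 vs M
  assumes G: "simple_graph V E"
    and v0: "v0 \<in> V" and w0: "w0 \<notin> V" and inj: "inj_on vs {1..<d}"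
    and vs: "\<And>i. i \<in> {1..<d} \<Longrightarrow> {v0, vs i} \<in> E"
    and M: "M \<subseteq> {w. {v0, w} \<in> E \<and> w \<notin> vs ` {1..<d}}"
    and V': "V' = insert w0 V"
    and E': "E' = (E - {{v0, w} | w. w \<in> M}) \<union> {{w0, w} | w. w \<in> M}
            \<union> {{w0, v0}} \<union> {{w0, vs i} | i. i \<in> {1..<d}}"
begin

lemma M_edge: "w \<in> M \<Longrightarrow> {v0, w} \<in> E" and M_vs: "w \<in> M \<Longrightarrow> w \<notin> vs ` {1..<d}"
  using M by auto

lemma in_V: "w \<in> M \<Longrightarrow> w \<in> V" "w \<in> M \<Longrightarrow> w \<noteq> v0" "i \<in> {1..<d} \<Longrightarrow> vs i \<in> V" "i \<in> {1..<d} \<Longrightarrow> vs i \<noteq> v0"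
  using simple_graphD[OF G M_edge, of w] simple_graphD[OF G vs, of i] by auto

lemma v0_notin_vs: "v0 \<notin> vs ` {1..<d}"
  using in_V(4) by fastforce

lemma E'_eq: "E' = (E - (\<lambda>w. {v0, w}) ` M) \<union> (\<lambda>w. {w0, w}) ` (M \<union> insert v0 (vs ` {1..<d}))"
  unfolding E' by blast

lemma simple_graph': "simple_graph V' E'"
  unfolding simple_graph_def
proof
  show "finite V'" using simple_graph_finite[OF G] by (simp add: V')
  show "E' \<subseteq> {{v, w} | v w. v \<in> V' \<and> w \<in> V' \<and> v \<noteq> w}"
  proof
    fix e assume "e \<in> E'"
    then consider "e \<in> E" | w where "e = {w0, w}" "w \<in> V"
      unfolding E'_eq using in_V v0 by blast
    then show "e \<in> {{v, w} | v w. v \<in> V' \<and> w \<in> V' \<and> v \<noteq> w}"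
    proof cases
      case 1
      then show ?thesis by (rule simple_graph_edgeE[OF G]) (auto simp: V')
    next
      case 2
      with w0 show ?thesis by (auto simp: V')
    qed
  qed
qed

lemma edge'_w0: "{w0, w} \<in> E' \<longleftrightarrow> w \<in> M \<or> w = v0 \<or> w \<in> vs ` {1..<d}"
proof -
  have "{w0, w} \<notin> E" using simple_graphD(1)[OF G] w0 by blast
  then show ?thesis unfolding E'_eq using w0 in_V v0 by (auto simp: doubleton_eq_iff)
qed

lemma edge'_V: "u \<in> V \<Longrightarrow> w \<in> V \<Longrightarrow> {u, w} \<in> E' \<longleftrightarrow> {u, w} \<in> E \<and> {u, w} \<notin> (\<lambda>w. {v0, w}) ` M"
  unfolding E'_eq using w0 by (auto simp: doubleton_eq_iff)

text \<open>These edges survive because \<open>M\<close> avoids the vertices \<open>vs i\<close>.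
  General position of \<open>G'\<close> can thus be arranged at the same edges as for
  \<open>G\<close>.\<close>

lemma vs_edge': "i \<in> {1..<d} \<Longrightarrow> {v0, vs i} \<in> E'"
  using edge'_V[of v0 "vs i"] in_V v0 vs M_vs[of "vs i"] by (auto simp: doubleton_eq_iff)

lemma w0_neighbour: "w \<in> M \<or> w \<in> vs ` {1..<d} \<Longrightarrow> {v0, w} \<in> E"
  using M_edge vs by auto

lemma card_V': "card V' = Suc (card V)"
  using simple_graph_finite[OF G] w0 by (simp add: V')

text \<open>Replacing edges keeps their number, and the new vertex is joined to \<open>v0\<close>
  and the \<open>d - 1\<close> vertices \<open>vs i\<close>. Together with \<open>card_V'\<close>
  this leaves \<open>d |V| - |E|\<close> unchanged.\<close>

lemma card_E': assumes "1 \<le> d" shows "card E' = card E + d"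
proof -
  note fin = simple_graph_finite[OF G]
  have finM: "finite M" using fin(1) in_V(1) by (meson finite_subset subsetI)
  let ?N = "M \<union> insert v0 (vs ` {1..<d})"
  have "card (M \<union> insert v0 (vs ` {1..<d})) = card M + card (insert v0 (vs ` {1..<d}))"
    using M_vs in_V finM by (intro card_Un_disjoint) auto
  also have "card (insert v0 (vs ` {1..<d})) = Suc (card (vs ` {1..<d}))"
    by (rule card_insert_disjoint) (use in_V(4) in force)+
  also have "\<dots> = d" using card_image[OF inj] assms by simp
  finally have N: "card ?N = card M + d" .
  have inj_pair: "inj_on (\<lambda>w. {x, w}) S" for x :: 'v and S by (auto simp: inj_on_def doubleton_eq_iff)
  have "card E' = card (E - (\<lambda>w. {v0, w}) ` M) + card ((\<lambda>w. {w0, w}) ` ?N)"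
    unfolding E'_eq
  proof (rule card_Un_disjoint)
    have "e \<subseteq> V" if "e \<in> E" for e by (rule simple_graph_edgeE[OF G that]) auto
    then show "(E - (\<lambda>w. {v0, w}) ` M) \<inter> (\<lambda>w. {w0, w}) ` ?N = {}" using w0 by blast
  qed (use fin finM in auto)
  also have "\<dots> = card E - card M + (card M + d)"
  proof -
    have "card (E - (\<lambda>w. {v0, w}) ` M) = card E - card ((\<lambda>w. {v0, w}) ` M)"
      by (rule card_Diff_subset) (use M_edge finM in auto)
    then show ?thesis by (simp only: card_image[OF inj_pair] N)
  qed
  also have "\<dots> = card E + d"
  proof -
    have "card M = card ((\<lambda>w. {v0, w}) ` M)" by (simp add: card_image[OF inj_pair])
    also have "\<dots> \<le> card E" using fin(2) M_edge by (intro card_mono) auto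
    finally show ?thesis by simp
  qed
  finally show ?thesis .
qed

end

section \<open>Independence and rigidity of frameworks under a split\<close>

context smooth_convex_space
begin

text \<open>Failure for all radii \<open>1/(n+1)\<close> would give dependent placements converging
  to \<open>p\<close>, although both distinctness along edges and independence of rows persist near
  the limit.\<close>

lemma independent_framework_open:
  assumes G: "simple_graph V E" and ind: "independent_framework d b V E p"
  shows "\<exists>\<epsilon>>0. \<forall>q\<in>config_space V. (\<forall>v\<in>V. norm (q v - p v) < \<epsilon>) \<longrightarrow> independent_framework d b V E q"
proof (rule ccontr)
  assume "\<not> ?thesis"
  then have "\<exists>q\<in>config_space V. (\<forall>v\<in>V. norm (q v - p v) < inverse (real (Suc n))) \<and> \<not> independent_framework d b V E q" for n
    by (metis inverse_positive_iff_positive of_nat_0_less_iff zero_less_Suc)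
  then obtain Q where Q: "\<And>n. Q n \<in> config_space V" "\<And>n v. v \<in> V \<Longrightarrow> norm (Q n v - p v) < inverse (real (Suc n))"
    "\<And>n. \<not> independent_framework d b V E (Q n)" by metis
  have pl: "placement V E p" and rows: "indep_family E (rigidity_matrix d b p)"
    using ind by (auto simp: independent_framework_iff[OF G])
  have lim: "(\<lambda>n. Q n v) \<longlonglongrightarrow> p v" if "v \<in> V" for v
  proof -
    have "(\<lambda>n. Q n v - p v) \<longlonglongrightarrow> 0"
      by (rule Lim_null_comparison[OF _ LIMSEQ_inverse_real_of_nat])
        (use Q(2)[OF that] in \<open>simp add: less_imp_le del: of_nat_Suc\<close>)
    then show ?thesis by (simp add: LIM_zero_iff)
  qed
  have diff_lim: "(\<lambda>n. Q n u - Q n w) \<longlonglongrightarrow> p u - p w" and ne: "p u - p w \<noteq> 0" if "{u, w} \<in> E" for u w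
    using that simple_graphD[OF G that] pl by (auto intro: tendsto_diff lim simp: placement_def)
  have "eventually (\<lambda>n. placement V E (Q n)) sequentially"
  proof (rule eventually_placement[OF G Q(1)])
    fix u w assume uw: "{u, w} \<in> E"
    have "eventually (\<lambda>n. Q n u - Q n w \<noteq> 0) sequentially"
      by (rule tendsto_imp_eventually_ne[OF diff_lim[OF uw] ne[OF uw]])
    then show "eventually (\<lambda>n. Q n u \<noteq> Q n w) sequentially" by simp
  qed
  moreover have "eventually (\<lambda>n. indep_family E (rigidity_matrix d b (Q n))) sequentially"
    unfolding rigidity_matrix_eq_edge_row
    by (rule eventually_indep_rows[OF G rows[unfolded rigidity_matrix_eq_edge_row]])
      (intro tendsto_phi diff_lim ne tendsto_const)
  ultimately have "eventually (\<lambda>n. False) sequentially"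
    by eventually_elim (use Q(3) in \<open>simp add: independent_framework_iff[OF G]\<close>)
  then show False by simp
qed

text \<open>Only the vertices \<open>vs i\<close> move while \<open>v0\<close> stays; injectivity of
  \<open>vs\<close> lets the edge vectors be prescribed independently. The moves are smaller than
  the radius of openness, so independence of the framework is kept.\<close>

lemma ex_general_position_framework:
  assumes G: "simple_graph V E" and ind: "independent_graph d b V E"
    and inj: "inj_on vs {1..<d}" and vs: "\<And>i. i \<in> {1..<d} \<Longrightarrow> {v0, vs i} \<in> E"
  obtains q where "independent_framework d b V E q"
    "indep_family {1..<d} (\<lambda>i. q v0 - q (vs i))" "indep_family {1..<d} (\<lambda>i. \<phi> (q v0 - q (vs i)))"
proof -
  obtain p where p: "independent_framework d b V E p" using ind by (auto simp: independent_graph_def)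
  obtain \<epsilon> where \<epsilon>: "\<epsilon> > 0" "\<And>q. q \<in> config_space V \<Longrightarrow> (\<And>v. v \<in> V \<Longrightarrow> norm (q v - p v) < \<epsilon>)
      \<Longrightarrow> independent_framework d b V E q"
    using independent_framework_open[OF G p] by blast
  have card: "card {1..<d} < d" using dim_pos by simp
  obtain y where y: "\<And>i. i \<in> {1..<d} \<Longrightarrow> norm (y i - (p v0 - p (vs i))) < \<epsilon>"
    and y_ind: "indep_family {1..<d} y" "indep_family {1..<d} (\<lambda>i. \<phi> (y i))"
    using ex_near_general_position[OF finite_atLeastLessThan card \<epsilon>(1), of "\<lambda>i. p v0 - p (vs i)"] by blast
  define q where "q v = (if v \<in> vs ` {1..<d} then p v0 - y (the_inv_into {1..<d} vs v) else p v)" for v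
  have vs_V: "vs i \<in> V" "vs i \<noteq> v0" if "i \<in> {1..<d}" for i
    using simple_graphD[OF G vs[OF that]] by auto
  have q_vs: "q (vs i) = p v0 - y i" if "i \<in> {1..<d}" for i
    using that inj by (simp add: q_def the_inv_into_f_f)
  have "v0 \<notin> vs ` {1..<d}" using vs_V(2) by fastforce
  then have "q v0 = p v0" by (simp add: q_def)
  then have diff: "q v0 - q (vs i) = y i" if "i \<in> {1..<d}" for i using q_vs[OF that] by simp
  have "independent_framework d b V E q"
  proof (rule \<epsilon>(2))
    have "p \<in> config_space V"
      using p by (auto simp: independent_framework_def well_positioned_def placement_def)
    then show "q \<in> config_space V" using vs_V by (auto simp: config_space_def q_def)
    fix v assume "v \<in> V"
    show "norm (q v - p v) < \<epsilon>"
    proof (cases "v \<in> vs ` {1..<d}")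
      case True
      then obtain i where i: "i \<in> {1..<d}" "v = vs i" by blast
      have "q v - p v = - (y i - (p v0 - p (vs i)))" using q_vs[OF i(1)] by (simp add: i(2))
      then show ?thesis using y[OF i(1)] by (metis norm_minus_cancel)
    qed (simp add: q_def \<epsilon>(1))
  qed
  moreover have "indep_family {1..<d} (\<lambda>i. q v0 - q (vs i))" "indep_family {1..<d} (\<lambda>i. \<phi> (q v0 - q (vs i)))"
    using y_ind indep_family_cong[of "{1..<d}", OF diff]
      indep_family_cong[of "{1..<d}" "\<lambda>i. \<phi> (q v0 - q (vs i))" "\<lambda>i. \<phi> (y i)"] diff by auto
  ultimately show thesis by (rule that)
qed

text \<open>A rigid placement \<open>p\<close> may fail to be in general position, but regularity
  gives it the full rank \<open>card E\<close>, so its tangent space has dimension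
  \<open>d |V| - |E|\<close>. The one at \<open>q\<close> is at least as large by general position
  and at most as large by the orthogonality bound.\<close>

lemma rigid_graph_iff:
  assumes G: "simple_graph V E" and q: "independent_framework d b V E q"
    and v0: "v0 \<in> V" and vs: "vs ` {1..<d} \<subseteq> V" and gp: "indep_family {1..<d} (\<lambda>i. q v0 - q (vs i))"
  shows "rigid_graph d b V E \<longleftrightarrow> int (card E) = int (d * card V) - int (dim (tangent_space (orbit V q) q))"
proof -
  note fin = simple_graph_finite[OF G]
  have rank_le: "rigidity_rank d b E p \<le> card E" for p
  proof -
    have "rigidity_rank d b E p \<le> card (rigidity_matrix d b p ` E)"
      unfolding rigidity_rank_def using fin
      by (intro real_vector.dim_le_card) (auto intro: span_base)
    also have "\<dots> \<le> card E" by (rule card_image_le[OF fin(2)])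
    finally show ?thesis .
  qed
  have rank_q: "rigidity_rank d b E q = card E"
    using q by (simp add: independent_framework_def rigidity_rank_def real_vector.dim_eq_card_independent card_image)
  have wp_q: "well_positioned V E q" using q by (simp add: independent_framework_def)
  have reg_q: "regular_framework d b V E q"
    unfolding regular_framework_def rank_q using rank_le wp_q by blast
  have conf_q: "q \<in> config_space V" using wp_q by (simp add: well_positioned_def placement_def)
  have le: "dim (tangent_space (orbit V q) q) + card E \<le> d * card V"
    by (rule dim_tangent_space_add_card_le[OF G q])
  show ?thesis
  proof
    assume "rigid_graph d b V E"
    then obtain p where p: "rigid_framework d b V E p" by (auto simp: rigid_graph_def)
    then have "rigidity_rank d b E q \<le> rigidity_rank d b E p"
      using wp_q by (simp add: rigid_framework_def regular_framework_def)
    with rank_le[of p] have "rigidity_rank d b E p = card E" by (simp add: rank_q)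
    moreover have "dim (tangent_space (orbit V p) p) \<le> dim (tangent_space (orbit V q) q)"
      by (rule dim_tangent_space_le[OF fin(1) fin(1) conf_q v0 _ _ vs gp]) auto
    ultimately show "int (card E) = int (d * card V) - int (dim (tangent_space (orbit V q) q))"
      using p le unfolding rigid_framework_def by linarith
  next
    assume "int (card E) = int (d * card V) - int (dim (tangent_space (orbit V q) q))"
    then show "rigid_graph d b V E"
      unfolding rigid_graph_def rigid_framework_def using reg_q rank_q by auto
  qed
qed

text \<open>The limit of the row of \<open>w0 v0\<close>, rescaled by \<open>1/t\<close>, as \<open>w0\<close> tends to \<open>v0\<close> along
  \<open>p v0 + t z\<close>; all other rows converge to those at \<open>w0 = v0\<close>. A stress of the limit collapses to
  a stress of \<open>G\<close>.\<close>
lemma stress_free_split: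
  assumes split: "split_graph d V E V' E' v0 w0 vs M"
    and sf: "stress_free V E (\<lambda>u w. \<phi> (p u - p w))"
    and ne: "\<And>i. i \<in> {1..<d} \<Longrightarrow> p v0 - p (vs i) \<noteq> 0"
    and ind: "indep_family {1..<d} (\<lambda>i. \<phi> (p v0 - p (vs i)))"
    and z: "z \<noteq> 0" "\<And>i. i \<in> {1..<d} \<Longrightarrow> \<phi> (p v0 - p (vs i)) z = 0"
    and \<theta>: "\<And>u w. u \<in> V \<Longrightarrow> w \<in> V \<Longrightarrow> \<theta> u w = \<phi> (p u - p w)"
      "\<And>u. u \<in> V \<Longrightarrow> u \<noteq> v0 \<Longrightarrow> \<theta> u w0 = \<phi> (p u - p v0)"
      "\<And>u. u \<in> V \<Longrightarrow> u \<noteq> v0 \<Longrightarrow> \<theta> w0 u = \<phi> (p v0 - p u)"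
      "\<theta> w0 v0 = \<phi> z" "\<theta> v0 w0 = \<phi> (- z)"
  shows "stress_free V' E' \<theta>"
  unfolding stress_free_def
proof (intro allI impI, elim conjE)
  interpret split_graph d V E V' E' v0 w0 vs M by (rule split)
  note fin = simple_graph_finite[OF G]
  fix \<omega> :: "'b \<Rightarrow> 'b \<Rightarrow> real" and a c
  assume sym: "\<forall>u w. \<omega> u w = \<omega> w u" and off: "\<forall>u w. {u, w} \<notin> E' \<longrightarrow> \<omega> u w = 0"
    and eq: "\<forall>u\<in>V'. \<forall>x. (\<Sum>w\<in>V'. \<omega> u w * \<theta> u w x) = 0"
  have eq_V: "\<omega> u w0 * \<theta> u w0 x + (\<Sum>w\<in>V. \<omega> u w * \<theta> u w x) = 0" if "u \<in> V'" for u x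
    using eq[rule_format, OF that, of x] fin w0 by (simp add: V')
  have loop: "\<omega> u u = 0" for u
    using off simple_graphD(3)[OF simple_graph', of u u] by blast
  have split_v0: "(\<Sum>w\<in>V. f w) = f v0 + (\<Sum>w\<in>V - {v0}. f w)" for f :: "'b \<Rightarrow> real"
    using fin v0 by (simp add: sum.remove)
  \<comment> \<open>Contraction of \<open>w0\<close> onto \<open>v0\<close>: the weight of an edge
    \<open>w0 w\<close> is added to that of \<open>v0 w\<close>.\<close>
  define \<omega>' where "\<omega>' u w = (if u \<in> V \<and> w \<in> V
    then \<omega> u w + (if u = v0 \<and> w \<noteq> v0 then \<omega> w0 w else 0) + (if w = v0 \<and> u \<noteq> v0 then \<omega> u w0 else 0)
    else 0)" for u w
  have w0_off: "\<omega> w0 w = 0" if "w \<noteq> v0" "{v0, w} \<notin> E" for w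
    using off that edge'_w0[of w] w0_neighbour[of w] by blast
  have \<omega>': "\<omega>' u w = 0" for u w
  proof (rule stress_freeD[OF sf])
    show "\<omega>' u w = \<omega>' w u" for u w using sym by (auto simp: \<omega>'_def)
    show "\<omega>' u w = 0" if uw: "{u, w} \<notin> E" for u w
    proof (cases "u \<in> V \<and> w \<in> V")
      case True
      have 1: "\<omega> u w = 0" using off edge'_V True uw by blast
      have 2: "\<omega> w0 w = 0" if "u = v0" "w \<noteq> v0" using w0_off that uw by blast
      have 3: "\<omega> u w0 = 0" if "w = v0" "u \<noteq> v0"
        using w0_off[of u] that uw sym by (metis insert_commute)
      show ?thesis using 1 2 3 by (simp add: \<omega>'_def)
    qed (simp only: \<omega>'_def if_False)
    show "(\<Sum>w\<in>V. \<omega>' u w * \<phi> (p u - p w) x) = 0" if u: "u \<in> V" for u x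
    proof (cases "u = v0")
      case False
      have "(\<Sum>w\<in>V. \<omega>' u w * \<phi> (p u - p w) x)
          = \<omega>' u v0 * \<phi> (p u - p v0) x + (\<Sum>w\<in>V - {v0}. \<omega>' u w * \<phi> (p u - p w) x)"
        by (rule split_v0)
      also have "\<dots> = (\<omega> u v0 + \<omega> u w0) * \<phi> (p u - p v0) x + (\<Sum>w\<in>V - {v0}. \<omega> u w * \<phi> (p u - p w) x)"
        using u v0 False by (simp add: \<omega>'_def)
      also have "\<dots> = \<omega> u w0 * \<phi> (p u - p v0) x + (\<Sum>w\<in>V. \<omega> u w * \<phi> (p u - p w) x)"
        by (simp add: split_v0[of "\<lambda>w. \<omega> u w * \<phi> (p u - p w) x"] algebra_simps)
      also have "\<dots> = \<omega> u w0 * \<theta> u w0 x + (\<Sum>w\<in>V. \<omega> u w * \<theta> u w x)"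
        using u False by (simp add: \<theta>)
      also have "\<dots> = 0" by (rule eq_V) (use u in \<open>simp add: V'\<close>)
      finally show ?thesis .
    next
      case True
      have "(\<Sum>w\<in>V. \<omega>' v0 w * \<phi> (p v0 - p w) x)
          = \<omega>' v0 v0 * \<phi> (p v0 - p v0) x + (\<Sum>w\<in>V - {v0}. \<omega>' v0 w * \<phi> (p v0 - p w) x)"
        by (rule split_v0)
      \<comment> \<open>The diagonal term vanishes with its weight, since \<open>E'\<close> has no
        loops. Up to the edge \<open>w0 v0\<close>, the two sums are the equilibria at
        \<open>v0\<close> and at \<open>w0\<close>.\<close>
      also have "\<dots> = (\<Sum>w\<in>V - {v0}. \<omega> v0 w * \<phi> (p v0 - p w) x) + (\<Sum>w\<in>V - {v0}. \<omega> w0 w * \<phi> (p v0 - p w) x)"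
        using v0 by (simp add: \<omega>'_def loop distrib_right sum.distrib)
      also have "(\<Sum>w\<in>V - {v0}. \<omega> v0 w * \<phi> (p v0 - p w) x) = - (\<omega> v0 w0 * \<phi> (- z) x)"
        using eq_V[of v0 x] v0 by (simp add: V' split_v0 loop \<theta>)
      also have "(\<Sum>w\<in>V - {v0}. \<omega> w0 w * \<phi> (p v0 - p w) x) = - (\<omega> w0 v0 * \<phi> z x)"
        using eq_V[of w0 x] by (simp add: V' split_v0 loop \<theta>)
      \<comment> \<open>The edge \<open>w0 v0\<close> acts on its two ends with opposite
        functionals, so the contraction cancels it.\<close>
      also have "- (\<omega> v0 w0 * \<phi> (- z) x) + - (\<omega> w0 v0 * \<phi> z x) = 0"
        using sym by (simp add: phi_minus[OF z(1)])
      finally show ?thesis by (simp only: True)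
    qed
  qed
  \<comment> \<open>A replaced edge \<open>v0 w\<close> is missing from \<open>E'\<close>, so the
    contracted weight is that of \<open>w0 w\<close> alone.\<close>
  have w0_M: "\<omega> w0 w = 0" if "w \<in> M" for w
  proof -
    have "{v0, w} \<notin> E'" using edge'_V[of v0 w] v0 in_V(1)[OF that] that by blast
    then have "\<omega> v0 w = 0" using off by blast
    then show ?thesis using \<omega>'[of v0 w] v0 in_V(1)[OF that] in_V(2)[OF that] by (simp add: \<omega>'_def)
  qed
  have eq_w0: "\<omega> w0 v0 * \<phi> z x + (\<Sum>i\<in>{1..<d}. \<omega> w0 (vs i) * \<phi> (p v0 - p (vs i)) x) = 0" for x
  proof -
    have "(\<Sum>w\<in>V - {v0}. \<omega> w0 w * \<phi> (p v0 - p w) x) = (\<Sum>w\<in>vs ` {1..<d}. \<omega> w0 w * \<phi> (p v0 - p w) x)"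
    proof (rule sum.mono_neutral_right)
      show "\<forall>w\<in>V - {v0} - vs ` {1..<d}. \<omega> w0 w * \<phi> (p v0 - p w) x = 0"
        using w0_M off edge'_w0 by auto
    qed (use fin in_V(3) v0_notin_vs in auto)
    also have "\<dots> = (\<Sum>i\<in>{1..<d}. \<omega> w0 (vs i) * \<phi> (p v0 - p (vs i)) x)"
      by (simp add: sum.reindex[OF inj])
    finally show ?thesis
      using eq_V[of w0 x] by (simp add: V' split_v0 loop \<theta>)
  qed
  \<comment> \<open>Evaluation at \<open>z\<close> removes all terms with \<open>vs i\<close> and
    leaves the weight of \<open>w0 v0\<close> times \<open>(norm z)^2\<close>.\<close>
  have w0_v0: "\<omega> w0 v0 = 0"
    using eq_w0[of z] z by (simp add: phi_self)
  have "(\<Sum>i\<in>{1..<d}. \<omega> w0 (vs i) *\<^sub>R \<phi> (p v0 - p (vs i))) = 0"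
    using eq_w0 by (simp add: fun_eq_iff sum_fun_at w0_v0)
  then have w0_vs: "\<omega> w0 (vs i) = 0" if "i \<in> {1..<d}" for i
    using indep_familyD[OF ind _ that, of "\<lambda>i. \<omega> w0 (vs i)"] by blast
  have w0_all: "\<omega> w0 w = 0" for w
    using off edge'_w0[of w] w0_v0 w0_vs w0_M by blast
  show "\<omega> a c = 0"
  proof (cases "{a, c} \<in> E'")
    case True
    then have "a \<in> V'" "c \<in> V'" using simple_graphD[OF simple_graph'] by blast+
    then consider "a = w0" | "c = w0" | "a \<in> V" "c \<in> V" by (auto simp: V')
    then show ?thesis
    proof cases
      case 1 then show ?thesis using w0_all by simp
    next
      case 2 then show ?thesis using w0_all[of a] sym by simp
    next
      case 3
      moreover have "\<omega> a w0 = 0" using w0_all[of a] sym by simp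
      ultimately show ?thesis using \<omega>'[of a c] w0_all[of c] by (simp add: \<omega>'_def split: if_splits)
    qed
  qed (use off in blast)
qed

lemma independent_graph_split:
  assumes split: "split_graph d V E V' E' v0 w0 vs M" and ind_G: "independent_graph d b V E"
  shows "independent_graph d b V' E'"
proof -
  interpret split_graph d V E V' E' v0 w0 vs M by (rule split)
  obtain p where p: "independent_framework d b V E p"
    and gp: "indep_family {1..<d} (\<lambda>i. \<phi> (p v0 - p (vs i)))"
    by (rule ex_general_position_framework[OF G ind_G inj vs])
  have pl: "placement V E p" and rows: "indep_family E (rigidity_matrix d b p)"
    using p by (auto simp: independent_framework_iff[OF G])
  have p_ne: "p u - p w \<noteq> 0" if "{u, w} \<in> E" for u w using pl that by (simp add: placement_def)
  obtain z where z: "z \<noteq> 0" "\<And>i. i \<in> {1..<d} \<Longrightarrow> \<phi> (p v0 - p (vs i)) z = 0"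
    by (rule ex_common_zero[of "{1..<d}" "\<lambda>i. \<phi> (p v0 - p (vs i))"])
      (use dim_pos linear_phi p_ne vs in auto)
  define p' where "p' t = p(w0 := p v0 + t *\<^sub>R z)" for t
  \<comment> \<open>On the edge \<open>w0 v0\<close> this is \<phi> at \<open>t z\<close> divided by
    \<open>t\<close>, which does not depend on \<open>t\<close> and remains meaningful at
    \<open>t = 0\<close>, where the two vertices coincide.\<close>
  define \<theta>' where "\<theta>' t u w = (if u = w0 \<and> w = v0 then \<phi> z else if u = v0 \<and> w = w0 then \<phi> (- z)
    else \<phi> (p' t u - p' t w))" for t u w
  have w0v0: "w0 \<noteq> v0" using w0 v0 by blast
  have lim: "((\<lambda>t. p' t u) \<longlongrightarrow> p' 0 u) (at_right 0)" for u
  proof (cases "u = w0")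
    case True
    have "((\<lambda>t. p v0 + t *\<^sub>R z) \<longlongrightarrow> p v0 + 0 *\<^sub>R z) (at_right 0)" by (intro tendsto_intros)
    then show ?thesis by (simp add: True p'_def)
  qed (simp add: p'_def)
  \<comment> \<open>Placing \<open>w0\<close> at \<open>v0\<close> collapses only the edge between
    them: every other neighbour of \<open>w0\<close> is a neighbour of \<open>v0\<close> in
    \<open>G\<close>.\<close>
  have special: "p' 0 u - p' 0 w \<noteq> 0" if uw: "{u, w} \<in> E'" "{u, w} \<noteq> {w0, v0}" for u w
  proof -
    have *: "p v0 - p w \<noteq> 0" if "{w0, w} \<in> E'" "w \<noteq> v0" for w
      using that edge'_w0[of w] w0_neighbour[of w] p_ne by blast
    have "u \<in> V'" "w \<in> V'" "u \<noteq> w" using simple_graphD[OF simple_graph' uw(1)] by auto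
    then consider "u = w0" "w \<noteq> w0" "w \<noteq> v0" | "w = w0" "u \<noteq> w0" "u \<noteq> v0" | "u \<in> V" "w \<in> V" "u \<noteq> w0" "w \<noteq> w0"
      using uw(2) w0 by (auto simp: V')
    then show ?thesis
    proof cases
      case 1 then show ?thesis using *[of w] uw(1) by (simp add: p'_def)
    next
      case 2 then show ?thesis using *[of u] uw(1) by (simp add: p'_def insert_commute)
    next
      case 3
      then have "{u, w} \<in> E" using edge'_V uw(1) by blast
      then show ?thesis using p_ne 3 by (simp add: p'_def)
    qed
  qed
  have sf: "stress_free V' E' (\<theta>' 0)"
  proof (rule stress_free_split[OF split _ _ gp z])
    show "stress_free V E (\<lambda>u w. \<phi> (p u - p w))"
      using rows unfolding rigidity_matrix_eq_edge_row by (rule stress_free_if_indep_rows[OF G])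
    show "p v0 - p (vs i) \<noteq> 0" if "i \<in> {1..<d}" for i using p_ne vs[OF that] by blast
  qed (use w0 w0v0 in \<open>auto simp: \<theta>'_def p'_def\<close>)
  have lin: "linear (\<theta>' 0 u w)" if "{u, w} \<in> E'" for u w
    using special[OF that] z(1) linear_phi unfolding \<theta>'_def by (auto simp: doubleton_eq_iff)
  have \<theta>_lim: "((\<lambda>t. \<theta>' t u w x) \<longlongrightarrow> \<theta>' 0 u w x) (at_right 0)" if "{u, w} \<in> E'" for u w x
  proof (cases "{u, w} = {w0, v0}")
    case True
    then show ?thesis by (auto simp: \<theta>'_def doubleton_eq_iff)
  next
    case False
    have "((\<lambda>t. \<phi> (p' t u - p' t w) x) \<longlongrightarrow> \<phi> (p' 0 u - p' 0 w) x) (at_right 0)"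
      by (intro tendsto_phi tendsto_diff lim tendsto_const special that False)
    with False show ?thesis by (auto simp: \<theta>'_def)
  qed
  have "eventually (\<lambda>t. indep_family E' (edge_row d b (\<theta>' t))) (at_right 0)"
    by (rule eventually_indep_rows[OF simple_graph' indep_rows_if_stress_free[OF simple_graph' lin sf] \<theta>_lim])
  moreover have "eventually (\<lambda>t. placement V' E' (p' t)) (at_right 0)"
  proof (rule eventually_placement[OF simple_graph'])
    show "p' t \<in> config_space V'" for t
      using pl w0 by (auto simp: p'_def placement_def config_space_def V')
    fix u w assume uw: "{u, w} \<in> E'"
    show "eventually (\<lambda>t. p' t u \<noteq> p' t w) (at_right 0)"
    proof (cases "{u, w} = {w0, v0}")
      case True
      have "eventually (\<lambda>t. t > 0) (at_right (0::real))" by (rule eventually_at_right_less)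
      then show ?thesis
        by eventually_elim (use True z(1) w0v0 in \<open>auto simp: p'_def doubleton_eq_iff\<close>)
    next
      case False
      have "eventually (\<lambda>t. p' t u - p' t w \<noteq> 0) (at_right 0)"
        by (rule tendsto_imp_eventually_ne[OF tendsto_diff[OF lim lim] special[OF uw False]])
      then show ?thesis by simp
    qed
  qed
  moreover have "eventually (\<lambda>t. t > 0) (at_right (0::real))" by (rule eventually_at_right_less)
  ultimately have "eventually (\<lambda>t. independent_framework d b V' E' (p' t)) (at_right 0)"
  proof eventually_elim
    case (elim t)
    \<comment> \<open>Undoes the division by \<open>t\<close>: the actual rows are nonzero multiples
      of the rescaled ones, so independence carries over.\<close>
    define s where "s e = (if e = {w0, v0} then t else 1)" for e
    have row: "rigidity_matrix d b (p' t) e = s e *\<^sub>R edge_row d b (\<theta>' t) e" if e: "e \<in> E'" for e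
    proof -
      have \<theta>s: "\<phi> (p' t u - p' t w) = (\<lambda>a. s {u, w} * \<theta>' t u w a)" for u w
      proof -
        consider "u = w0" "w = v0" | "u = v0" "w = w0" | "{u, w} \<noteq> {w0, v0}"
          by (auto simp: doubleton_eq_iff)
        then show ?thesis
        proof cases
          case 1
          then show ?thesis using phi_scale[OF z(1), of t] elim w0v0
            by (auto simp: fun_eq_iff p'_def \<theta>'_def s_def)
        next
          case 2
          then show ?thesis using phi_scale[of "- z" t] z(1) elim w0v0
            by (auto simp: fun_eq_iff p'_def \<theta>'_def s_def insert_commute)
        next
          case 3
          then have "\<not> (u = w0 \<and> w = v0)" "\<not> (u = v0 \<and> w = w0)" by (auto simp: insert_commute)
          then have "\<theta>' t u w = \<phi> (p' t u - p' t w)" unfolding \<theta>'_def by (simp only: if_False)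
          moreover have "s {u, w} = 1" using 3 unfolding s_def by (rule if_not_P)
          ultimately show ?thesis by simp
        qed
      qed
      show ?thesis
      proof (rule ext, unfold rigidity_matrix_eq_edge_row)
        fix j :: "'b \<times> nat"
        obtain v k where j: "j = (v, k)" by (cases j)
        show "edge_row d b (\<lambda>u w. \<phi> (p' t u - p' t w)) e j = (s e *\<^sub>R edge_row d b (\<theta>' t) e) j"
        proof (cases "v \<in> e \<and> k \<in> {1..d}")
          case True
          then have "s {v, the_elem (e - {v})} = s e" using other_endpoint[OF simple_graph' e] by simp
          with True show ?thesis by (simp add: j edge_row_def \<theta>s)
        next
          case False
          then show ?thesis by (auto simp: j edge_row_def)
        qed
      qed
    qed
    have "indep_family E' (rigidity_matrix d b (p' t))"
    proof (rule indep_familyI)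
      fix c e assume c: "(\<Sum>e\<in>E'. c e *\<^sub>R rigidity_matrix d b (p' t) e) = 0" and e: "e \<in> E'"
      have "(\<Sum>e\<in>E'. (c e * s e) *\<^sub>R edge_row d b (\<theta>' t) e) = 0"
        using c by (simp add: row)
      then have "c e * s e = 0" using indep_familyD[OF elim(1) _ e, of "\<lambda>e. c e * s e"] by blast
      then show "c e = 0" using elim(3) by (auto simp: s_def split: if_splits)
    qed
    then show ?case using elim(2) by (simp add: independent_framework_iff[OF simple_graph'])
  qed
  then obtain t where "independent_framework d b V' E' (p' t)"
    using eventually_happens trivial_limit_at_right_real by blast
  then show ?thesis by (auto simp: independent_graph_def)
qed

text \<open>The placements of \<open>G\<close> and \<open>G'\<close> are chosen without relation to
  each other. Both are in general position, so comparing tangent spaces in both directions shows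
  that the dimensions agree.\<close>

lemma rigid_graph_split_iff:
  assumes split: "split_graph d V E V' E' v0 w0 vs M"
    and ind: "independent_graph d b V E" "independent_graph d b V' E'"
  shows "rigid_graph d b V' E' \<longleftrightarrow> rigid_graph d b V E"
proof -
  interpret split_graph d V E V' E' v0 w0 vs M by (rule split)
  note fin = simple_graph_finite(1)[OF G] simple_graph_finite(1)[OF simple_graph']
  obtain q where q: "independent_framework d b V E q" "indep_family {1..<d} (\<lambda>i. q v0 - q (vs i))"
    by (rule ex_general_position_framework[OF G ind(1) inj vs])
  obtain q' where q': "independent_framework d b V' E' q'" "indep_family {1..<d} (\<lambda>i. q' v0 - q' (vs i))"
    by (rule ex_general_position_framework[OF simple_graph' ind(2) inj vs_edge'])
  have conf: "q \<in> config_space V" "q' \<in> config_space V'"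
    using q(1) q'(1) by (auto simp: independent_framework_def well_positioned_def placement_def)
  have sub: "vs ` {1..<d} \<subseteq> V" "vs ` {1..<d} \<subseteq> V'" and v0': "v0 \<in> V'" using in_V v0 by (auto simp: V')
  have "dim (tangent_space (orbit V q) q) = dim (tangent_space (orbit V' q') q')"
    by (intro antisym dim_tangent_space_le[OF fin(2) fin(1) conf(1) v0 _ _ sub(1) q(2)]
        dim_tangent_space_le[OF fin(1) fin(2) conf(2) v0' _ _ sub(2) q'(2)]) auto
  then show ?thesis
    unfolding rigid_graph_iff[OF G q(1) v0 sub(1) q(2)] rigid_graph_iff[OF simple_graph' q'(1) v0' sub(2) q'(2)]
    by (simp add: card_V' card_E'[OF dim_pos] algebra_simps)
qed

end

theorem proposition4p7:
  fixes d :: nat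
    and b :: "nat \<Rightarrow> 'a::real_normed_vector"
    and V V' :: "'v set"
    and E E' :: "'v set set"
  assumes "1 \<le> d"
    and "indexed_basis d b"
    and "smooth_space TYPE('a)"
    and "strictly_convex_space TYPE('a)"
    and "simple_graph V E"
    and "vertex_split d V E V' E'"
  shows "(independent_graph d b V E \<longrightarrow> independent_graph d b V' E') \<and>
         (independent_graph d b V E \<and> independent_graph d b V' E' \<longrightarrow>
            (rigid_graph d b V' E' \<longleftrightarrow> rigid_graph d b V E))"
proof -
  interpret smooth_convex_space d b
    using assms(1-4) by unfold_locales
  obtain v0 w0 vs M where split: "split_graph d V E V' E' v0 w0 vs M"
    using assms(5,6) unfolding vertex_split_def split_graph_def by blast
  show ?thesis
    using independent_graph_split[OF split] rigid_graph_split_iff[OF split] by blast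
qed

end
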